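(* Let $\alpha\in\mathbb{R}$, $B_0>0$. Let $A$ and $B$ be two disjoint measurable sets in $\mathbb{R}^2$ and suppose that $f\in L^2(A)$ and $g\in L^2(B)$, with $\operatorname{supp}(f)\subset A$ and $\operatorname{supp}(g)\subset B$. Then, for all $t>0$, $$|\langle e^{-tH_{\alpha,B_0}}f,g\rangle|\le\|f\|_{L^2(A)}\|g\|_{L^2(B)}\,e^{-\frac{d^2(A,B)}{4t}},$$ where $d(A,B)=\inf\{|x-y|:x\in A,\ y\in B\}$.
   Context: For $x=(x_1,x_2)$ put $A_B(x)=\alpha\left(-\frac{x_2}{|x|^2},\frac{x_1}{|x|^2}\right)$ on $\mathbb{R}^2\setminus\{0\}$ (here the subscript $B$ is only part of the name of the potential) and $A_{\mathrm{hmf}}(x)=\frac{B_0}{2}(-x_2,x_1)$. The operator $H_{\alpha,B_0}=-(\nabla+i(A_B+A_{\mathrm{hmf}}))^2$ denotes the Friedrichs extension, i.e. the nonnegative self-adjoint operator on $L^2(\mathbb{R}^2;\mathbb{C})$ associated with the closure of the quadratic form $Q_{\alpha,B_0}(f)=\int_{\mathbb{R}^2}|(\nabla+i(A_B+A_{\mathrm{hmf}}))f|^2\,dx$ initially defined on $C_c^\infty(\mathbb{R}^2\setminus\{0\};\mathbb{C})$. The heat semigroup $e^{-tH_{\alpha,B_0}}$ is defined by the spectral functional calculus, and $\langle\cdot,\cdot\rangle$ is the inner product of $L^2(\mathbb{R}^2)$; functions in $L^2(A)$, $L^2(B)$ are extended by zero to $\mathbb{R}^2$. *)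

theory Defs
  imports "HOL-Analysis.Analysis"
begin

text \<open>
  Elements of \<open>L\<^sup>2(M; \<complex>)\<close> are represented by functions, and equality in \<open>L\<^sup>2\<close> is equality
  almost everywhere.  Operators in \<open>L\<^sup>2\<close> are given by their graphs, which are relations between
  representatives that are closed under equality almost everywhere.
\<close>

definition l2_space :: "'a measure \<Rightarrow> ('a \<Rightarrow> complex) set" where
  "l2_space M = {f \<in> borel_measurable M. integrable M (\<lambda>x. (cmod (f x))\<^sup>2)}"

definition l2_inner :: "'a measure \<Rightarrow> ('a \<Rightarrow> complex) \<Rightarrow> ('a \<Rightarrow> complex) \<Rightarrow> complex" where
  "l2_inner M f g = (\<integral>x. f x * cnj (g x) \<partial>M)"

definition l2_norm :: "'a measure \<Rightarrow> ('a \<Rightarrow> complex) \<Rightarrow> real" where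
  "l2_norm M f = sqrt (\<integral>x. (cmod (f x))\<^sup>2 \<partial>M)"

definition form_approx ::
  "'a measure \<Rightarrow> ('a \<Rightarrow> complex) set \<Rightarrow> (('a \<Rightarrow> complex) \<Rightarrow> real) \<Rightarrow>
   (nat \<Rightarrow> 'a \<Rightarrow> complex) \<Rightarrow> ('a \<Rightarrow> complex) \<Rightarrow> bool" where
  "form_approx M D Q \<phi> f \<longleftrightarrow>
     f \<in> l2_space M \<and> (\<forall>n. \<phi> n \<in> D) \<and>
     (\<lambda>n. l2_norm M (\<lambda>x. \<phi> n x - f x)) \<longlonglongrightarrow> 0 \<and>
     (\<forall>e>0. \<exists>N. \<forall>m\<ge>N. \<forall>n\<ge>N. Q (\<lambda>x. \<phi> m x - \<phi> n x) < e)"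

definition closure_domain ::
  "'a measure \<Rightarrow> ('a \<Rightarrow> complex) set \<Rightarrow> (('a \<Rightarrow> complex) \<Rightarrow> real) \<Rightarrow> ('a \<Rightarrow> complex) set" where
  "closure_domain M D Q = {f. \<exists>\<phi>. form_approx M D Q \<phi> f}"

text \<open>For a closable form \<open>Q\<close> on \<open>D\<close> the limit does not depend on the approximating sequence.\<close>

definition closure_form ::
  "'a measure \<Rightarrow> ('a \<Rightarrow> complex) set \<Rightarrow> (('a \<Rightarrow> complex) \<Rightarrow> real) \<Rightarrow> ('a \<Rightarrow> complex) \<Rightarrow> real" where
  "closure_form M D Q f =
     (THE c. \<forall>\<phi>. form_approx M D Q \<phi> f \<longrightarrow> (\<lambda>n. Q (\<phi> n)) \<longlonglongrightarrow> c)"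

text \<open>The sesquilinear form of a quadratic form, linear in its first argument (as \<open>l2_inner\<close> is).\<close>

definition polar_form ::
  "(('a \<Rightarrow> complex) \<Rightarrow> real) \<Rightarrow> ('a \<Rightarrow> complex) \<Rightarrow> ('a \<Rightarrow> complex) \<Rightarrow> complex" where
  "polar_form Q f g =
     (\<Sum>k<4. \<i> ^ k * complex_of_real (Q (\<lambda>x. f x + \<i> ^ k * g x))) / 4"

definition form_operator ::
  "'a measure \<Rightarrow> ('a \<Rightarrow> complex) set \<Rightarrow> (('a \<Rightarrow> complex) \<Rightarrow> real) \<Rightarrow>
   (('a \<Rightarrow> complex) \<times> ('a \<Rightarrow> complex)) set" where
  "form_operator M D Q =
     {(f, h). f \<in> closure_domain M D Q \<and> h \<in> l2_space M \<and>
        (\<forall>g \<in> closure_domain M D Q. polar_form (closure_form M D Q) f g = l2_inner M h g)}"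

text \<open>
  Projection-valued measures on the Borel sets of \<open>\<real>\<close>.  A symmetric map defined on all of \<open>L\<^sup>2\<close> is
  linear and respects equality almost everywhere, so these properties are not listed.  Additivity
  of all the measures \<open>S \<mapsto> \<langle>E S f, f\<rangle>\<close> amounts to additivity of \<open>E\<close> in the strong sense.
\<close>

definition projection_valued_measure ::
  "'a measure \<Rightarrow> (real set \<Rightarrow> ('a \<Rightarrow> complex) \<Rightarrow> 'a \<Rightarrow> complex) \<Rightarrow> bool" where
  "projection_valued_measure M E \<longleftrightarrow>
     (\<forall>S \<in> sets borel. \<forall>f \<in> l2_space M. E S f \<in> l2_space M) \<and>
     (\<forall>S \<in> sets borel. \<forall>f \<in> l2_space M. \<forall>g \<in> l2_space M.
        l2_inner M (E S f) g = l2_inner M f (E S g)) \<and>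
     (\<forall>S \<in> sets borel. \<forall>T \<in> sets borel. \<forall>f \<in> l2_space M.
        AE x in M. E S (E T f) x = E (S \<inter> T) f x) \<and>
     (\<forall>f \<in> l2_space M. AE x in M. E UNIV f x = f x) \<and>
     (\<forall>f \<in> l2_space M. \<forall>S :: nat \<Rightarrow> real set. range S \<subseteq> sets borel \<and> disjoint_family S \<longrightarrow>
        (\<lambda>n. l2_inner M (E (S n) f) f) sums l2_inner M (E (\<Union>n. S n) f) f)"

definition scalar_spectral_measure ::
  "'a measure \<Rightarrow> (real set \<Rightarrow> ('a \<Rightarrow> complex) \<Rightarrow> 'a \<Rightarrow> complex) \<Rightarrow> ('a \<Rightarrow> complex) \<Rightarrow> real measure" where
  "scalar_spectral_measure M E f =
     measure_of UNIV (sets borel) (\<lambda>S. ennreal (Re (l2_inner M (E S f) f)))"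

definition simple_spectral_integral ::
  "(real set \<Rightarrow> ('a \<Rightarrow> complex) \<Rightarrow> 'a \<Rightarrow> complex) \<Rightarrow> (real \<Rightarrow> complex) \<Rightarrow> ('a \<Rightarrow> complex) \<Rightarrow> 'a \<Rightarrow> complex" where
  "simple_spectral_integral E s f = (\<lambda>x. \<Sum>c \<in> range s. c * E (s -` {c}) f x)"

text \<open>
  The graph of \<open>\<integral>\<phi> dE\<close>: its domain consists of the \<open>f\<close> with \<open>\<phi> \<in> L\<^sup>2(\<mu>\<^sub>f)\<close>, where \<open>\<mu>\<^sub>f\<close> is the scalar
  spectral measure, and its value at \<open>f\<close> is the limit of the integrals of simple functions
  converging to \<open>\<phi>\<close> in \<open>L\<^sup>2(\<mu>\<^sub>f)\<close>.
\<close>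

definition spectral_integral ::
  "'a measure \<Rightarrow> (real set \<Rightarrow> ('a \<Rightarrow> complex) \<Rightarrow> 'a \<Rightarrow> complex) \<Rightarrow> (real \<Rightarrow> complex) \<Rightarrow>
   (('a \<Rightarrow> complex) \<times> ('a \<Rightarrow> complex)) set" where
  "spectral_integral M E \<phi> =
     {(f, u). f \<in> l2_space M \<and> u \<in> l2_space M \<and>
        (\<exists>s :: nat \<Rightarrow> real \<Rightarrow> complex. (\<forall>n. simple_function borel (s n)) \<and>
           (\<lambda>n. \<integral>\<^sup>+ r. ennreal ((cmod (s n r - \<phi> r))\<^sup>2) \<partial>scalar_spectral_measure M E f) \<longlonglongrightarrow> 0 \<and>
           (\<lambda>n. l2_norm M (\<lambda>x. simple_spectral_integral E (s n) f x - u x)) \<longlonglongrightarrow> 0)}"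

text \<open>
  The graph of \<open>\<phi>(H)\<close> for a self-adjoint operator with graph \<open>H\<close>.  By the spectral theorem,
  \<open>H = \<integral>r dE(r)\<close> for one and, up to equality almost everywhere, only one \<open>E\<close>.  If the measurable
  function \<open>\<phi>\<close> is bounded on the spectrum of \<open>H\<close>, then every \<open>f\<close> in \<open>L\<^sup>2\<close> has an image, unique up to
  equality almost everywhere, and the pairs \<open>(f, u)\<close> list all its representatives \<open>u\<close>.
\<close>

definition functional_calculus ::
  "'a measure \<Rightarrow> (('a \<Rightarrow> complex) \<times> ('a \<Rightarrow> complex)) set \<Rightarrow> (real \<Rightarrow> complex) \<Rightarrow>
   (('a \<Rightarrow> complex) \<times> ('a \<Rightarrow> complex)) set" where
  "functional_calculus M H \<phi> =
     {(f, u). \<exists>E. projection_valued_measure M E \<and> H = spectral_integral M E complex_of_real \<and>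
        (f, u) \<in> spectral_integral M E \<phi>}"

primrec C_k :: "nat \<Rightarrow> (real^2 \<Rightarrow> complex) \<Rightarrow> bool" where
  "C_k 0 f \<longleftrightarrow> continuous_on UNIV f"
| "C_k (Suc n) f \<longleftrightarrow>
     (\<forall>x. f differentiable (at x)) \<and> (\<forall>v. C_k n (\<lambda>x. frechet_derivative f (at x) v))"

definition test_functions :: "(real^2 \<Rightarrow> complex) set" where
  "test_functions = {f. (\<forall>k. C_k k f) \<and> compact (closure {x. f x \<noteq> 0}) \<and> 0 \<notin> closure {x. f x \<noteq> 0}}"

definition A_B :: "real \<Rightarrow> real^2 \<Rightarrow> real^2" where
  "A_B \<alpha> x = \<alpha> *\<^sub>R vector [- (x $ 2) / (norm x)\<^sup>2, x $ 1 / (norm x)\<^sup>2]"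

definition A_hmf :: "real \<Rightarrow> real^2 \<Rightarrow> real^2" where
  "A_hmf B\<^sub>0 x = (B\<^sub>0 / 2) *\<^sub>R vector [- (x $ 2), x $ 1]"

definition magnetic_gradient :: "real \<Rightarrow> real \<Rightarrow> (real^2 \<Rightarrow> complex) \<Rightarrow> real^2 \<Rightarrow> complex^2" where
  "magnetic_gradient \<alpha> B\<^sub>0 f x =
     (\<chi> j. frechet_derivative f (at x) (axis j 1) +
           \<i> * complex_of_real ((A_B \<alpha> x + A_hmf B\<^sub>0 x) $ j) * f x)"

definition Q_form :: "real \<Rightarrow> real \<Rightarrow> (real^2 \<Rightarrow> complex) \<Rightarrow> real" where
  "Q_form \<alpha> B\<^sub>0 f = (\<integral>x. (norm (magnetic_gradient \<alpha> B\<^sub>0 f x))\<^sup>2 \<partial>lebesgue)"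

definition H_op :: "real \<Rightarrow> real \<Rightarrow> ((real^2 \<Rightarrow> complex) \<times> (real^2 \<Rightarrow> complex)) set" where
  "H_op \<alpha> B\<^sub>0 = form_operator lebesgue test_functions (Q_form \<alpha> B\<^sub>0)"

definition heat_semigroup ::
  "real \<Rightarrow> real \<Rightarrow> real \<Rightarrow> ((real^2 \<Rightarrow> complex) \<times> (real^2 \<Rightarrow> complex)) set" where
  "heat_semigroup \<alpha> B\<^sub>0 t =
     functional_calculus lebesgue (H_op \<alpha> B\<^sub>0) (\<lambda>r. complex_of_real (exp (- t * r)))"

definition zero_ext :: "(real^2) set \<Rightarrow> (real^2 \<Rightarrow> complex) \<Rightarrow> real^2 \<Rightarrow> complex" where
  "zero_ext A f = (\<lambda>x. if x \<in> A then f x else 0)"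

text \<open>The complement of the largest open set on which \<open>f\<close> vanishes almost everywhere.\<close>

definition ess_support :: "(real^2 \<Rightarrow> complex) \<Rightarrow> (real^2) set" where
  "ess_support f = {x. \<forall>U. open U \<and> x \<in> U \<longrightarrow> \<not> (AE y in lebesgue. y \<in> U \<longrightarrow> f y = 0)}"

end

theory Submission
  imports Defs "HOL-Complex_Analysis.Cauchy_Integral_Formula"
begin

text \<open>
  The estimate is an instance of the exponential-weight method of Davies and Gaffney.  Let
  \<open>\<omega> = exp (- 2 a \<rho>)\<close>, where \<open>\<rho>\<close> is a smooth stand-in for the distance from \<open>B\<close> with
  \<open>\<bar>\<nabla>\<rho>\<bar> \<le> 1\<close>.  Completing the square pointwise gives
  \<open>Re Q(w, \<omega>w) \<ge> - a\<^sup>2 \<integral>\<omega>\<bar>w\<bar>\<^sup>2\<close>: the magnetic potential enters only through the covariant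
  gradient of \<open>w\<close>, while the product rule differentiates the real weight \<open>\<omega>\<close> in the ordinary way.
  Hence \<open>\<integral>\<omega>\<bar>w(s)\<bar>\<^sup>2\<close> grows at most like \<open>exp (2 a\<^sup>2 s)\<close> along \<open>w(s) = exp (- s H) f\<close>.  As \<open>\<omega>\<close> is
  about \<open>1\<close> on \<open>B\<close> and at most \<open>exp (- 2 a d)\<close> on \<open>A\<close>, where \<open>d = d(A, B)\<close>, the Cauchy-Schwarz inequality
  bounds the pairing with \<open>g\<close> by \<open>exp (a\<^sup>2 t - a d)\<close> times the product of the norms, and \<open>a = d/(2t)\<close>
  is the optimal choice.

  Three things have to be supplied to turn this into a proof.

  The operator is given through a projection-valued measure \<open>E\<close>.  The identity
  \<open>\<parallel>\<Sum>j. c j E(S j) f\<parallel> = \<parallel>\<Sum>j. c j indicator (S j)\<parallel>\<close>, with the norm of \<open>L\<^sup>2(\<mu>\<^sub>f)\<close> on the right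
  (\<open>norm_step_function\<close>), and the completeness of \<open>L\<^sup>2\<close> (\<open>Riesz_Fischer\<close>) yield an isometric
  calculus.  The evolution is then replaced by \<open>\<Sum>j. exp (- s r\<^sub>j) E(I\<^sub>j) f\<close> over small intervals \<open>I\<^sub>j\<close>
  with left end points \<open>r\<^sub>j\<close>.  This is a finite sum, so it is differentiated term by term, and
  \<open>H\<close> acts on each term as multiplication by \<open>r\<^sub>j\<close> up to an error of the size of the mesh
  (\<open>spectral_block\<close>).  Gronwall's argument for the finite sums (\<open>discrete_evolution_bound\<close>) passes
  to the limit (\<open>weighted_semigroup_bound\<close>).

  The form on the closure domain is a limit along approximating sequences of test functions.  That
  it does not depend on the sequence is closability, which follows from the existence of a formal
  adjoint on test functions, that is, from integration by parts (\<open>integration_by_parts\<close>).  The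
  inequality for \<open>Q(w, \<omega>w)\<close> is proved for test functions and carried over by approximation
  (\<open>generator_lower_bound\<close>).

  The weight has to be smooth, because the form core consists of smooth functions.  The function
  \<open>\<rho>(x) = - (1/k) ln (\<Sum>y. exp (- k q\<^sub>y(x)))\<close>, where \<open>q\<^sub>y(x) = sqrt (\<epsilon>\<^sup>2 + \<bar>x - y\<bar>\<^sup>2)\<close> and
  \<open>y\<close> runs over a finite \<open>\<epsilon>\<close>-net of a bounded piece of \<open>B\<close>, is smooth; its gradient is a convex
  combination of the gradients of the \<open>q\<^sub>y\<close>, so it is at most \<open>1\<close> in norm.  Letting \<open>k\<close> tend to infinity, then
  \<open>\<epsilon>\<close> to zero, and exhausting \<open>B\<close> by bounded pieces gives the sharp constant.
\<close>

section \<open>Semidefinite forms and square-integrable functions\<close>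

locale psd_form =
  fixes D :: "('a \<Rightarrow> complex) set" and b :: "('a \<Rightarrow> complex) \<Rightarrow> ('a \<Rightarrow> complex) \<Rightarrow> complex"
  assumes zero_mem: "(\<lambda>x. 0) \<in> D"
    and lin_mem: "\<And>f g c. f \<in> D \<Longrightarrow> g \<in> D \<Longrightarrow> (\<lambda>x. f x + c * g x) \<in> D"
    and left_linear: "\<And>f g h c. f \<in> D \<Longrightarrow> g \<in> D \<Longrightarrow> h \<in> D \<Longrightarrow>
      b (\<lambda>x. f x + c * g x) h = b f h + c * b g h"
    and hermitian: "\<And>f g. f \<in> D \<Longrightarrow> g \<in> D \<Longrightarrow> b g f = cnj (b f g)"
    and nonneg: "\<And>f. f \<in> D \<Longrightarrow> 0 \<le> Re (b f f)"
begin

definition seminorm :: "('a \<Rightarrow> complex) \<Rightarrow> real" where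
  "seminorm f = sqrt (Re (b f f))"

lemma diff_mem: "f \<in> D \<Longrightarrow> g \<in> D \<Longrightarrow> (\<lambda>x. f x - g x) \<in> D"
  using lin_mem[of f g "-1"] by simp

lemma add_mem: "f \<in> D \<Longrightarrow> g \<in> D \<Longrightarrow> (\<lambda>x. f x + g x) \<in> D"
  using lin_mem[of f g "1"] by simp

lemma scale_mem: "f \<in> D \<Longrightarrow> (\<lambda>x. c * f x) \<in> D"
  using lin_mem[OF zero_mem, of f c] by simp

lemma zero_left: "f \<in> D \<Longrightarrow> b (\<lambda>x. 0) f = 0"
  using left_linear[OF zero_mem zero_mem, of f 1] by simp

lemma diff_left: "f \<in> D \<Longrightarrow> g \<in> D \<Longrightarrow> h \<in> D \<Longrightarrow> b (\<lambda>x. f x - g x) h = b f h - b g h"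
  using left_linear[of f g h "-1"] by simp

lemma right_antilinear:
  assumes "f \<in> D" "g \<in> D" "h \<in> D"
  shows "b h (\<lambda>x. f x + c * g x) = b h f + cnj c * b h g"
  using hermitian[OF lin_mem[OF assms(1,2)] assms(3), of c] left_linear[OF assms, of c]
    hermitian[OF assms(1,3)] hermitian[OF assms(2,3)] by simp

lemma zero_right: "f \<in> D \<Longrightarrow> b f (\<lambda>x. 0) = 0"
  using hermitian[OF zero_mem, of f] zero_left[of f] by simp

lemma scale_right: "f \<in> D \<Longrightarrow> g \<in> D \<Longrightarrow> b f (\<lambda>x. c * g x) = cnj c * b f g"
  using right_antilinear[OF zero_mem, of g f c] zero_right[of f] by simp

lemma sum_mem:
  "finite J \<Longrightarrow> (\<And>j. j \<in> J \<Longrightarrow> F j \<in> D) \<Longrightarrow> (\<lambda>x. \<Sum>j\<in>J. c j * F j x) \<in> D"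
proof (induction J rule: finite_induct)
  case empty then show ?case by (simp add: zero_mem)
next
  case (insert j J)
  then show ?case using lin_mem[of "\<lambda>x. \<Sum>j\<in>J. c j * F j x" "F j" "c j"]
    by (simp add: add.commute)
qed

lemma sum_left:
  "finite J \<Longrightarrow> (\<And>j. j \<in> J \<Longrightarrow> F j \<in> D) \<Longrightarrow> g \<in> D \<Longrightarrow>
    b (\<lambda>x. \<Sum>j\<in>J. c j * F j x) g = (\<Sum>j\<in>J. c j * b (F j) g)"
proof (induction J rule: finite_induct)
  case empty then show ?case by (simp add: zero_left)
next
  case (insert j J)
  then show ?case using left_linear[of "\<lambda>x. \<Sum>j\<in>J. c j * F j x" "F j" g "c j"]
    by (simp add: add.commute sum_mem)
qed

lemma sum_right:
  assumes "finite J" "\<And>j. j \<in> J \<Longrightarrow> F j \<in> D" "g \<in> D"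
  shows "b g (\<lambda>x. \<Sum>j\<in>J. c j * F j x) = (\<Sum>j\<in>J. cnj (c j) * b g (F j))"
proof -
  have m: "(\<lambda>x. \<Sum>j\<in>J. c j * F j x) \<in> D" by (rule sum_mem[OF assms(1,2)])
  have "b (\<lambda>x. \<Sum>j\<in>J. c j * F j x) g = (\<Sum>j\<in>J. c j * b (F j) g)"
    by (rule sum_left[OF assms])
  with hermitian[OF m assms(3)]
  have "b g (\<lambda>x. \<Sum>j\<in>J. c j * F j x) = cnj (\<Sum>j\<in>J. c j * b (F j) g)" by argo
  also have "\<dots> = (\<Sum>j\<in>J. cnj (c j) * b g (F j))"
    unfolding cnj_sum complex_cnj_mult
    by (rule sum.cong[OF refl], subst hermitian[OF assms(2) assms(3)]) auto
  finally show ?thesis .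
qed

lemma seminorm_nonneg: "f \<in> D \<Longrightarrow> 0 \<le> seminorm f"
  by (simp add: seminorm_def nonneg)

lemma seminorm_square: "f \<in> D \<Longrightarrow> (seminorm f)\<^sup>2 = Re (b f f)"
  by (simp add: seminorm_def nonneg)

text \<open>
  The expansion behind the Cauchy-Schwarz inequality, polarization and the scaling of the seminorm.
\<close>

lemma square_of_comb:
  assumes "f \<in> D" "g \<in> D"
  shows "Re (b (\<lambda>x. f x + c * g x) (\<lambda>x. f x + c * g x)) =
    Re (b f f) + 2 * Re (cnj c * b f g) + (cmod c)\<^sup>2 * Re (b g g)"
proof -
  have "b (\<lambda>x. f x + c * g x) (\<lambda>x. f x + c * g x) =
      b f f + cnj c * b f g + c * (cnj (b f g) + cnj c * b g g)"
    using left_linear[OF assms lin_mem[OF assms], of c c] right_antilinear[OF assms assms(1), of c]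
      right_antilinear[OF assms assms(2), of c] hermitian[OF assms] by metis
  also have "\<dots> = b f f + (cnj c * b f g + cnj (cnj c * b f g)) + c * cnj c * b g g"
    by (simp add: algebra_simps)
  also have "\<dots> = b f f + of_real (2 * Re (cnj c * b f g)) + of_real ((cmod c)\<^sup>2) * b g g"
    unfolding complex_add_cnj complex_norm_square ..
  finally have eq: "b (\<lambda>x. f x + c * g x) (\<lambda>x. f x + c * g x) = \<dots>" .
  show ?thesis unfolding eq by simp
qed

lemma Cauchy_Schwarz:
  assumes f: "f \<in> D" and g: "g \<in> D"
  shows "cmod (b f g) \<le> seminorm f * seminorm g"
proof -
  define F G c where "F = Re (b f f)" and "G = Re (b g g)" and "c = cmod (b f g)"
  have *: "0 \<le> F - 2 * s * c\<^sup>2 + s\<^sup>2 * c\<^sup>2 * G" for s :: real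
  proof -
    have "0 \<le> Re (b f f) + 2 * Re (cnj (- of_real s * b f g) * b f g)
       + (cmod (- of_real s * b f g))\<^sup>2 * Re (b g g)"
      using nonneg[OF lin_mem[OF f g], of "- of_real s * b f g"]
      unfolding square_of_comb[OF f g] .
    moreover have "Re (cnj (- of_real s * b f g) * b f g) = - s * c\<^sup>2"
      unfolding c_def cmod_power2 by (simp add: power2_eq_square algebra_simps)
    ultimately show ?thesis
      by (simp add: F_def G_def c_def norm_mult power_mult_distrib algebra_simps)
  qed
  have "c\<^sup>2 \<le> F * G"
  proof (cases "G = 0")
    case True
    show ?thesis
    proof (rule ccontr)
      assume "\<not> ?thesis"
      \<comment> \<open>If \<open>g\<close> has length zero, the quadratic in \<open>s\<close> is affine; at this \<open>s\<close> it takes the value \<open>-1\<close>.\<close>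
      then have "c\<^sup>2 > 0" using True by simp
      with *[of "(F + 1) / (2 * c\<^sup>2)"] True show False by (simp add: field_simps)
    qed
  next
    case False
    then have "G > 0" using nonneg[OF g] by (simp add: G_def)
    with *[of "1 / G"] show ?thesis by (simp add: field_simps power2_eq_square)
  qed
  then have "sqrt (c\<^sup>2) \<le> sqrt (F * G)" by (simp only: real_sqrt_le_iff)
  then show ?thesis
    by (simp add: c_def seminorm_def real_sqrt_mult F_def G_def)
qed

lemma triangle:
  assumes f: "f \<in> D" and g: "g \<in> D"
  shows "seminorm (\<lambda>x. f x + g x) \<le> seminorm f + seminorm g"
proof -
  have "(seminorm (\<lambda>x. f x + g x))\<^sup>2 = Re (b f f) + 2 * Re (b f g) + Re (b g g)"
    using square_of_comb[OF f g, of 1] seminorm_square[OF add_mem[OF f g]] by simp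
  also have "\<dots> \<le> (seminorm f)\<^sup>2 + 2 * (seminorm f * seminorm g) + (seminorm g)\<^sup>2"
    using Cauchy_Schwarz[OF f g] complex_Re_le_cmod[of "b f g"]
    by (simp add: seminorm_square f g)
  also have "\<dots> = (seminorm f + seminorm g)\<^sup>2" by (simp add: power2_sum)
  finally show ?thesis
    by (rule power2_le_imp_le) (simp add: seminorm_nonneg f g)
qed

lemma seminorm_scale: "f \<in> D \<Longrightarrow> seminorm (\<lambda>x. c * f x) = cmod c * seminorm f"
  using square_of_comb[OF zero_mem, of f c]
  by (simp add: seminorm_def zero_left zero_mem real_sqrt_mult)

lemma seminorm_minus: "f \<in> D \<Longrightarrow> g \<in> D \<Longrightarrow> seminorm (\<lambda>x. f x - g x) = seminorm (\<lambda>x. g x - f x)"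
  using seminorm_scale[OF diff_mem[of f g], of "-1"] by simp

lemma triangle_diff:
  assumes f: "f \<in> D" and g: "g \<in> D"
  shows "\<bar>seminorm f - seminorm g\<bar> \<le> seminorm (\<lambda>x. f x - g x)"
proof -
  have "seminorm f \<le> seminorm (\<lambda>x. f x - g x) + seminorm g"
    using triangle[OF diff_mem[OF f g] g] by simp
  moreover have "seminorm g \<le> seminorm (\<lambda>x. f x - g x) + seminorm f"
    using triangle[OF diff_mem[OF g f] f] seminorm_minus[OF f g] by simp
  ultimately show ?thesis by linarith
qed

lemma triangle_minus:
  assumes f: "f \<in> D" and g: "g \<in> D"
  shows "seminorm (\<lambda>x. f x - g x) \<le> seminorm f + seminorm g"
  using triangle_diff[OF f diff_mem[OF f g]] triangle_diff[OF g diff_mem[OF g f]]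
    seminorm_minus[OF f g] triangle[OF f scale_mem[OF g], of "-1"] seminorm_scale[OF g, of "-1"]
  by simp

lemma triangle_mid:
  assumes "f \<in> D" "g \<in> D" "h \<in> D"
  shows "seminorm (\<lambda>x. f x - h x) \<le> seminorm (\<lambda>x. f x - g x) + seminorm (\<lambda>x. g x - h x)"
  using triangle[OF diff_mem[of f g] diff_mem[of g h]] assms by simp

lemma seminorm_sum_le:
  "finite J \<Longrightarrow> (\<And>j. j \<in> J \<Longrightarrow> F j \<in> D) \<Longrightarrow>
    seminorm (\<lambda>x. \<Sum>j\<in>J. c j * F j x) \<le> (\<Sum>j\<in>J. cmod (c j) * seminorm (F j))"
proof (induction J rule: finite_induct)
  case empty then show ?case by (simp add: seminorm_def zero_left zero_mem)
next
  case (insert j J)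
  then show ?case
    using triangle[of "\<lambda>x. c j * F j x" "\<lambda>x. \<Sum>j\<in>J. c j * F j x"]
    by (simp add: sum_mem scale_mem seminorm_scale)
qed

lemma seminorm_diff_tendsto:
  assumes mem: "\<And>n. u n \<in> D" "\<And>n. v n \<in> D" "f \<in> D" "g \<in> D"
    and u: "(\<lambda>n. seminorm (\<lambda>x. u n x - f x)) \<longlonglongrightarrow> 0"
    and v: "(\<lambda>n. seminorm (\<lambda>x. v n x - g x)) \<longlonglongrightarrow> 0"
  shows "(\<lambda>n. seminorm (\<lambda>x. u n x - v n x)) \<longlonglongrightarrow> seminorm (\<lambda>x. f x - g x)"
proof (rule LIM_zero_cancel, rule Lim_null_comparison)
  show "(\<lambda>n. seminorm (\<lambda>x. u n x - f x) + seminorm (\<lambda>x. v n x - g x)) \<longlonglongrightarrow> 0"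
    using tendsto_add[OF u v] by simp
  have "\<bar>seminorm (\<lambda>x. u n x - v n x) - seminorm (\<lambda>x. f x - g x)\<bar>
      \<le> seminorm (\<lambda>x. u n x - f x) + seminorm (\<lambda>x. v n x - g x)" for n
  proof -
    have "\<bar>seminorm (\<lambda>x. u n x - v n x) - seminorm (\<lambda>x. f x - g x)\<bar>
        \<le> seminorm (\<lambda>x. (u n x - v n x) - (f x - g x))"
      by (intro triangle_diff diff_mem mem)
    also have "(\<lambda>x. (u n x - v n x) - (f x - g x)) = (\<lambda>x. (u n x - f x) - (v n x - g x))"
      by (rule ext) simp
    also have "seminorm \<dots> \<le> seminorm (\<lambda>x. u n x - f x) + seminorm (\<lambda>x. v n x - g x)"
      by (intro triangle_minus diff_mem mem)
    finally show ?thesis .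
  qed
  then show "\<forall>\<^sub>F n in sequentially. norm (seminorm (\<lambda>x. u n x - v n x) - seminorm (\<lambda>x. f x - g x))
      \<le> seminorm (\<lambda>x. u n x - f x) + seminorm (\<lambda>x. v n x - g x)"
    by simp
qed

text \<open>
  The four terms of \<open>polar_form\<close> kill the antilinear cross term and leave the form itself.
\<close>

lemma polarization:
  assumes f: "f \<in> D" and g: "g \<in> D"
    and Q: "\<And>h. h \<in> D \<Longrightarrow> Q h = Re (b h h)"
  shows "polar_form Q f g = b f g"
proof -
  have *: "Q (\<lambda>x. f x + c * g x) = Re (b f f) + 2 * Re (cnj c * b f g) + (cmod c)\<^sup>2 * Re (b g g)" for c
    using Q[OF lin_mem[OF f g]] square_of_comb[OF f g] by simp
  have i3: "\<i> ^ 3 = - \<i>" by (simp add: power3_eq_cube)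
  have "polar_form Q f g = (\<Sum>k<4. \<i> ^ k * complex_of_real (Q (\<lambda>x. f x + \<i> ^ k * g x))) / 4"
    by (simp add: polar_form_def)
  also have "\<dots> = (\<Sum>k<4. \<i> ^ k * complex_of_real (Re (b f f) + 2 * Re (cnj (\<i>^k) * b f g) + (cmod (\<i>^k))\<^sup>2 * Re (b g g))) / 4"
    by (simp only: *)
  also have "\<dots> = b f g"
    by (simp add: eval_nat_numeral complex_eq_iff)
  finally show ?thesis .
qed

end

lemma l2_spaceD: "f \<in> l2_space M \<Longrightarrow> f \<in> borel_measurable M"
  "f \<in> l2_space M \<Longrightarrow> integrable M (\<lambda>x. (cmod (f x))\<^sup>2)"
  by (auto simp: l2_space_def)

lemma borel_measurable_cnj [measurable]:
  "f \<in> borel_measurable M \<Longrightarrow> (\<lambda>x. cnj (f x)) \<in> borel_measurable M"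
  by (rule borel_measurable_continuous_on[of cnj]) (auto intro: continuous_intros)

lemma l2_product_integrable:
  assumes "f \<in> l2_space M" "g \<in> l2_space M"
  shows "integrable M (\<lambda>x. f x * cnj (g x))"
proof (rule Bochner_Integration.integrable_bound)
  note [measurable] = l2_spaceD(1)[OF assms(1)] l2_spaceD(1)[OF assms(2)]
  show "integrable M (\<lambda>x. (cmod (f x))\<^sup>2 + (cmod (g x))\<^sup>2)"
    using assms by (auto dest: l2_spaceD)
  show "(\<lambda>x. f x * cnj (g x)) \<in> borel_measurable M" by measurable
  have "a * b \<le> a\<^sup>2 + b\<^sup>2" for a b :: real
    using sum_squares_bound[of a b] zero_le_power2[of a] zero_le_power2[of b] by linarith
  then show "AE x in M. norm (f x * cnj (g x)) \<le> norm ((cmod (f x))\<^sup>2 + (cmod (g x))\<^sup>2)"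
    by (simp add: norm_mult)
qed

lemma l2_lin_mem:
  assumes "f \<in> l2_space M" "g \<in> l2_space M"
  shows "(\<lambda>x. f x + c * g x) \<in> l2_space M"
proof -
  note [measurable] = l2_spaceD(1)[OF assms(1)] l2_spaceD(1)[OF assms(2)]
  have "integrable M (\<lambda>x. (cmod (f x + c * g x))\<^sup>2)"
  proof (rule Bochner_Integration.integrable_bound)
    show "integrable M (\<lambda>x. 2 * (cmod (f x))\<^sup>2 + 2 * (cmod c)\<^sup>2 * (cmod (g x))\<^sup>2)"
      by (intro Bochner_Integration.integrable_add integrable_mult_right l2_spaceD(2) assms)
    show "(\<lambda>x. (cmod (f x + c * g x))\<^sup>2) \<in> borel_measurable M" by measurable
    have "(cmod (a + c * b))\<^sup>2 \<le> 2 * (cmod a)\<^sup>2 + 2 * (cmod c)\<^sup>2 * (cmod b)\<^sup>2" for a b :: complex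
    proof -
      have "(cmod (a + c * b))\<^sup>2 \<le> (cmod a + cmod c * cmod b)\<^sup>2"
        by (metis norm_ge_zero norm_mult norm_triangle_ineq power_mono)
      also have "\<dots> \<le> 2 * (cmod a)\<^sup>2 + 2 * (cmod c * cmod b)\<^sup>2"
        using sum_squares_bound[of "cmod a" "cmod c * cmod b"] by (simp add: power2_sum)
      finally show ?thesis by (simp add: power_mult_distrib)
    qed
    then show "AE x in M. norm ((cmod (f x + c * g x))\<^sup>2)
        \<le> norm (2 * (cmod (f x))\<^sup>2 + 2 * (cmod c)\<^sup>2 * (cmod (g x))\<^sup>2)"
      by simp
  qed
  then show ?thesis by (auto simp: l2_space_def)
qed

global_interpretation l2: psd_form "l2_space M" "l2_inner M" for M :: "'a measure"
proof
  show "(\<lambda>x. 0) \<in> l2_space M" by (simp add: l2_space_def)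
  show "(\<lambda>x. f x + c * g x) \<in> l2_space M" if "f \<in> l2_space M" "g \<in> l2_space M" for f g c
    using that by (rule l2_lin_mem)
  show "l2_inner M (\<lambda>x. f x + c * g x) h = l2_inner M f h + c * l2_inner M g h"
    if "f \<in> l2_space M" "g \<in> l2_space M" "h \<in> l2_space M" for f g h c
  proof -
    have "l2_inner M (\<lambda>x. f x + c * g x) h = (\<integral>x. f x * cnj (h x) + c * (g x * cnj (h x)) \<partial>M)"
      by (simp add: l2_inner_def algebra_simps)
    also have "\<dots> = l2_inner M f h + c * l2_inner M g h"
      unfolding l2_inner_def using that
      by (subst Bochner_Integration.integral_add) (auto simp: l2_product_integrable)
    finally show ?thesis .
  qed
  show "l2_inner M g f = cnj (l2_inner M f g)" for f g
    unfolding l2_inner_def by (simp add: mult.commute flip: Bochner_Integration.integral_cnj)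
  show "0 \<le> Re (l2_inner M f f)" if "f \<in> l2_space M" for f
  proof -
    have "l2_inner M f f = (\<integral>x. complex_of_real ((cmod (f x))\<^sup>2) \<partial>M)"
      unfolding l2_inner_def by (simp add: complex_norm_square del: of_real_power)
    then show ?thesis by (simp del: of_real_power)
  qed
qed

lemma l2_inner_self: "l2_inner M f f = complex_of_real (\<integral>x. (cmod (f x))\<^sup>2 \<partial>M)"
proof -
  have "l2_inner M f f = (\<integral>x. complex_of_real ((cmod (f x))\<^sup>2) \<partial>M)"
    unfolding l2_inner_def by (simp add: complex_norm_square del: of_real_power)
  then show ?thesis by (simp del: of_real_power)
qed

lemma l2_seminorm [simp]: "l2.seminorm M = l2_norm M"
  by (rule ext) (simp add: l2.seminorm_def l2_norm_def l2_inner_self)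

lemma l2_norm_square: "(l2_norm M f)\<^sup>2 = (\<integral>x. (cmod (f x))\<^sup>2 \<partial>M)"
  by (simp add: l2_norm_def)

lemma l2_norm_nonneg [simp]: "0 \<le> l2_norm M f"
  by (simp add: l2_norm_def)

lemma l2_norm_cong_AE:
  assumes "f \<in> borel_measurable M" "g \<in> borel_measurable M" "AE x in M. f x = g x"
  shows "l2_norm M f = l2_norm M g"
  unfolding l2_norm_def
  by (intro arg_cong[of _ _ sqrt] integral_cong_AE) (use assms in auto)

lemma l2_inner_cong_AE:
  assumes "f \<in> l2_space M" "f' \<in> l2_space M" "g \<in> l2_space M" "g' \<in> l2_space M"
    "AE x in M. f x = f' x" "AE x in M. g x = g' x"
  shows "l2_inner M f g = l2_inner M f' g'"
  unfolding l2_inner_def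
proof (rule integral_cong_AE)
  note [measurable] = assms(1-4)[THEN l2_spaceD(1)]
  show "(\<lambda>x. f x * cnj (g x)) \<in> borel_measurable M" "(\<lambda>x. f' x * cnj (g' x)) \<in> borel_measurable M"
    by measurable
  show "AE x in M. f x * cnj (g x) = f' x * cnj (g' x)"
    using assms(5,6) by eventually_elim simp
qed

lemma l2_norm_nn:
  "f \<in> l2_space M \<Longrightarrow> ennreal ((l2_norm M f)\<^sup>2) = (\<integral>\<^sup>+x. ennreal ((cmod (f x))\<^sup>2) \<partial>M)"
  by (simp add: l2_norm_square nn_integral_eq_integral l2_spaceD)

lemma l2_spaceI_nn:
  assumes [measurable]: "f \<in> borel_measurable M" and "(\<integral>\<^sup>+x. ennreal ((cmod (f x))\<^sup>2) \<partial>M) < \<infinity>"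
  shows "f \<in> l2_space M"
  using assms by (auto simp: l2_space_def integrable_iff_bounded)

text \<open>
  Minkowski's inequality for functions whose square-integrability is part of the conclusion; the
  bounds \<open>a\<close> and \<open>b\<close> make it usable in an induction over partial sums.
\<close>

lemma nn_l2_triangle:
  assumes [measurable]: "f \<in> borel_measurable M" "g \<in> borel_measurable M"
    and f: "(\<integral>\<^sup>+x. ennreal ((f x)\<^sup>2) \<partial>M) \<le> ennreal (a\<^sup>2)"
    and g: "(\<integral>\<^sup>+x. ennreal ((g x)\<^sup>2) \<partial>M) \<le> ennreal (b\<^sup>2)"
    and "0 \<le> a" "0 \<le> b"
  shows "(\<integral>\<^sup>+x. ennreal ((f x + g x)\<^sup>2) \<partial>M) \<le> ennreal ((a + b)\<^sup>2)"
proof -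
  define F G where "F = (\<lambda>x. complex_of_real (f x))" and "G = (\<lambda>x. complex_of_real (g x))"
  have F: "F \<in> l2_space M"
    by (rule l2_spaceI_nn) (use f in \<open>auto simp: F_def intro: le_less_trans\<close>)
  have G: "G \<in> l2_space M"
    by (rule l2_spaceI_nn) (use g in \<open>auto simp: G_def intro: le_less_trans\<close>)
  have "ennreal ((l2_norm M F)\<^sup>2) \<le> ennreal (a\<^sup>2)" "ennreal ((l2_norm M G)\<^sup>2) \<le> ennreal (b\<^sup>2)"
    using f g by (auto simp: l2_norm_nn F G) (auto simp: F_def G_def)
  then have "(l2_norm M F)\<^sup>2 \<le> a\<^sup>2" "(l2_norm M G)\<^sup>2 \<le> b\<^sup>2"
    by (simp_all add: ennreal_le_iff)
  then have "l2_norm M F \<le> a" "l2_norm M G \<le> b"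
    using assms(5,6) power2_le_imp_le by blast+
  then have "l2_norm M (\<lambda>x. F x + G x) \<le> a + b"
    using l2.triangle[OF F G] by simp
  then have "ennreal ((l2_norm M (\<lambda>x. F x + G x))\<^sup>2) \<le> ennreal ((a + b)\<^sup>2)"
    by (intro ennreal_leI power_mono) auto
  then show ?thesis
    by (subst (asm) l2_norm_nn[OF l2.add_mem[OF F G]])
      (simp add: F_def G_def flip: of_real_add)
qed

text \<open>
  A subsequence with increments summable in norm converges almost everywhere, because the sum of the
  moduli of its increments is square-integrable and hence finite almost everywhere; Fatou's lemma then
  turns the Cauchy property into convergence in norm to the pointwise limit.
\<close>

lemma Riesz_Fischer:
  assumes mem: "\<And>n. f n \<in> l2_space M"
    and Cauchy: "\<And>e. e > 0 \<Longrightarrow> \<exists>N. \<forall>m\<ge>N. \<forall>n\<ge>N. l2_norm M (\<lambda>x. f m x - f n x) < e"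
  shows "\<exists>g \<in> l2_space M. (\<lambda>n. l2_norm M (\<lambda>x. f n x - g x)) \<longlonglongrightarrow> 0"
proof -
  note [measurable] = mem[THEN l2_spaceD(1)]
  have "\<forall>k. \<exists>N. \<forall>m\<ge>N. \<forall>n\<ge>N. l2_norm M (\<lambda>x. f m x - f n x) < (1/2)^k"
    using Cauchy by simp
  then obtain N0 where N0: "\<And>k m n. m \<ge> N0 k \<Longrightarrow> n \<ge> N0 k \<Longrightarrow> l2_norm M (\<lambda>x. f m x - f n x) < (1/2)^k"
    by metis
  \<comment> \<open>Adding up the thresholds makes \<open>N\<close> monotone; the summand \<open>k\<close> makes it unbounded.\<close>
  define N where "N k = k + (\<Sum>j\<le>k. N0 j)" for k
  have N_ge: "N k \<ge> N0 k" for k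
    unfolding N_def by (rule trans_le_add2, rule member_le_sum) auto
  have N_ge': "N k \<ge> k" for k by (simp add: N_def)
  have N_Suc: "N (Suc k) \<ge> N k" for k by (simp add: N_def)
  have step: "l2_norm M (\<lambda>x. f (N (Suc k)) x - f (N k) x) \<le> (1/2)^k" for k
    by (rule less_imp_le[OF N0]) (use N_ge[of k] N_Suc[of k] in auto)
  define d where "d k x = cmod (f (N (Suc k)) x - f (N k) x)" for k x
  have [measurable]: "d k \<in> borel_measurable M" for k
    unfolding d_def by measurable
  have dk: "(\<integral>\<^sup>+x. ennreal ((d k x)\<^sup>2) \<partial>M) \<le> ennreal (((1/2)^k)\<^sup>2)" for k
    unfolding d_def by (subst l2_norm_nn[symmetric])
      (auto intro!: ennreal_leI power_mono step l2.diff_mem mem)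
  have part: "(\<integral>\<^sup>+x. ennreal ((\<Sum>k<K. d k x)\<^sup>2) \<partial>M) \<le> ennreal ((\<Sum>k<K. (1/2)^k)\<^sup>2)" for K
  proof (induction K)
    case 0 then show ?case by simp
  next
    case (Suc K)
    show ?case
      using nn_l2_triangle[OF _ _ Suc dk[of K]] by (auto simp: sum_nonneg)
  qed
  have dn: "0 \<le> d k x" for k x by (simp add: d_def)
  have geo: "(\<Sum>k<K. (1/2)^k) \<le> (2::real)" for K
    using sum_le_suminf[of "\<lambda>k. (1/2::real)^k" "{..<K}"] suminf_geometric[of "1/2::real"]
    by (simp add: summable_geometric)
  have part2: "(\<integral>\<^sup>+x. ennreal ((\<Sum>k<K. d k x)\<^sup>2) \<partial>M) \<le> 4" for K
  proof -
    have "ennreal ((\<Sum>k<K. (1/2)^k)\<^sup>2) \<le> ennreal (2\<^sup>2)"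
      by (intro ennreal_leI power_mono geo) (simp add: sum_nonneg)
    with part[of K] show ?thesis by simp
  qed
  define G where "G x = (SUP K. ennreal ((\<Sum>k<K. d k x)\<^sup>2))" for x
  have [measurable]: "G \<in> borel_measurable M" unfolding G_def by measurable
  have "(\<integral>\<^sup>+x. G x \<partial>M) = (SUP K. \<integral>\<^sup>+x. ennreal ((\<Sum>k<K. d k x)\<^sup>2) \<partial>M)"
    unfolding G_def
  proof (rule nn_integral_monotone_convergence_SUP)
    show "incseq (\<lambda>K x. ennreal ((\<Sum>k<K. d k x)\<^sup>2))"
      by (intro incseq_SucI le_funI ennreal_leI power_mono) (auto simp: dn sum_nonneg)
  qed measurable
  also have "\<dots> \<le> 4" using part2 by (auto intro: SUP_least)
  also have "\<dots> < \<infinity>" by simp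
  finally have "AE x in M. G x \<noteq> \<infinity>"
    by (intro nn_integral_PInf_AE) auto
  then have conv: "AE x in M. convergent (\<lambda>k. f (N k) x)"
  proof eventually_elim
    case (elim x)
    obtain c where c: "G x = ennreal c" "c \<ge> 0" using elim by (cases "G x") auto
    have "(\<Sum>k<K. d k x) \<le> sqrt c" for K
    proof -
      have "ennreal ((\<Sum>k<K. d k x)\<^sup>2) \<le> ennreal c"
        unfolding c(1)[symmetric] G_def by (rule SUP_upper) simp
      then show ?thesis using c(2) by (simp add: real_le_rsqrt)
    qed
    then have "summable (\<lambda>k. d k x)" by (intro summableI_nonneg_bounded dn)
    then have "summable (\<lambda>k. f (N (Suc k)) x - f (N k) x)"
      unfolding d_def by (rule summable_norm_cancel)
    then have "convergent (\<lambda>K. \<Sum>k<K. f (N (Suc k)) x - f (N k) x)"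
      by (simp add: summable_iff_convergent)
    then have "convergent (\<lambda>K. f (N K) x - f (N 0) x)"
      by (simp add: sum_lessThan_telescope[where f="\<lambda>k. f (N k) x"])
    then show ?case
      using convergent_add[OF _ convergent_const[of "f (N 0) x"]] by fastforce
  qed
  define g where "g x = lim (\<lambda>k. f (N k) x)" for x
  have gm[measurable]: "g \<in> borel_measurable M"
    unfolding g_def by (rule borel_measurable_lim_metric) measurable
  have conv': "AE x in M. (\<lambda>k. f (N k) x) \<longlonglongrightarrow> g x"
    using conv by eventually_elim (simp add: g_def convergent_LIMSEQ_iff)
  have fatou: "(\<integral>\<^sup>+x. ennreal ((cmod (f n x - g x))\<^sup>2) \<partial>M) \<le> ennreal (e\<^sup>2)"
    if "\<And>k. k \<ge> n \<Longrightarrow> l2_norm M (\<lambda>x. f n x - f k x) \<le> e" for n e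
  proof -
    have "(\<integral>\<^sup>+x. ennreal ((cmod (f n x - g x))\<^sup>2) \<partial>M) =
        (\<integral>\<^sup>+x. liminf (\<lambda>k. ennreal ((cmod (f n x - f (N (k + n)) x))\<^sup>2)) \<partial>M)"
    proof (rule nn_integral_cong_AE)
      show "AE x in M. ennreal ((cmod (f n x - g x))\<^sup>2) =
          liminf (\<lambda>k. ennreal ((cmod (f n x - f (N (k + n)) x))\<^sup>2))"
        using conv'
      proof eventually_elim
        case (elim x)
        have "(\<lambda>k. ennreal ((cmod (f n x - f (N (k + n)) x))\<^sup>2))
            \<longlonglongrightarrow> ennreal ((cmod (f n x - g x))\<^sup>2)"
          by (intro tendsto_intros LIMSEQ_ignore_initial_segment[OF elim])
        then show ?case by (rule lim_imp_Liminf[OF sequentially_bot, symmetric])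
      qed
    qed
    also have "\<dots> \<le> liminf (\<lambda>k. \<integral>\<^sup>+x. ennreal ((cmod (f n x - f (N (k + n)) x))\<^sup>2) \<partial>M)"
      by (rule nn_integral_liminf) measurable
    also have "\<dots> \<le> liminf (\<lambda>k. ennreal (e\<^sup>2))"
    proof (rule Liminf_mono, rule always_eventually, rule allI)
      fix k
      have "N (k + n) \<ge> n" using N_ge'[of "k + n"] by simp
      then show "(\<integral>\<^sup>+x. ennreal ((cmod (f n x - f (N (k + n)) x))\<^sup>2) \<partial>M) \<le> ennreal (e\<^sup>2)"
        by (subst l2_norm_nn[symmetric])
          (auto intro!: ennreal_leI power_mono that l2.diff_mem mem)
    qed
    finally show ?thesis by (simp add: Liminf_const)
  qed
  obtain n1 where n1: "\<And>m n. m \<ge> n1 \<Longrightarrow> n \<ge> n1 \<Longrightarrow> l2_norm M (\<lambda>x. f m x - f n x) < 1"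
    using Cauchy[of 1] by auto
  have "(\<lambda>x. f n1 x - g x) \<in> l2_space M"
  proof (rule l2_spaceI_nn)
    show "(\<integral>\<^sup>+x. ennreal ((cmod (f n1 x - g x))\<^sup>2) \<partial>M) < \<infinity>"
      by (rule le_less_trans[OF fatou[of n1 1]]) (use n1 in \<open>auto intro: less_imp_le\<close>)
  qed measurable
  then have g: "g \<in> l2_space M"
    using l2.diff_mem[OF mem[of n1]] by fastforce
  have "(\<lambda>n. l2_norm M (\<lambda>x. f n x - g x)) \<longlonglongrightarrow> 0"
  proof (rule LIMSEQ_I)
    fix e :: real assume e: "e > 0"
    obtain n0 where n0: "\<And>m n. m \<ge> n0 \<Longrightarrow> n \<ge> n0 \<Longrightarrow> l2_norm M (\<lambda>x. f m x - f n x) < e / 2"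
      using Cauchy[of "e/2"] e by auto
    have le: "l2_norm M (\<lambda>x. f n x - g x) \<le> e / 2" if "n \<ge> n0" for n
    proof -
      have "ennreal ((l2_norm M (\<lambda>x. f n x - g x))\<^sup>2) \<le> ennreal ((e/2)\<^sup>2)"
        unfolding l2_norm_nn[OF l2.diff_mem[OF mem g]]
        by (rule fatou) (use n0 that in \<open>auto intro: less_imp_le\<close>)
      then have "(l2_norm M (\<lambda>x. f n x - g x))\<^sup>2 \<le> (e/2)\<^sup>2" by (simp add: ennreal_le_iff)
      then show ?thesis by (rule power2_le_imp_le) (use e in simp)
    qed
    show "\<exists>n0. \<forall>n\<ge>n0. norm (l2_norm M (\<lambda>x. f n x - g x) - 0) < e"
    proof (intro exI[of _ n0] allI impI)
      fix n assume "n0 \<le> n"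
      then show "norm (l2_norm M (\<lambda>x. f n x - g x) - 0) < e" using le[of n] e by simp
    qed
  qed
  with g show ?thesis by blast
qed

lemma l2_inner_tendsto_0:
  assumes "\<And>n. u n \<in> l2_space N" "v \<in> l2_space N" "(\<lambda>n. l2_norm N (u n)) \<longlonglongrightarrow> 0"
  shows "(\<lambda>n. l2_inner N (u n) v) \<longlonglongrightarrow> 0"
proof (rule Lim_null_comparison)
  show "(\<lambda>n. l2_norm N (u n) * l2_norm N v) \<longlonglongrightarrow> 0" using tendsto_mult_left_zero[OF assms(3)] .
  show "\<forall>\<^sub>F n in sequentially. norm (l2_inner N (u n) v) \<le> l2_norm N (u n) * l2_norm N v"
    using l2.Cauchy_Schwarz[of _ N v] assms by simp
qed

lemma norm_tendsto_0_iff_nn: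
  fixes g :: "nat \<Rightarrow> 'b \<Rightarrow> complex"
  assumes "\<And>n. g n \<in> l2_space N"
  shows "(\<lambda>n. \<integral>\<^sup>+ r. ennreal ((cmod (g n r))\<^sup>2) \<partial>N) \<longlonglongrightarrow> 0 \<longleftrightarrow> (\<lambda>n. l2_norm N (g n)) \<longlonglongrightarrow> 0"
proof -
  have "(\<lambda>n. \<integral>\<^sup>+ r. ennreal ((cmod (g n r))\<^sup>2) \<partial>N) \<longlonglongrightarrow> 0 \<longleftrightarrow>
      (\<lambda>n. ennreal ((l2_norm N (g n))\<^sup>2)) \<longlonglongrightarrow> 0"
    using assms by (simp add: l2_norm_nn)
  also have "\<dots> \<longleftrightarrow> (\<lambda>n. (l2_norm N (g n))\<^sup>2) \<longlonglongrightarrow> 0"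
    using tendsto_ennreal_iff[of "\<lambda>n. (l2_norm N (g n))\<^sup>2" sequentially 0] by simp
  also have "\<dots> \<longleftrightarrow> (\<lambda>n. l2_norm N (g n)) \<longlonglongrightarrow> 0"
  proof
    assume "(\<lambda>n. (l2_norm N (g n))\<^sup>2) \<longlonglongrightarrow> 0"
    from tendsto_real_sqrt[OF this] show "(\<lambda>n. l2_norm N (g n)) \<longlonglongrightarrow> 0" by simp
  next
    assume "(\<lambda>n. l2_norm N (g n)) \<longlonglongrightarrow> 0"
    from tendsto_power[OF this, of 2] show "(\<lambda>n. (l2_norm N (g n))\<^sup>2) \<longlonglongrightarrow> 0" by simp
  qed
  finally show ?thesis .
qed

section \<open>Isometry and existence for spectral integrals\<close>

lemma simple_eq_step: "simple_function borel s \<Longrightarrow> s r = (\<Sum>c\<in>range s. c * indicator (s -` {c}) r)"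
  for s :: "real \<Rightarrow> complex"
proof -
  assume "simple_function borel s"
  then have "finite (range s)" by (simp add: simple_function_def)
  then have "(\<Sum>c\<in>range s. c * indicator (s -` {c}) r) = (\<Sum>c\<in>{s r}. c * indicator (s -` {c}) r)"
    by (intro sum.mono_neutral_right) (auto simp: indicator_def)
  then show ?thesis by simp
qed

lemma simple_vimage: "simple_function borel s \<Longrightarrow> s -` {c} \<in> sets borel"
  for s :: "real \<Rightarrow> complex"
  using simple_functionD(2)[of borel s "{c}"] by simp

lemma simple_range: "simple_function borel s \<Longrightarrow> finite (range s)"
  for s :: "real \<Rightarrow> complex"
  by (simp add: simple_function_def)

locale spectral_resolution =
  fixes M :: "'a measure" and E :: "real set \<Rightarrow> ('a \<Rightarrow> complex) \<Rightarrow> 'a \<Rightarrow> complex"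
  assumes pvm: "projection_valued_measure M E"
begin

abbreviation \<mu> where "\<mu> \<equiv> scalar_spectral_measure M E"

lemma proj_mem [intro]: "S \<in> sets borel \<Longrightarrow> f \<in> l2_space M \<Longrightarrow> E S f \<in> l2_space M"
  using pvm by (simp add: projection_valued_measure_def)

lemma proj_symmetric:
  "S \<in> sets borel \<Longrightarrow> f \<in> l2_space M \<Longrightarrow> g \<in> l2_space M \<Longrightarrow>
    l2_inner M (E S f) g = l2_inner M f (E S g)"
  using pvm by (simp add: projection_valued_measure_def)

lemma proj_proj:
  "S \<in> sets borel \<Longrightarrow> T \<in> sets borel \<Longrightarrow> f \<in> l2_space M \<Longrightarrow> AE x in M. E S (E T f) x = E (S \<inter> T) f x"
  using pvm by (simp add: projection_valued_measure_def)

lemma proj_UNIV: "f \<in> l2_space M \<Longrightarrow> AE x in M. E UNIV f x = f x"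
  using pvm by (simp add: projection_valued_measure_def)

lemma proj_sums:
  "f \<in> l2_space M \<Longrightarrow> range S \<subseteq> sets borel \<Longrightarrow> disjoint_family S \<Longrightarrow>
    (\<lambda>n. l2_inner M (E (S n) f) f) sums l2_inner M (E (\<Union>n. S n) f) f"
  using pvm unfolding projection_valued_measure_def by blast

text \<open>
  Symmetry and multiplicativity of \<open>E\<close> reduce inner products of the vectors \<open>E S f\<close>, for a fixed
  \<open>f\<close>, to values of the scalar measure.
\<close>

lemma inner_proj_proj:
  assumes "S \<in> sets borel" "T \<in> sets borel" "f \<in> l2_space M"
  shows "l2_inner M (E S f) (E T f) = l2_inner M (E (S \<inter> T) f) f"
proof -
  have ST: "S \<inter> T \<in> sets borel" using assms by simp
  have "l2_inner M (E S f) (E T f) = l2_inner M f (E S (E T f))"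
    using assms by (simp add: proj_symmetric proj_mem)
  also have "\<dots> = l2_inner M f (E (S \<inter> T) f)"
    by (rule l2_inner_cong_AE) (use assms ST in \<open>auto intro!: proj_mem proj_proj\<close>)
  also have "\<dots> = l2_inner M (E (S \<inter> T) f) f"
    using assms ST by (simp add: proj_symmetric)
  finally show ?thesis .
qed

lemma inner_proj:
  assumes "S \<in> sets borel" "f \<in> l2_space M"
  shows "l2_inner M (E S f) f = complex_of_real ((l2_norm M (E S f))\<^sup>2)"
  using inner_proj_proj[OF assms(1,1,2)] by (simp add: l2_inner_self l2_norm_square)

lemma sets_\<mu> [simp, measurable_cong]: "sets (\<mu> f) = sets borel"
  and space_\<mu> [simp]: "space (\<mu> f) = UNIV"
  unfolding scalar_spectral_measure_def
  using sets.sigma_sets_eq[of "borel :: real measure"] by (simp_all add: sets_measure_of_conv space_measure_of_conv)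

lemma emeasure_\<mu>:
  assumes f: "f \<in> l2_space M" and S: "S \<in> sets borel"
  shows "emeasure (\<mu> f) S = ennreal ((l2_norm M (E S f))\<^sup>2)"
proof -
  define m where "m S = ennreal (Re (l2_inner M (E S f) f))" for S
  have "emeasure (\<mu> f) S = m S"
    unfolding scalar_spectral_measure_def m_def[symmetric]
  proof (rule emeasure_measure_of_sigma)
    show "sigma_algebra UNIV (sets (borel :: real measure))"
      using sets.sigma_algebra_axioms[of "borel :: real measure"] by simp
    have "(\<lambda>n. l2_inner M (E {} f) f) sums l2_inner M (E {} f) f"
      using proj_sums[OF f, of "\<lambda>n. {}"] by (simp add: disjoint_family_on_def)
    then have "(\<lambda>n::nat. l2_inner M (E {} f) f) \<longlonglongrightarrow> 0"
      by (intro summable_LIMSEQ_zero) (auto simp: summable_def)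
    then have "l2_inner M (E {} f) f = 0"
      by (simp add: tendsto_const_iff)
    then show "positive (sets borel) m" by (simp add: positive_def m_def)
    show "countably_additive (sets borel) m"
    proof (rule countably_additiveI)
      fix T :: "nat \<Rightarrow> real set"
      assume T: "range T \<subseteq> sets borel" "disjoint_family T"
      have "(\<lambda>n. Re (l2_inner M (E (T n) f) f)) sums Re (l2_inner M (E (\<Union>n. T n) f) f)"
        by (rule sums_Re[OF proj_sums[OF f T]])
      moreover have "0 \<le> Re (l2_inner M (E (T n) f) f)" for n
        using inner_proj[OF _ f, of "T n"] T(1) by (simp add: range_subsetD del: of_real_power)
      ultimately show "(\<Sum>n. m (T n)) = m (\<Union>n. T n)"
        unfolding m_def by (subst suminf_ennreal2) (auto simp: sums_iff)
    qed
  qed (use S in auto)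
  also have "m S = ennreal ((l2_norm M (E S f))\<^sup>2)"
    unfolding m_def inner_proj[OF S f] by (simp del: of_real_power)
  finally show ?thesis .
qed

lemma finite_\<mu>: "f \<in> l2_space M \<Longrightarrow> finite_measure (\<mu> f)"
  by (rule finite_measureI) (simp add: emeasure_\<mu>)

lemma measure_\<mu>:
  "f \<in> l2_space M \<Longrightarrow> S \<in> sets borel \<Longrightarrow> measure (\<mu> f) S = (l2_norm M (E S f))\<^sup>2"
  by (simp add: measure_def emeasure_\<mu>)

lemma norm_proj_UNIV: "f \<in> l2_space M \<Longrightarrow> l2_norm M (E UNIV f) = l2_norm M f"
  by (rule l2_norm_cong_AE) (auto intro!: l2_spaceD(1) proj_UNIV)

text \<open>
  Both squared norms expand into the double sum of \<open>c\<^sub>j cnj(c\<^sub>k) \<mu>(S\<^sub>j \<inter> S\<^sub>k)\<close>.  The sets may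
  overlap, so linear relations between indicator functions become linear relations between the
  vectors \<open>E (S j) f\<close>.
\<close>

lemma norm_step_function:
  assumes J: "finite J" and S: "\<And>j. j \<in> J \<Longrightarrow> S j \<in> sets borel" and f: "f \<in> l2_space M"
  shows "l2_norm M (\<lambda>x. \<Sum>j\<in>J. c j * E (S j) f x) = l2_norm (\<mu> f) (\<lambda>r. \<Sum>j\<in>J. c j * indicator (S j) r)"
proof -
  interpret finite_measure "\<mu> f" by (rule finite_\<mu>[OF f])
  have mem: "E (S j) f \<in> l2_space M" if "j \<in> J" for j
    using that S f by auto
  have int: "integrable (\<mu> f) (\<lambda>r. indicator (S j \<inter> S k) r :: complex)" if "j \<in> J" "k \<in> J" for j k
    using that S by (intro integrable_const_bound[where B=1]) (auto simp: indicator_def)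
  have meas: "(\<integral>r. (indicator A r :: complex) \<partial>\<mu> f) = complex_of_real (measure (\<mu> f) A)" for A
  proof -
    have "(\<integral>r. (indicator A r :: complex) \<partial>\<mu> f) = (\<integral>r. complex_of_real (indicator A r) \<partial>\<mu> f)"
      by (rule arg_cong[where f="integral\<^sup>L _"]) (auto simp: indicator_def)
    then show ?thesis by simp
  qed
  have "l2_inner M (\<lambda>x. \<Sum>j\<in>J. c j * E (S j) f x) (\<lambda>x. \<Sum>k\<in>J. c k * E (S k) f x)
      = (\<Sum>j\<in>J. c j * l2_inner M (E (S j) f) (\<lambda>x. \<Sum>k\<in>J. c k * E (S k) f x))"
    using J mem by (intro l2.sum_left l2.sum_mem) auto
  also have "\<dots> = (\<Sum>j\<in>J. c j * (\<Sum>k\<in>J. cnj (c k) * l2_inner M (E (S j) f) (E (S k) f)))"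
    using J mem by (intro sum.cong refl arg_cong2[of _ _ _ _ "(*)"] l2.sum_right) auto
  also have "\<dots> = (\<Sum>j\<in>J. \<Sum>k\<in>J. c j * cnj (c k) * (\<integral>r. indicator (S j \<inter> S k) r \<partial>\<mu> f))"
    unfolding sum_distrib_left
  proof (intro sum.cong refl)
    fix j k assume jk: "j \<in> J" "k \<in> J"
    then have "l2_inner M (E (S j) f) (E (S k) f) = (\<integral>r. indicator (S j \<inter> S k) r \<partial>\<mu> f)"
      using S f by (simp add: inner_proj_proj inner_proj measure_\<mu> meas)
    then show "c j * (cnj (c k) * l2_inner M (E (S j) f) (E (S k) f))
        = c j * cnj (c k) * (\<integral>r. indicator (S j \<inter> S k) r \<partial>\<mu> f)" by simp
  qed
  also have "\<dots> = (\<integral>r. (\<Sum>j\<in>J. \<Sum>k\<in>J. c j * cnj (c k) * indicator (S j \<inter> S k) r) \<partial>\<mu> f)"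
    using int by (simp add: Bochner_Integration.integral_sum)
  also have "\<dots> = l2_inner (\<mu> f) (\<lambda>r. \<Sum>j\<in>J. c j * indicator (S j) r) (\<lambda>r. \<Sum>j\<in>J. c j * indicator (S j) r)"
    unfolding l2_inner_def
    by (intro Bochner_Integration.integral_cong refl)
      (auto simp: sum_product indicator_def intro!: sum.cong)
  finally have "complex_of_real ((l2_norm M (\<lambda>x. \<Sum>j\<in>J. c j * E (S j) f x))\<^sup>2)
      = complex_of_real ((l2_norm (\<mu> f) (\<lambda>r. \<Sum>j\<in>J. c j * indicator (S j) r))\<^sup>2)"
    by (simp only: l2_inner_self l2_norm_square)
  then have "(l2_norm M (\<lambda>x. \<Sum>j\<in>J. c j * E (S j) f x))\<^sup>2
      = (l2_norm (\<mu> f) (\<lambda>r. \<Sum>j\<in>J. c j * indicator (S j) r))\<^sup>2"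
    by (simp only: of_real_eq_iff)
  then show ?thesis by (rule power2_eq_imp_eq) auto
qed

lemma norm_step_function_diff:
  assumes J: "finite J" and S: "\<And>j. j \<in> J \<Longrightarrow> S j \<in> sets borel"
    and K: "finite K" and T: "\<And>k. k \<in> K \<Longrightarrow> T k \<in> sets borel" and f: "f \<in> l2_space M"
  shows "l2_norm M (\<lambda>x. (\<Sum>j\<in>J. c j * E (S j) f x) - (\<Sum>k\<in>K. d k * E (T k) f x))
    = l2_norm (\<mu> f) (\<lambda>r. (\<Sum>j\<in>J. c j * indicator (S j) r) - (\<Sum>k\<in>K. d k * indicator (T k) r))"
proof -
  \<comment> \<open>The difference of two step functions is one step function, indexed by the disjoint sum.\<close>
  have eq: "(\<Sum>j\<in>J <+> K. case_sum c (\<lambda>k. - d k) j * X (case_sum S T j)) =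
      (\<Sum>j\<in>J. c j * X (S j)) - (\<Sum>k\<in>K. d k * X (T k))" for X :: "real set \<Rightarrow> complex"
    by (simp add: sum.Plus J K sum_negf)
  have "l2_norm M (\<lambda>x. \<Sum>j\<in>J <+> K. case_sum c (\<lambda>k. - d k) j * E (case_sum S T j) f x) =
      l2_norm (\<mu> f) (\<lambda>r. \<Sum>j\<in>J <+> K. case_sum c (\<lambda>k. - d k) j * indicator (case_sum S T j) r)"
    by (rule norm_step_function) (use assms in auto)
  then show ?thesis
    unfolding eq[of "\<lambda>A. E A f x" for x] eq[of "\<lambda>A. indicator A r" for r] .
qed

lemma simple_integral_mem:
  "simple_function borel s \<Longrightarrow> f \<in> l2_space M \<Longrightarrow> simple_spectral_integral E s f \<in> l2_space M"
  unfolding simple_spectral_integral_def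
  by (intro l2.sum_mem simple_range proj_mem simple_vimage)

lemma norm_simple_integral_diff:
  assumes "simple_function borel s" "simple_function borel s'" "f \<in> l2_space M"
  shows "l2_norm M (\<lambda>x. simple_spectral_integral E s f x - simple_spectral_integral E s' f x)
    = l2_norm (\<mu> f) (\<lambda>r. s r - s' r)"
proof -
  have "l2_norm M (\<lambda>x. simple_spectral_integral E s f x - simple_spectral_integral E s' f x)
    = l2_norm (\<mu> f) (\<lambda>r. (\<Sum>c\<in>range s. c * indicator (s -` {c}) r) - (\<Sum>c\<in>range s'. c * indicator (s' -` {c}) r))"
    unfolding simple_spectral_integral_def
    by (rule norm_step_function_diff) (use assms in \<open>auto intro: simple_range simple_vimage\<close>)
  then show ?thesis
    by (simp only: simple_eq_step[OF assms(1), symmetric] simple_eq_step[OF assms(2), symmetric])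
qed

lemma simple_l2:
  assumes s: "simple_function borel s" and f: "f \<in> l2_space M"
  shows "s \<in> l2_space (\<mu> f)"
proof -
  interpret finite_measure "\<mu> f" by (rule finite_\<mu>[OF f])
  have [measurable]: "s \<in> borel_measurable borel"
    using s by (rule borel_measurable_simple_function)
  have fin: "finite ((\<lambda>r. (cmod (s r))\<^sup>2) ` UNIV)"
    using finite_imageI[OF simple_range[OF s], of "\<lambda>z. (cmod z)\<^sup>2"] by (simp add: image_image)
  have "integrable (\<mu> f) (\<lambda>r. (cmod (s r))\<^sup>2)"
  proof (rule integrable_const_bound)
    show "AE r in \<mu> f. norm ((cmod (s r))\<^sup>2) \<le> Max ((\<lambda>r. (cmod (s r))\<^sup>2) ` UNIV)"
      using fin by auto
  qed measurable
  then show ?thesis by (auto simp: l2_space_def)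
qed

lemma spectral_integral_domain:
  assumes "(f, u) \<in> spectral_integral M E \<phi>" and [measurable]: "\<phi> \<in> borel_measurable borel"
  shows "f \<in> l2_space M" "u \<in> l2_space M" "\<phi> \<in> l2_space (\<mu> f)"
proof -
  show f: "f \<in> l2_space M" and "u \<in> l2_space M"
    using assms(1) by (auto simp: spectral_integral_def)
  obtain s where s: "\<And>n. simple_function borel (s n)"
    and lim: "(\<lambda>n. \<integral>\<^sup>+ r. ennreal ((cmod (s n r - \<phi> r))\<^sup>2) \<partial>\<mu> f) \<longlonglongrightarrow> 0"
    using assms(1) by (auto simp: spectral_integral_def)
  note [measurable] = borel_measurable_simple_function[OF s]
  have "\<forall>\<^sub>F n in sequentially. (\<integral>\<^sup>+ r. ennreal ((cmod (s n r - \<phi> r))\<^sup>2) \<partial>\<mu> f) < 1"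
    using lim by (rule order_tendstoD) simp
  then obtain n where n: "(\<integral>\<^sup>+ r. ennreal ((cmod (s n r - \<phi> r))\<^sup>2) \<partial>\<mu> f) < 1"
    by (auto simp: eventually_sequentially)
  have "(\<lambda>r. s n r - \<phi> r) \<in> l2_space (\<mu> f)"
    by (rule l2_spaceI_nn[OF _ less_trans[OF n]]) auto
  from l2.diff_mem[OF simple_l2[OF s[of n] f] this]
  show "\<phi> \<in> l2_space (\<mu> f)" by simp
qed

text \<open>
  In particular the value of a spectral integral at \<open>f\<close> is unique up to equality almost everywhere,
  and approximation in \<open>L\<^sup>2(\<mu>\<^sub>f)\<close> is approximation of vectors.
\<close>

lemma spectral_integral_isometry:
  assumes "(f, u) \<in> spectral_integral M E \<phi>" "(f, v) \<in> spectral_integral M E \<psi>"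
    and [measurable]: "\<phi> \<in> borel_measurable borel" "\<psi> \<in> borel_measurable borel"
  shows "l2_norm M (\<lambda>x. u x - v x) = l2_norm (\<mu> f) (\<lambda>r. \<phi> r - \<psi> r)"
proof -
  note mem = spectral_integral_domain[OF assms(1,3)] spectral_integral_domain[OF assms(2,4)]
  obtain s where s: "\<And>n. simple_function borel (s n)"
    and s1: "(\<lambda>n. \<integral>\<^sup>+ r. ennreal ((cmod (s n r - \<phi> r))\<^sup>2) \<partial>\<mu> f) \<longlonglongrightarrow> 0"
    and s2: "(\<lambda>n. l2_norm M (\<lambda>x. simple_spectral_integral E (s n) f x - u x)) \<longlonglongrightarrow> 0"
    using assms(1) by (auto simp: spectral_integral_def)
  obtain z where z: "\<And>n. simple_function borel (z n)"
    and z1: "(\<lambda>n. \<integral>\<^sup>+ r. ennreal ((cmod (z n r - \<psi> r))\<^sup>2) \<partial>\<mu> f) \<longlonglongrightarrow> 0"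
    and z2: "(\<lambda>n. l2_norm M (\<lambda>x. simple_spectral_integral E (z n) f x - v x)) \<longlonglongrightarrow> 0"
    using assms(2) by (auto simp: spectral_integral_def)
  have "(\<lambda>n. l2_norm M (\<lambda>x. simple_spectral_integral E (s n) f x - simple_spectral_integral E (z n) f x))
      \<longlonglongrightarrow> l2_norm M (\<lambda>x. u x - v x)"
    using l2.seminorm_diff_tendsto[of "\<lambda>n. simple_spectral_integral E (s n) f" M
        "\<lambda>n. simple_spectral_integral E (z n) f" u v] s2 z2 mem s z by (simp add: simple_integral_mem)
  then have 1: "(\<lambda>n. l2_norm (\<mu> f) (\<lambda>r. s n r - z n r)) \<longlonglongrightarrow> l2_norm M (\<lambda>x. u x - v x)"
    using mem s z by (simp add: norm_simple_integral_diff)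
  have s1': "(\<lambda>n. l2_norm (\<mu> f) (\<lambda>r. s n r - \<phi> r)) \<longlonglongrightarrow> 0"
    by (rule norm_tendsto_0_iff_nn[THEN iffD1, OF _ s1]) (intro l2.diff_mem simple_l2 s mem)
  have z1': "(\<lambda>n. l2_norm (\<mu> f) (\<lambda>r. z n r - \<psi> r)) \<longlonglongrightarrow> 0"
    by (rule norm_tendsto_0_iff_nn[THEN iffD1, OF _ z1]) (intro l2.diff_mem simple_l2 z mem)
  have "(\<lambda>n. l2_norm (\<mu> f) (\<lambda>r. s n r - z n r)) \<longlonglongrightarrow> l2_norm (\<mu> f) (\<lambda>r. \<phi> r - \<psi> r)"
    using l2.seminorm_diff_tendsto[of s "\<mu> f" z \<phi> \<psi>] s1' z1' mem s z by (simp add: simple_l2)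
  with 1 show ?thesis by (rule LIMSEQ_unique)
qed

text \<open>
  Simple functions dominated by \<open>2\<bar>\<phi>\<bar>\<close> converge to \<open>\<phi>\<close> in \<open>L\<^sup>2(\<mu>\<^sub>f)\<close>, so their integrals form a
  Cauchy sequence.
\<close>

lemma spectral_integral_exists:
  assumes f: "f \<in> l2_space M" and \<phi>: "\<phi> \<in> l2_space (\<mu> f)"
  shows "\<exists>u. (f, u) \<in> spectral_integral M E \<phi>"
proof -
  have [measurable]: "\<phi> \<in> borel_measurable borel"
    using l2_spaceD(1)[OF \<phi>] by (simp cong: measurable_cong_sets)
  obtain s where s: "\<And>n. simple_function borel (s n)"
    and lim: "\<And>r. (\<lambda>n. s n r) \<longlonglongrightarrow> \<phi> r" and bd: "\<And>n r. cmod (s n r) \<le> 2 * cmod (\<phi> r)"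
    using borel_measurable_implies_sequence_metric[of \<phi> borel 0] by auto
  note [measurable] = borel_measurable_simple_function[OF s]
  have mem: "(\<lambda>r. s n r - \<phi> r) \<in> l2_space (\<mu> f)" for n
    by (intro l2.diff_mem simple_l2 s f \<phi>)
  have "(\<lambda>n. \<integral>r. (cmod (s n r - \<phi> r))\<^sup>2 \<partial>\<mu> f) \<longlonglongrightarrow> (\<integral>r. 0 \<partial>\<mu> f)"
  proof (rule integral_dominated_convergence)
    show "integrable (\<mu> f) (\<lambda>r. 9 * (cmod (\<phi> r))\<^sup>2)"
      by (intro integrable_mult_right l2_spaceD(2) \<phi>)
    show "AE r in \<mu> f. (\<lambda>n. (cmod (s n r - \<phi> r))\<^sup>2) \<longlonglongrightarrow> 0"
    proof (rule AE_I2)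
      fix r
      have "(\<lambda>n. (cmod (s n r - \<phi> r))\<^sup>2) \<longlonglongrightarrow> (cmod (\<phi> r - \<phi> r))\<^sup>2"
        by (intro tendsto_intros lim)
      then show "(\<lambda>n. (cmod (s n r - \<phi> r))\<^sup>2) \<longlonglongrightarrow> 0" by simp
    qed
    show "AE r in \<mu> f. norm ((cmod (s n r - \<phi> r))\<^sup>2) \<le> 9 * (cmod (\<phi> r))\<^sup>2" for n
    proof (rule AE_I2)
      fix r
      have "cmod (s n r - \<phi> r) \<le> 3 * cmod (\<phi> r)"
        using norm_triangle_ineq4[of "s n r" "\<phi> r"] bd[of n r] by linarith
      then have "(cmod (s n r - \<phi> r))\<^sup>2 \<le> (3 * cmod (\<phi> r))\<^sup>2" by (intro power_mono) auto
      then show "norm ((cmod (s n r - \<phi> r))\<^sup>2) \<le> 9 * (cmod (\<phi> r))\<^sup>2" by (simp add: power_mult_distrib)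
    qed
  qed measurable
  then have "(\<lambda>n. l2_norm (\<mu> f) (\<lambda>r. s n r - \<phi> r)) \<longlonglongrightarrow> sqrt 0"
    unfolding l2_norm_def by (intro tendsto_real_sqrt) simp
  then have conv: "(\<lambda>n. l2_norm (\<mu> f) (\<lambda>r. s n r - \<phi> r)) \<longlonglongrightarrow> 0" by simp
  have "\<exists>u\<in>l2_space M. (\<lambda>n. l2_norm M (\<lambda>x. simple_spectral_integral E (s n) f x - u x)) \<longlonglongrightarrow> 0"
  proof (rule Riesz_Fischer)
    show "simple_spectral_integral E (s n) f \<in> l2_space M" for n
      by (intro simple_integral_mem s f)
    fix e :: real assume "e > 0"
    then obtain N where N: "\<And>n. n \<ge> N \<Longrightarrow> l2_norm (\<mu> f) (\<lambda>r. s n r - \<phi> r) < e / 2"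
      using order_tendstoD(2)[OF conv, of "e/2"] by (auto simp: eventually_sequentially)
    show "\<exists>N. \<forall>m\<ge>N. \<forall>n\<ge>N.
        l2_norm M (\<lambda>x. simple_spectral_integral E (s m) f x - simple_spectral_integral E (s n) f x) < e"
    proof (intro exI[of _ N] allI impI)
      fix m n assume mn: "N \<le> m" "N \<le> n"
      have "l2_norm (\<mu> f) (\<lambda>r. s m r - s n r)
          \<le> l2_norm (\<mu> f) (\<lambda>r. s m r - \<phi> r) + l2_norm (\<mu> f) (\<lambda>r. \<phi> r - s n r)"
        using l2.triangle_mid[of "s m" "\<mu> f" \<phi> "s n"] s f \<phi> by (simp add: simple_l2)
      also have "l2_norm (\<mu> f) (\<lambda>r. \<phi> r - s n r) = l2_norm (\<mu> f) (\<lambda>r. s n r - \<phi> r)"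
        using l2.seminorm_minus[of \<phi> "\<mu> f" "s n"] s f \<phi> by (simp add: simple_l2)
      finally show "l2_norm M (\<lambda>x. simple_spectral_integral E (s m) f x - simple_spectral_integral E (s n) f x) < e"
        using N[OF mn(1)] N[OF mn(2)] norm_simple_integral_diff[OF s s f] by simp
    qed
  qed
  then obtain u where "u \<in> l2_space M"
    "(\<lambda>n. l2_norm M (\<lambda>x. simple_spectral_integral E (s n) f x - u x)) \<longlonglongrightarrow> 0" by auto
  with conv f s show ?thesis
    by (auto simp: spectral_integral_def norm_tendsto_0_iff_nn[OF mem] intro!: exI[of _ u] exI[of _ s])
qed

lemma spectral_integral_step:
  assumes J: "finite J" and S: "\<And>j. j \<in> J \<Longrightarrow> S j \<in> sets borel" and f: "f \<in> l2_space M"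
  shows "(f, \<lambda>x. \<Sum>j\<in>J. c j * E (S j) f x) \<in> spectral_integral M E (\<lambda>r. \<Sum>j\<in>J. c j * indicator (S j) r)"
proof -
  define s where "s = (\<lambda>r. \<Sum>j\<in>J. c j * indicator (S j) r :: complex)"
  have s: "simple_function borel s"
    unfolding s_def
    by (intro simple_function_sum simple_function_mult simple_function_const simple_function_indicator S)
  have "l2_norm M (\<lambda>x. simple_spectral_integral E s f x - (\<Sum>j\<in>J. c j * E (S j) f x)) = l2_norm (\<mu> f) (\<lambda>r. s r - s r)"
  proof -
    have "l2_norm M (\<lambda>x. simple_spectral_integral E s f x - (\<Sum>j\<in>J. c j * E (S j) f x))
      = l2_norm (\<mu> f) (\<lambda>r. (\<Sum>c\<in>range s. c * indicator (s -` {c}) r) - (\<Sum>j\<in>J. c j * indicator (S j) r))"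
      unfolding simple_spectral_integral_def
      by (rule norm_step_function_diff) (use J S f s in \<open>auto intro: simple_range simple_vimage\<close>)
    then show ?thesis
      by (simp only: simple_eq_step[OF s, symmetric] fun_cong[OF s_def, symmetric])
  qed
  also have "\<dots> = 0" by (simp add: l2_norm_def)
  finally have 0: "l2_norm M (\<lambda>x. simple_spectral_integral E s f x - (\<Sum>j\<in>J. c j * E (S j) f x)) = 0" .
  have "(\<lambda>x. \<Sum>j\<in>J. c j * E (S j) f x) \<in> l2_space M"
    by (intro l2.sum_mem J proj_mem S f)
  with s f 0 show ?thesis
    unfolding spectral_integral_def s_def[symmetric]
    by (auto intro!: exI[of _ "\<lambda>_. s"])
qed

text \<open>
  On the range of the projection of a short interval, the operator \<open>\<integral>r dE\<close> is nearly multiplication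
  by the left end point: the measure \<open>\<mu>\<^sub>g\<close> of \<open>g = E {a..<a+\<delta>} f\<close> lives on that interval, so
  \<open>\<parallel>h - a g\<parallel>\<^sup>2\<close> is the integral of \<open>(r - a)\<^sup>2 \<le> \<delta>\<^sup>2\<close>.
\<close>

lemma spectral_block:
  assumes f: "f \<in> l2_space M" and "\<delta> > 0"
  shows "\<exists>h. (E {a..<a+\<delta>} f, h) \<in> spectral_integral M E complex_of_real \<and>
    l2_norm M (\<lambda>x. h x - a * E {a..<a+\<delta>} f x) \<le> \<delta> * l2_norm M (E {a..<a+\<delta>} f)"
proof -
  define S where "S = {a..<a+\<delta>}"
  define g where "g = E S f"
  have S[measurable]: "S \<in> sets borel" by (simp add: S_def)
  have g: "g \<in> l2_space M" using f by (auto simp: g_def)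
  interpret finite_measure "\<mu> g" by (rule finite_\<mu>[OF g])
  have "l2_norm M (E (-S) g) = l2_norm M (E {} f)"
    using proj_proj[of "-S" S f] f unfolding g_def
    by (intro l2_norm_cong_AE) (auto intro!: l2_spaceD(1) proj_mem)
  also have "\<dots> = 0"
    using measure_\<mu>[OF f, of "{}"] by simp
  finally have "emeasure (\<mu> g) (- S) = 0"
    using g by (simp add: emeasure_\<mu>)
  then have AE_S: "AE r in \<mu> g. r \<in> S"
    by (intro AE_I[of _ _ "-S"]) auto
  have mem: "complex_of_real \<in> l2_space (\<mu> g)"
  proof -
    have "integrable (\<mu> g) (\<lambda>r. (cmod (complex_of_real r))\<^sup>2)"
    proof (rule integrable_const_bound)
      show "AE r in \<mu> g. norm ((cmod (complex_of_real r))\<^sup>2) \<le> (\<bar>a\<bar> + \<delta>)\<^sup>2"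
        using AE_S
      proof eventually_elim
        case (elim r)
        then have "\<bar>r\<bar>\<^sup>2 \<le> (\<bar>a\<bar> + \<delta>)\<^sup>2" by (intro power_mono) (auto simp: S_def)
        then show ?case by simp
      qed
    qed measurable
    then show ?thesis by (auto simp: l2_space_def)
  qed
  then obtain h where h: "(g, h) \<in> spectral_integral M E complex_of_real"
    using spectral_integral_exists[OF g] by blast
  \<comment> \<open>\<open>a g\<close> agrees almost everywhere with a value of the spectral integral of the constant \<open>a\<close>.\<close>
  have const: "(g, \<lambda>x. a * E UNIV g x) \<in> spectral_integral M E (\<lambda>r. complex_of_real a)"
    using spectral_integral_step[of "{()}" "\<lambda>_. UNIV" g "\<lambda>_. complex_of_real a"] g by simp
  have "l2_norm M (\<lambda>x. h x - a * g x) = l2_norm M (\<lambda>x. h x - a * E UNIV g x)"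
  proof (rule l2_norm_cong_AE)
    show "AE x in M. h x - a * g x = h x - a * E UNIV g x"
      using proj_UNIV[OF g] by eventually_elim simp
  qed (auto intro!: l2_spaceD(1)[OF l2.diff_mem] l2.scale_mem proj_mem g spectral_integral_domain(2)[OF h])
  also have "\<dots> = l2_norm (\<mu> g) (\<lambda>r. r - a)"
    using spectral_integral_isometry[OF h const] by simp
  also have "\<dots> \<le> \<delta> * l2_norm M g"
  proof (rule power2_le_imp_le)
    have "(\<integral>r. (cmod (complex_of_real r - a))\<^sup>2 \<partial>\<mu> g) \<le> (\<integral>r. \<delta>\<^sup>2 \<partial>\<mu> g)"
    proof (rule integral_mono_AE)
      have "(\<lambda>r. complex_of_real r - a) \<in> l2_space (\<mu> g)"
        by (intro l2.diff_mem mem simple_l2 g) simp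
      then show "integrable (\<mu> g) (\<lambda>r. (cmod (complex_of_real r - a))\<^sup>2)" by (rule l2_spaceD(2))
      show "AE r in \<mu> g. (cmod (complex_of_real r - a))\<^sup>2 \<le> \<delta>\<^sup>2"
        using AE_S
      proof eventually_elim
        case (elim r)
        then have "\<bar>r - a\<bar>\<^sup>2 \<le> \<delta>\<^sup>2" by (intro power_mono) (auto simp: S_def)
        then show ?case by (simp flip: of_real_diff)
      qed
    qed simp
    then show "(l2_norm (\<mu> g) (\<lambda>r. r - a))\<^sup>2 \<le> (\<delta> * l2_norm M g)\<^sup>2"
      using measure_\<mu>[OF g, of UNIV] norm_proj_UNIV[OF g]
      by (simp add: l2_norm_square power_mult_distrib mult.commute)
  qed (use \<open>\<delta> > 0\<close> in simp)
  finally show ?thesis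
    using h \<open>\<delta> > 0\<close> unfolding g_def S_def by (intro exI[of _ h]) auto
qed

end

section \<open>Growth of a weighted norm along the semigroup\<close>

locale bounded_weight =
  fixes M :: "'a measure" and \<omega> :: "'a \<Rightarrow> real" and C :: real
  assumes weight_measurable [measurable]: "\<omega> \<in> borel_measurable M"
    and weight_nonneg: "\<And>x. 0 \<le> \<omega> x" and weight_le: "\<And>x. \<omega> x \<le> C"
begin

definition weigh :: "('a \<Rightarrow> complex) \<Rightarrow> 'a \<Rightarrow> complex" where
  "weigh f x = complex_of_real (\<omega> x) * f x"

definition weighted_norm :: "('a \<Rightarrow> complex) \<Rightarrow> real" where
  "weighted_norm f = l2_norm M (\<lambda>x. complex_of_real (sqrt (\<omega> x)) * f x)"

lemma C_nonneg: "0 \<le> C"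
  using weight_nonneg weight_le order_trans by blast

lemma bounded_mult:
  fixes g :: "'a \<Rightarrow> real"
  assumes [measurable]: "g \<in> borel_measurable M" and g: "\<And>x. \<bar>g x\<bar> \<le> c" and f: "f \<in> l2_space M"
  shows "(\<lambda>x. complex_of_real (g x) * f x) \<in> l2_space M"
    and "l2_norm M (\<lambda>x. complex_of_real (g x) * f x) \<le> c * l2_norm M f"
proof -
  note [measurable] = l2_spaceD(1)[OF f]
  have c: "0 \<le> c" using g[of undefined] by linarith
  have le: "(cmod (complex_of_real (g x) * f x))\<^sup>2 \<le> c\<^sup>2 * (cmod (f x))\<^sup>2" for x
    unfolding norm_mult power_mult_distrib using g[of x] by (intro mult_right_mono) (auto simp: power2_le_iff_abs_le c)
  have int: "integrable M (\<lambda>x. c\<^sup>2 * (cmod (f x))\<^sup>2)"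
    by (intro integrable_mult_right l2_spaceD(2) f)
  have "integrable M (\<lambda>x. (cmod (complex_of_real (g x) * f x))\<^sup>2)"
    by (rule Bochner_Integration.integrable_bound[OF int]) (use le in auto)
  then show mem: "(\<lambda>x. complex_of_real (g x) * f x) \<in> l2_space M"
    by (simp add: l2_space_def)
  have "(l2_norm M (\<lambda>x. complex_of_real (g x) * f x))\<^sup>2 \<le> (c * l2_norm M f)\<^sup>2"
    unfolding power_mult_distrib l2_norm_square
    by (subst integral_mult_right_zero[symmetric], rule integral_mono[OF l2_spaceD(2)[OF mem] int le])
  then show "l2_norm M (\<lambda>x. complex_of_real (g x) * f x) \<le> c * l2_norm M f"
    by (rule power2_le_imp_le) (simp add: c)
qed

lemma weigh_mem: "f \<in> l2_space M \<Longrightarrow> weigh f \<in> l2_space M"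
  and weigh_norm: "f \<in> l2_space M \<Longrightarrow> l2_norm M (weigh f) \<le> C * l2_norm M f"
  using bounded_mult[OF weight_measurable, of C f] weight_nonneg weight_le
  unfolding weigh_def[abs_def] by simp_all

lemma sqrt_mul_mem: "f \<in> l2_space M \<Longrightarrow> (\<lambda>x. complex_of_real (sqrt (\<omega> x)) * f x) \<in> l2_space M"
  and weighted_norm_le: "f \<in> l2_space M \<Longrightarrow> weighted_norm f \<le> sqrt C * l2_norm M f"
  using bounded_mult[of "\<lambda>x. sqrt (\<omega> x)" "sqrt C" f] weight_nonneg weight_le
  unfolding weighted_norm_def by simp_all

lemma weighted_norm_square:
  "l2_inner M f (weigh f) = complex_of_real ((weighted_norm f)\<^sup>2)"
proof -
  have "complex_of_real (\<omega> x) = complex_of_real (sqrt (\<omega> x)) * complex_of_real (sqrt (\<omega> x))" for x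
    by (simp add: weight_nonneg flip: of_real_mult)
  then have "l2_inner M f (weigh f) = l2_inner M (\<lambda>x. complex_of_real (sqrt (\<omega> x)) * f x) (\<lambda>x. complex_of_real (sqrt (\<omega> x)) * f x)"
    unfolding l2_inner_def weigh_def by (simp add: algebra_simps)
  then show ?thesis unfolding weighted_norm_def by (simp only: l2_inner_self l2_norm_square)
qed

lemma weigh_symmetric: "l2_inner M f (weigh g) = cnj (l2_inner M g (weigh f))"
  unfolding l2_inner_def weigh_def by (simp add: algebra_simps flip: Bochner_Integration.integral_cnj)

lemma weighted_norm_tendsto:
  assumes u: "\<And>n. u n \<in> l2_space M" and v: "v \<in> l2_space M"
    and lim: "(\<lambda>n. l2_norm M (\<lambda>x. u n x - v x)) \<longlonglongrightarrow> 0"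
  shows "(\<lambda>n. weighted_norm (u n)) \<longlonglongrightarrow> weighted_norm v"
proof (rule LIM_zero_cancel, rule Lim_null_comparison)
  show "(\<lambda>n. sqrt C * l2_norm M (\<lambda>x. u n x - v x)) \<longlonglongrightarrow> 0"
    using tendsto_mult_left[OF lim, of "sqrt C"] by simp
  have "\<bar>weighted_norm (u n) - weighted_norm v\<bar> \<le> sqrt C * l2_norm M (\<lambda>x. u n x - v x)" for n
  proof -
    have "\<bar>weighted_norm (u n) - weighted_norm v\<bar> \<le> weighted_norm (\<lambda>x. u n x - v x)"
      using l2.triangle_diff[OF sqrt_mul_mem[OF u] sqrt_mul_mem[OF v], of n]
      by (simp add: weighted_norm_def right_diff_distrib)
    also have "\<dots> \<le> sqrt C * l2_norm M (\<lambda>x. u n x - v x)"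
      by (intro weighted_norm_le l2.diff_mem u v)
    finally show ?thesis .
  qed
  then show "\<forall>\<^sub>F n in sequentially. norm (weighted_norm (u n) - weighted_norm v) \<le> sqrt C * l2_norm M (\<lambda>x. u n x - v x)"
    by simp
qed

text \<open>
  This lemma and the next compare the weight with constants: from above where \<open>f\<close> lives, and from
  below where the other factor of an inner product lives.
\<close>

lemma weighted_norm_le_on:
  assumes f: "f \<in> l2_space M" and z: "\<And>x. x \<notin> A \<Longrightarrow> f x = 0" and le: "\<And>x. x \<in> A \<Longrightarrow> \<omega> x \<le> c" and c: "0 \<le> c"
  shows "weighted_norm f \<le> sqrt c * l2_norm M f"
proof (rule power2_le_imp_le)
  have "(weighted_norm f)\<^sup>2 \<le> (\<integral>x. c * (cmod (f x))\<^sup>2 \<partial>M)"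
    unfolding weighted_norm_def l2_norm_square
  proof (rule integral_mono)
    show "integrable M (\<lambda>x. (cmod (complex_of_real (sqrt (\<omega> x)) * f x))\<^sup>2)"
      by (intro l2_spaceD(2) sqrt_mul_mem f)
    show "integrable M (\<lambda>x. c * (cmod (f x))\<^sup>2)" by (intro integrable_mult_right l2_spaceD(2) f)
    show "(cmod (complex_of_real (sqrt (\<omega> x)) * f x))\<^sup>2 \<le> c * (cmod (f x))\<^sup>2" for x
      using z[of x] le[of x] weight_nonneg[of x]
      by (cases "x \<in> A") (auto simp: norm_mult power_mult_distrib intro: mult_right_mono)
  qed
  then show "(weighted_norm f)\<^sup>2 \<le> (sqrt c * l2_norm M f)\<^sup>2"
    using c by (simp add: power_mult_distrib l2_norm_square)
qed (use c in simp)

lemma inner_le_weighted_norm: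
  assumes u: "u \<in> l2_space M" and g: "g \<in> l2_space M" and z: "\<And>x. x \<notin> S \<Longrightarrow> g x = 0"
    and ge: "\<And>x. x \<in> S \<Longrightarrow> c \<le> \<omega> x" and c: "0 < c"
  shows "cmod (l2_inner M u g) \<le> weighted_norm u * (l2_norm M g / sqrt c)"
proof -
  \<comment> \<open>Off \<open>S\<close> the weight may be tiny; there \<open>g\<close> vanishes, and cutting off keeps the factor bounded.\<close>
  define v where "v x = complex_of_real (if \<omega> x < c then 0 else 1 / sqrt (\<omega> x)) * g x" for x
  have v: "v \<in> l2_space M" "l2_norm M v \<le> 1 / sqrt c * l2_norm M g"
  proof -
    have "\<bar>if \<omega> x < c then 0 else 1 / sqrt (\<omega> x)\<bar> \<le> 1 / sqrt c" for x
      using c by (auto intro!: divide_left_mono simp: not_less)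
    from bounded_mult[OF _ this g] show "v \<in> l2_space M" "l2_norm M v \<le> 1 / sqrt c * l2_norm M g"
      unfolding v_def[abs_def] by simp_all
  qed
  have eq: "u x * cnj (g x) = complex_of_real (sqrt (\<omega> x)) * u x * cnj (v x)" for x
  proof (cases "x \<in> S")
    case True
    then have "sqrt (\<omega> x) > 0" "\<not> \<omega> x < c" using ge[of x] c by auto
    then show ?thesis by (simp add: v_def)
  qed (simp add: v_def z)
  have "l2_inner M u g = l2_inner M (\<lambda>x. complex_of_real (sqrt (\<omega> x)) * u x) v"
    unfolding l2_inner_def eq ..
  then have "cmod (l2_inner M u g) \<le> weighted_norm u * l2_norm M v"
    using l2.Cauchy_Schwarz[OF sqrt_mul_mem[OF u] v(1)] by (simp add: weighted_norm_def)
  also have "\<dots> \<le> weighted_norm u * (l2_norm M g / sqrt c)"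
    using v(2) by (intro mult_left_mono) (auto simp: weighted_norm_def)
  finally show ?thesis .
qed

end

context spectral_resolution
begin

text \<open>
  The cells of mesh \<open>1/N\<close> are indexed by integers, so the index of the cell containing \<open>r\<close> is
  \<open>\<lfloor>r N\<rfloor>\<close>.
\<close>

definition cell :: "real \<Rightarrow> int \<Rightarrow> real set" where
  "cell N j = {of_int j / N ..< of_int j / N + 1 / N}"

lemma cell_borel [simp, measurable]: "cell N j \<in> sets borel"
  by (simp add: cell_def)

lemma mem_cell_iff: "N > 0 \<Longrightarrow> r \<in> cell N j \<longleftrightarrow> j = \<lfloor>r * N\<rfloor>"
  by (auto simp: cell_def field_simps floor_eq_iff eq_commute[of j])

lemma cell_step:
  assumes "N > 0" "finite J"
  shows "(\<Sum>j\<in>J. c j * indicator (cell N j) r) = (if \<lfloor>r * N\<rfloor> \<in> J then c \<lfloor>r * N\<rfloor> else (0::complex))"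
proof -
  have "(\<Sum>j\<in>J. c j * indicator (cell N j) r) = (\<Sum>j\<in>J. if j = \<lfloor>r * N\<rfloor> then c j else 0)"
    by (intro sum.cong) (auto simp: mem_cell_iff[OF assms(1)] indicator_def)
  then show ?thesis using assms(2) by simp
qed

text \<open>
  The evolution \<open>exp (- s H) f\<close> with the spectral variable rounded down to the grid and cut off outside
  the cells in \<open>J\<close>.
\<close>

definition discrete_evolution :: "('a \<Rightarrow> complex) \<Rightarrow> real \<Rightarrow> int set \<Rightarrow> real \<Rightarrow> 'a \<Rightarrow> complex" where
  "discrete_evolution f N J s x = (\<Sum>j\<in>J. complex_of_real (exp (- s * (j / N))) * E (cell N j) f x)"

lemma discrete_evolution_mem: "f \<in> l2_space M \<Longrightarrow> finite J \<Longrightarrow> discrete_evolution f N J s \<in> l2_space M"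
  unfolding discrete_evolution_def[abs_def] by (intro l2.sum_mem proj_mem cell_borel)

lemma norm_discrete_evolution_le:
  assumes f: "f \<in> l2_space M" and N: "N > 0" and J: "finite J" and b: "\<And>j. j \<in> J \<Longrightarrow> - s * (j / N) \<le> b"
  shows "l2_norm M (discrete_evolution f N J s) \<le> exp b * l2_norm M f"
proof -
  interpret finite_measure "\<mu> f" by (rule finite_\<mu>[OF f])
  define \<sigma> where "\<sigma> r = (\<Sum>j\<in>J. complex_of_real (exp (- s * (j / N))) * indicator (cell N j) r)" for r
  have bd: "(cmod (\<sigma> r))\<^sup>2 \<le> (exp b)\<^sup>2" for r
    unfolding \<sigma>_def cell_step[OF N J]
    by (intro power_mono) (use b in auto)
  have [measurable]: "\<sigma> \<in> borel_measurable borel" unfolding \<sigma>_def by measurable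
  have "l2_norm M (discrete_evolution f N J s) = l2_norm (\<mu> f) \<sigma>"
    unfolding discrete_evolution_def \<sigma>_def by (rule norm_step_function[OF J _ f]) simp
  also have "\<dots> \<le> exp b * l2_norm M f"
  proof (rule power2_le_imp_le)
    have "(\<integral>r. (cmod (\<sigma> r))\<^sup>2 \<partial>\<mu> f) \<le> (\<integral>r. (exp b)\<^sup>2 \<partial>\<mu> f)"
    proof (rule integral_mono)
      show "integrable (\<mu> f) (\<lambda>r. (cmod (\<sigma> r))\<^sup>2)"
        by (rule integrable_const_bound[where B="(exp b)\<^sup>2"]) (use bd in auto)
    qed (use bd in auto)
    then show "(l2_norm (\<mu> f) \<sigma>)\<^sup>2 \<le> (exp b * l2_norm M f)\<^sup>2"
      using measure_\<mu>[OF f, of UNIV] norm_proj_UNIV[OF f]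
      by (simp add: l2_norm_square power_mult_distrib mult.commute)
  qed simp
  finally show ?thesis .
qed

text \<open>
  The projections of disjoint cells are orthogonal, so the squares of the norms add up to at most
  \<open>\<parallel>f\<parallel>\<^sup>2\<close>.  The factor \<open>sqrt (card J)\<close> lost here is harmless: the number of cells grows like \<open>N\<close>, and the
  error that is summed is of order \<open>1/N\<close> on each cell.
\<close>

lemma sum_norm_cells:
  assumes f: "f \<in> l2_space M" and N: "N > 0" and J: "finite J"
  shows "(\<Sum>j\<in>J. l2_norm M (E (cell N j) f)) \<le> sqrt (card J) * l2_norm M f"
proof (rule power2_le_imp_le)
  interpret finite_measure "\<mu> f" by (rule finite_\<mu>[OF f])
  have "(\<Sum>j\<in>J. (l2_norm M (E (cell N j) f))\<^sup>2) = (\<Sum>j\<in>J. measure (\<mu> f) (cell N j))"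
    by (simp add: measure_\<mu>[OF f])
  also have "\<dots> = measure (\<mu> f) (\<Union>j\<in>J. cell N j)"
    by (intro measure_finite_Union[symmetric] J) (auto simp: disjoint_family_on_def mem_cell_iff[OF N])
  also have "\<dots> \<le> measure (\<mu> f) UNIV" by (intro finite_measure_mono) auto
  also have "\<dots> = (l2_norm M f)\<^sup>2" using measure_\<mu>[OF f, of UNIV] norm_proj_UNIV[OF f] by simp
  finally have *: "(\<Sum>j\<in>J. (l2_norm M (E (cell N j) f))\<^sup>2) \<le> (l2_norm M f)\<^sup>2" .
  have "(\<Sum>j\<in>J. l2_norm M (E (cell N j) f))\<^sup>2 \<le> (\<Sum>j\<in>J. 1\<^sup>2) * (\<Sum>j\<in>J. (l2_norm M (E (cell N j) f))\<^sup>2)"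
    using Cauchy_Schwarz_ineq_sum[of "\<lambda>j. 1" "\<lambda>j. l2_norm M (E (cell N j) f)" J] by simp
  also have "\<dots> \<le> card J * (l2_norm M f)\<^sup>2" using * by (simp add: mult_left_mono)
  finally show "(\<Sum>j\<in>J. l2_norm M (E (cell N j) f))\<^sup>2 \<le> (sqrt (card J) * l2_norm M f)\<^sup>2"
    by (simp add: power_mult_distrib)
qed simp

end

text \<open>
  The abstract setting of the weighted estimate.  The last assumption bounds the
  generator from below in the weighted pairing; for the magnetic operator \<open>\<kappa> = a\<^sup>2\<close>.
\<close>

locale weighted_resolution = spectral_resolution M E + bounded_weight M \<omega> C
  for M :: "'a measure" and E \<omega> C +
  fixes \<kappa> :: real
  assumes \<kappa>_nonneg: "0 \<le> \<kappa>"
    and generator_sum: "\<And>J :: int set. \<And>f h c. finite J \<Longrightarrow>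
        (\<And>j. j \<in> J \<Longrightarrow> (f j, h j) \<in> spectral_integral M E complex_of_real) \<Longrightarrow>
        ((\<lambda>x. \<Sum>j\<in>J. c j * f j x), (\<lambda>x. \<Sum>j\<in>J. c j * h j x)) \<in> spectral_integral M E complex_of_real"
    and lower_bound: "\<And>f h. (f, h) \<in> spectral_integral M E complex_of_real \<Longrightarrow>
        - \<kappa> * (weighted_norm f)\<^sup>2 \<le> Re (l2_inner M h (weigh f))"
begin

lemma discrete_evolution_derivative:
  assumes f: "f \<in> l2_space M" and N: "N > 0" and J: "finite J"
  shows "((\<lambda>s. (weighted_norm (discrete_evolution f N J s))\<^sup>2) has_real_derivative
    - 2 * Re (l2_inner M (\<lambda>x. \<Sum>j\<in>J. complex_of_real ((j / N) * exp (- s * (j / N))) * E (cell N j) f x)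
        (weigh (discrete_evolution f N J s)))) (at s)"
proof -
  define A where "A j k = Re (l2_inner M (E (cell N j) f) (weigh (E (cell N k) f)))" for j k
  have mem: "E (cell N j) f \<in> l2_space M" for j using f by auto
  have expand: "Re (l2_inner M (\<lambda>x. \<Sum>j\<in>J. complex_of_real (c j) * E (cell N j) f x) (weigh (discrete_evolution f N J s)))
      = (\<Sum>j\<in>J. \<Sum>k\<in>J. c j * exp (- s * (k / N)) * A j k)" for c :: "int \<Rightarrow> real" and s
  proof -
    have w: "weigh (discrete_evolution f N J s) = (\<lambda>x. \<Sum>k\<in>J. complex_of_real (exp (- s * (k / N))) * weigh (E (cell N k) f) x)"
      by (rule ext) (simp add: weigh_def discrete_evolution_def sum_distrib_left mult.left_commute)
    have "l2_inner M (\<lambda>x. \<Sum>j\<in>J. complex_of_real (c j) * E (cell N j) f x) (weigh (discrete_evolution f N J s))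
      = (\<Sum>j\<in>J. complex_of_real (c j) * l2_inner M (E (cell N j) f) (weigh (discrete_evolution f N J s)))"
      by (intro l2.sum_left J mem weigh_mem discrete_evolution_mem f)
    also have "\<dots> = (\<Sum>j\<in>J. complex_of_real (c j) * (\<Sum>k\<in>J. cnj (complex_of_real (exp (- s * (k / N))))
        * l2_inner M (E (cell N j) f) (weigh (E (cell N k) f))))"
      unfolding w by (intro sum.cong refl arg_cong2[of _ _ _ _ "(*)"] l2.sum_right J mem weigh_mem)
    finally show ?thesis
      by (simp add: A_def sum_distrib_left mult.assoc)
  qed
  \<comment> \<open>Real parts make the Gram matrix symmetric, so the derivatives of the two exponentials contribute equally.\<close>
  have sym: "A j k = A k j" for j k
    unfolding A_def by (subst weigh_symmetric) simp
  have I: "(weighted_norm (discrete_evolution f N J s))\<^sup>2 = (\<Sum>j\<in>J. \<Sum>k\<in>J. exp (- s * (j / N)) * exp (- s * (k / N)) * A j k)" for s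
    using expand[of "\<lambda>j. exp (- s * (j / N))" s] weighted_norm_square[of "discrete_evolution f N J s"]
    by (simp add: discrete_evolution_def[abs_def])
  have "((\<lambda>s. \<Sum>j\<in>J. \<Sum>k\<in>J. exp (- s * (j / N)) * exp (- s * (k / N)) * A j k) has_real_derivative
      (\<Sum>j\<in>J. \<Sum>k\<in>J. (- (j / N) - k / N) * (exp (- s * (j / N)) * exp (- s * (k / N)) * A j k))) (at s)"
    using N by (auto intro!: derivative_eq_intros sum.cong simp: algebra_simps)
  moreover have "(\<Sum>j\<in>J. \<Sum>k\<in>J. (- (j / N) - k / N) * (exp (- s * (j / N)) * exp (- s * (k / N)) * A j k))
    = - 2 * (\<Sum>j\<in>J. \<Sum>k\<in>J. ((j / N) * exp (- s * (j / N))) * exp (- s * (k / N)) * A j k)"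
  proof -
    let ?X = "\<lambda>j k. ((j / N) * exp (- s * (j / N))) * exp (- s * (k / N)) * A j k"
    have "(\<Sum>j\<in>J. \<Sum>k\<in>J. (- (j / N) - k / N) * (exp (- s * (j / N)) * exp (- s * (k / N)) * A j k))
      = - (\<Sum>j\<in>J. \<Sum>k\<in>J. ?X j k) - (\<Sum>j\<in>J. \<Sum>k\<in>J. ?X k j)"
      unfolding sum_negf[symmetric] sum_subtractf[symmetric]
    proof (intro sum.cong refl)
      fix j k
      show "(- (j / N) - k / N) * (exp (- s * (j / N)) * exp (- s * (k / N)) * A j k) = - ?X j k - ?X k j"
        unfolding sym[of k j] by (simp add: algebra_simps)
    qed
    also have "(\<Sum>j\<in>J. \<Sum>k\<in>J. ?X k j) = (\<Sum>j\<in>J. \<Sum>k\<in>J. ?X j k)" by (rule sum.swap)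
    finally show ?thesis by simp
  qed
  ultimately show ?thesis unfolding I expand by simp
qed

text \<open>
  Gronwall's argument for the function \<open>I s = (weighted_norm (discrete_evolution f N J s))\<^sup>2\<close>.  In its derivative the
  multiplication by grid points is replaced by the generator at the cost of \<open>err\<close>, and the lower
  bound gives \<open>I' \<le> 2\<kappa>I + err\<close>.
\<close>

lemma discrete_evolution_bound:
  assumes f: "f \<in> l2_space M" and N: "N > 0" and t: "t \<ge> 0" and J: "finite J"
    and R: "\<And>j. j \<in> J \<Longrightarrow> \<bar>j / N\<bar> \<le> R"
  shows "(weighted_norm (discrete_evolution f N J t))\<^sup>2 \<le> exp (2 * \<kappa> * t) *
    ((weighted_norm (discrete_evolution f N J 0))\<^sup>2 + t * (2 * C * (exp (t * R))\<^sup>2 * (1 / N * sqrt (card J)) * (l2_norm M f)\<^sup>2))"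
proof -
  define err where "err = 2 * C * (exp (t * R))\<^sup>2 * (1 / N * sqrt (card J)) * (l2_norm M f)\<^sup>2"
  define I where "I s = (weighted_norm (discrete_evolution f N J s))\<^sup>2" for s
  define F where "F j = E (cell N j) f" for j
  have F: "F j \<in> l2_space M" for j unfolding F_def using f by auto
  have "\<exists>h. (F j, h) \<in> spectral_integral M E complex_of_real \<and>
    l2_norm M (\<lambda>x. h x - complex_of_real (j / N) * F j x) \<le> 1 / N * l2_norm M (F j)" for j
    unfolding F_def cell_def by (rule spectral_block[OF f]) (use N in simp)
  then obtain h where h: "\<And>j. (F j, h j) \<in> spectral_integral M E complex_of_real"
    and hn: "\<And>j. l2_norm M (\<lambda>x. h j x - complex_of_real (j / N) * F j x) \<le> 1 / N * l2_norm M (F j)"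
    by metis
  have hm: "h j \<in> l2_space M" for j by (rule spectral_integral_domain(2)[OF h]) simp
  have deriv: "\<exists>y. (I has_real_derivative y) (at s) \<and> y \<le> 2 * \<kappa> * I s + err" if s: "0 \<le> s" "s \<le> t" for s
  proof -
    define e where "e j = exp (- s * (j / N))" for j :: int
    define w where "w = discrete_evolution f N J s"
    have w: "w = (\<lambda>x. \<Sum>j\<in>J. complex_of_real (e j) * F j x)"
      by (rule ext) (simp add: w_def discrete_evolution_def e_def F_def)
    have wm: "w \<in> l2_space M" unfolding w_def by (rule discrete_evolution_mem[OF f J])
    define g where "g = (\<lambda>x. \<Sum>j\<in>J. complex_of_real (e j) * h j x)"
    have gm: "g \<in> l2_space M" unfolding g_def by (intro l2.sum_mem J hm)
    have wg: "(w, g) \<in> spectral_integral M E complex_of_real"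
      unfolding w g_def by (rule generator_sum[OF J h])
    define p where "p = (\<lambda>x. \<Sum>j\<in>J. complex_of_real ((j / N) * e j) * F j x)"
    have pm: "p \<in> l2_space M" unfolding p_def by (intro l2.sum_mem J F)
    have eb: "- s * (j / N) \<le> t * R" if "j \<in> J" for j
    proof -
      have "s * - (j / N) \<le> s * \<bar>j / N\<bar>" by (intro mult_left_mono s abs_ge_minus_self)
      then have "- s * (j / N) \<le> s * \<bar>j / N\<bar>" by simp
      also have "\<dots> \<le> t * R" using s R[OF that] by (intro mult_mono) auto
      finally show ?thesis .
    qed
    have ebd: "e j \<le> exp (t * R)" if "j \<in> J" for j unfolding e_def using eb[OF that] by simp
    have rho: "l2_norm M (\<lambda>x. g x - p x) \<le> exp (t * R) * (1 / N * (sqrt (card J) * l2_norm M f))"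
    proof -
      have gp: "(\<lambda>x. g x - p x) = (\<lambda>x. \<Sum>j\<in>J. complex_of_real (e j) * (h j x - complex_of_real (j / N) * F j x))"
        by (rule ext) (simp add: g_def p_def sum_subtractf algebra_simps)
      have "l2_norm M (\<lambda>x. g x - p x) \<le>
        (\<Sum>j\<in>J. cmod (complex_of_real (e j)) * l2_norm M (\<lambda>x. h j x - complex_of_real (j / N) * F j x))"
        unfolding gp by (rule l2.seminorm_sum_le[unfolded l2_seminorm, OF J]) (intro l2.diff_mem l2.scale_mem hm F)
      also have "\<dots> \<le> (\<Sum>j\<in>J. exp (t * R) * (1 / N * l2_norm M (F j)))"
      proof (intro sum_mono mult_mono hn)
        show "cmod (complex_of_real (e j)) \<le> exp (t * R)" if "j \<in> J" for j
          using ebd[OF that] by (simp add: e_def)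
      qed auto
      also have "\<dots> = exp (t * R) * (1 / N * (\<Sum>j\<in>J. l2_norm M (F j)))"
        by (simp add: sum_distrib_left)
      also have "\<dots> \<le> exp (t * R) * (1 / N * (sqrt (card J) * l2_norm M f))"
        using N sum_norm_cells[OF f N J] unfolding F_def by (intro mult_left_mono) auto
      finally show ?thesis .
    qed
    have wn: "l2_norm M (weigh w) \<le> C * (exp (t * R) * l2_norm M f)"
      using weigh_norm[OF wm] mult_left_mono[OF norm_discrete_evolution_le[OF f N J eb] C_nonneg]
      unfolding w_def by linarith
    have cross: "Re (l2_inner M (\<lambda>x. g x - p x) (weigh w)) \<le> err / 2"
    proof -
      have "Re (l2_inner M (\<lambda>x. g x - p x) (weigh w)) \<le> l2_norm M (\<lambda>x. g x - p x) * l2_norm M (weigh w)"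
        using complex_Re_le_cmod order_trans
          l2.Cauchy_Schwarz[OF l2.diff_mem[OF gm pm] weigh_mem[OF wm]] by (metis l2_seminorm)
      also have "\<dots> \<le> (exp (t * R) * (1 / N * (sqrt (card J) * l2_norm M f))) * (C * (exp (t * R) * l2_norm M f))"
        using N by (intro mult_mono rho wn) auto
      also have "\<dots> = err / 2" by (simp add: err_def power2_eq_square)
      finally show ?thesis .
    qed
    have "- 2 * Re (l2_inner M p (weigh w)) =
        2 * Re (l2_inner M (\<lambda>x. g x - p x) (weigh w)) - 2 * Re (l2_inner M g (weigh w))"
      using gm pm weigh_mem[OF wm] by (simp add: l2.diff_left)
    also have "\<dots> \<le> err + 2 * (\<kappa> * (weighted_norm w)\<^sup>2)"
      using cross lower_bound[OF wg] by simp
    finally have "- 2 * Re (l2_inner M p (weigh w)) \<le> 2 * \<kappa> * I s + err"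
      by (simp add: I_def w_def)
    moreover have "(I has_real_derivative - 2 * Re (l2_inner M p (weigh w))) (at s)"
      using discrete_evolution_derivative[OF f N J, of s] unfolding I_def[abs_def] p_def w_def e_def F_def .
    ultimately show ?thesis by blast
  qed
  have err0: "0 \<le> err" unfolding err_def using C_nonneg N by simp
  \<comment> \<open>The integrating factor makes this function nonincreasing.\<close>
  define G where "G s = exp (- (2 * \<kappa> * s)) * I s - s * err" for s
  have "G 0 \<ge> G t"
  proof (rule DERIV_nonpos_imp_nonincreasing[OF t])
    fix s assume s: "0 \<le> s" "s \<le> t"
    then obtain y where y: "(I has_real_derivative y) (at s)" "y \<le> 2 * \<kappa> * I s + err"
      using deriv by blast
    have "(G has_real_derivative (exp (- (2 * \<kappa> * s)) * (y - 2 * \<kappa> * I s) - err)) (at s)"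
      unfolding G_def[abs_def]
      by (auto intro!: derivative_eq_intros y(1) simp: algebra_simps)
    moreover have "exp (- (2 * \<kappa> * s)) * (y - 2 * \<kappa> * I s) \<le> exp (- (2 * \<kappa> * s)) * err"
      using y(2) by simp
    moreover have "exp (- (2 * \<kappa> * s)) * err \<le> 1 * err"
      using err0 \<kappa>_nonneg s by (intro mult_right_mono) auto
    ultimately show "\<exists>y. (G has_real_derivative y) (at s) \<and> y \<le> 0"
      by (intro exI conjI) (assumption, linarith)
  qed
  then have "exp (- (2 * \<kappa> * t)) * I t \<le> I 0 + t * err" by (simp add: G_def)
  then have "exp (2 * \<kappa> * t) * (exp (- (2 * \<kappa> * t)) * I t) \<le> exp (2 * \<kappa> * t) * (I 0 + t * err)"
    by (intro mult_left_mono) auto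
  then show ?thesis by (simp add: I_def err_def mult.assoc[symmetric] exp_add[symmetric])
qed

text \<open>
  Rounding down multiplies the exponential by at most \<open>exp s\<close>, so \<open>(exp s + 1) exp (- s r)\<close> dominates the
  differences; it lies in \<open>L\<^sup>2(\<mu>\<^sub>f)\<close> because the vector \<open>u\<close> is given.
\<close>

lemma discrete_evolution_tendsto:
  fixes N :: "nat \<Rightarrow> nat"
  assumes u: "(f, u) \<in> spectral_integral M E (\<lambda>r. complex_of_real (exp (- s * r)))" and s: "s \<ge> 0"
    and N: "\<And>n. n < N n"
  shows "(\<lambda>n. l2_norm M (\<lambda>x. discrete_evolution f (N n) {- int (n * N n)..<int (n * N n)} s x - u x)) \<longlonglongrightarrow> 0"
proof -
  define J where "J n = {- int (n * N n)..<int (n * N n)}" for n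
  note dom = spectral_integral_domain[OF u]
  have f: "f \<in> l2_space M" using dom by simp
  have e2: "(\<lambda>r. complex_of_real (exp (- s * r))) \<in> l2_space (\<mu> f)" using dom by simp
  have N0: "real (N n) > 0" for n using N[of n] by simp
  define \<sigma> where "\<sigma> n r = (\<Sum>j\<in>J n. complex_of_real (exp (- s * (j / real (N n)))) * indicator (cell (N n) j) r)" for n r
  have \<sigma>: "\<sigma> n r = (if \<lfloor>r * real (N n)\<rfloor> \<in> J n then complex_of_real (exp (- s * (\<lfloor>r * real (N n)\<rfloor> / real (N n)))) else 0)" for n r
    unfolding \<sigma>_def by (rule cell_step[OF N0]) (simp add: J_def)
  have [measurable]: "\<sigma> n \<in> borel_measurable borel" for n unfolding \<sigma>_def by measurable
  have dist: "\<lfloor>r * real (N n)\<rfloor> / real (N n) \<le> r" "r - 1 / real (N n) \<le> \<lfloor>r * real (N n)\<rfloor> / real (N n)" for r n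
  proof -
    have "real_of_int \<lfloor>r * real (N n)\<rfloor> \<le> r * real (N n)" "r * real (N n) - 1 \<le> \<lfloor>r * real (N n)\<rfloor>" by linarith+
    then show "\<lfloor>r * real (N n)\<rfloor> / real (N n) \<le> r" "r - 1 / real (N n) \<le> \<lfloor>r * real (N n)\<rfloor> / real (N n)"
      using N0[of n] by (simp_all add: pos_le_divide_eq pos_divide_le_eq left_diff_distrib)
  qed
  have N1: "1 / real (N n) \<le> 1 / Suc n" for n using N[of n] by (simp add: frac_le)
  have "(\<lambda>n. 1 / real (Suc n)) \<longlonglongrightarrow> 0" using LIMSEQ_inverse_real_of_nat by (simp add: inverse_eq_divide)
  then have N_lim: "(\<lambda>n. 1 / real (N n)) \<longlonglongrightarrow> 0"
    by (rule Lim_null_comparison[rotated]) (use N1 in auto)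
  have lim: "(\<lambda>n. \<sigma> n r) \<longlonglongrightarrow> complex_of_real (exp (- s * r))" for r
  proof -
    have "(\<lambda>n. \<lfloor>r * real (N n)\<rfloor> / real (N n)) \<longlonglongrightarrow> r"
    proof (rule tendsto_sandwich)
      show "(\<lambda>n. r - 1 / real (N n)) \<longlonglongrightarrow> r" using tendsto_diff[OF tendsto_const N_lim, of r] by simp
    qed (use dist in auto)
    then have "(\<lambda>n. complex_of_real (exp (- s * (\<lfloor>r * real (N n)\<rfloor> / real (N n))))) \<longlonglongrightarrow> complex_of_real (exp (- s * r))"
      by (intro tendsto_intros)
    moreover have "\<forall>\<^sub>F n in sequentially. \<sigma> n r = complex_of_real (exp (- s * (\<lfloor>r * real (N n)\<rfloor> / real (N n))))"
    proof -
      obtain m :: nat where m: "\<bar>r\<bar> < m" using reals_Archimedean2 by blast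
      have "\<sigma> n r = complex_of_real (exp (- s * (\<lfloor>r * real (N n)\<rfloor> / real (N n))))" if "n \<ge> m" for n
      proof -
        have r: "- real n \<le> r" "r < real n" using m that by linarith+
        have "- real n * N n \<le> r * real (N n)" "r * real (N n) < real n * N n"
          using r N0[of n] by (intro mult_right_mono mult_strict_right_mono; simp)+
        then have "- int (n * N n) \<le> \<lfloor>r * real (N n)\<rfloor>" "\<lfloor>r * real (N n)\<rfloor> < int (n * N n)"
          by (simp_all add: le_floor_iff floor_less_iff)
        then show ?thesis by (simp add: \<sigma> J_def)
      qed
      then show ?thesis by (auto simp: eventually_sequentially)
    qed
    ultimately show ?thesis by (subst tendsto_cong)
  qed
  define g where "g n r = \<sigma> n r - complex_of_real (exp (- s * r))" for n r
  have [measurable]: "g n \<in> borel_measurable borel" for n unfolding g_def by measurable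
  have "(\<lambda>n. \<integral>r. (cmod (g n r))\<^sup>2 \<partial>\<mu> f) \<longlonglongrightarrow> (\<integral>r. 0 \<partial>\<mu> f)"
  proof (rule integral_dominated_convergence)
    show "integrable (\<mu> f) (\<lambda>r. (exp s + 1)\<^sup>2 * (cmod (complex_of_real (exp (- s * r))))\<^sup>2)"
      by (intro integrable_mult_right l2_spaceD(2) e2)
    show "AE r in \<mu> f. (\<lambda>n. (cmod (g n r))\<^sup>2) \<longlonglongrightarrow> 0"
    proof (rule AE_I2)
      fix r
      have "(\<lambda>n. (cmod (g n r))\<^sup>2) \<longlonglongrightarrow> (cmod (complex_of_real (exp (- s * r)) - complex_of_real (exp (- s * r))))\<^sup>2"
        unfolding g_def by (intro tendsto_intros lim)
      then show "(\<lambda>n. (cmod (g n r))\<^sup>2) \<longlonglongrightarrow> 0" by simp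
    qed
    show "AE r in \<mu> f. norm ((cmod (g n r))\<^sup>2) \<le> (exp s + 1)\<^sup>2 * (cmod (complex_of_real (exp (- s * r))))\<^sup>2" for n
    proof (rule AE_I2)
      fix r
      have "cmod (\<sigma> n r) \<le> exp s * exp (- s * r)"
      proof (cases "\<lfloor>r * real (N n)\<rfloor> \<in> J n")
        case True
        have "1 / real (N n) \<le> 1" using N0[of n] by simp
        then have "r - \<lfloor>r * real (N n)\<rfloor> / real (N n) \<le> 1" using dist(2)[of r n] by linarith
        then have "s * (r - \<lfloor>r * real (N n)\<rfloor> / real (N n)) \<le> s * 1" using s by (rule mult_left_mono)
        then have "- s * (\<lfloor>r * real (N n)\<rfloor> / real (N n)) \<le> s + - s * r" by (simp add: algebra_simps)
        then have "exp (- s * (\<lfloor>r * real (N n)\<rfloor> / real (N n))) \<le> exp (s + - s * r)" by simp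
        also have "\<dots> = exp s * exp (- s * r)" by (rule exp_add)
        finally show ?thesis using True by (simp add: \<sigma>)
      qed (simp add: \<sigma>)
      then have "cmod (g n r) \<le> exp s * exp (- s * r) + exp (- s * r)"
        unfolding g_def using norm_triangle_ineq4[of "\<sigma> n r" "complex_of_real (exp (- s * r))"] by simp
      then have "cmod (g n r) \<le> (exp s + 1) * exp (- s * r)" by (simp add: algebra_simps)
      then have "(cmod (g n r))\<^sup>2 \<le> ((exp s + 1) * exp (- s * r))\<^sup>2" by (intro power_mono) auto
      then show "norm ((cmod (g n r))\<^sup>2) \<le> (exp s + 1)\<^sup>2 * (cmod (complex_of_real (exp (- s * r))))\<^sup>2"
        by (simp add: power_mult_distrib)
    qed
  qed measurable
  then have "(\<lambda>n. l2_norm (\<mu> f) (g n)) \<longlonglongrightarrow> sqrt 0"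
    unfolding l2_norm_def by (intro tendsto_real_sqrt) simp
  moreover have "l2_norm M (\<lambda>x. discrete_evolution f (N n) (J n) s x - u x) = l2_norm (\<mu> f) (g n)" for n
  proof -
    have "(f, discrete_evolution f (N n) (J n) s) \<in> spectral_integral M E (\<sigma> n)"
      unfolding discrete_evolution_def[abs_def] \<sigma>_def[abs_def]
      by (rule spectral_integral_step[OF _ _ f]) (auto simp: J_def)
    from spectral_integral_isometry[OF this u] show ?thesis by (simp add: g_def[abs_def])
  qed
  ultimately show ?thesis by (simp add: J_def)
qed

lemma weighted_semigroup_bound:
  assumes u: "(f, u) \<in> spectral_integral M E (\<lambda>r. complex_of_real (exp (- t * r)))" and t: "t \<ge> 0"
  shows "weighted_norm u \<le> exp (\<kappa> * t) * weighted_norm f"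
proof -
  have dom: "f \<in> l2_space M" "u \<in> l2_space M"
    using spectral_integral_domain[OF u] by auto
  \<comment> \<open>Cutting off at \<open>n\<close> costs a factor \<open>exp (2 t n)\<close> in the error; this mesh makes the total error at most of order \<open>1/(n+1)\<close>.\<close>
  define m where "m n = nat \<lceil>2 * n * (real n + 1)\<^sup>2 * (exp (t * n))^4\<rceil> + n + 1" for n :: nat
  have m: "2 * n * (real n + 1)\<^sup>2 * (exp (t * n))^4 \<le> m n" "n < m n" for n
    unfolding m_def by (simp_all, linarith)
  define J where "J n = {- int (n * m n)..<int (n * m n)}" for n
  have J: "finite (J n)" for n by (simp add: J_def)
  have card: "real (card (J n)) = 2 * n * m n" for n by (simp add: J_def)
  \<comment> \<open>At time zero the limit is \<open>f\<close>, represented by \<open>E UNIV f\<close>.\<close>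
  have f1: "(f, \<lambda>x. E UNIV f x) \<in> spectral_integral M E (\<lambda>r. complex_of_real (exp (- 0 * r)))"
    using spectral_integral_step[of "{()}" "\<lambda>_. UNIV" f "\<lambda>_. 1"] dom by simp
  have "(\<lambda>n. l2_norm M (\<lambda>x. discrete_evolution f (m n) (J n) 0 x - E UNIV f x)) \<longlonglongrightarrow> 0"
    unfolding J_def by (rule discrete_evolution_tendsto[OF f1 _ m(2)]) simp
  moreover have "l2_norm M (\<lambda>x. discrete_evolution f (m n) (J n) 0 x - E UNIV f x)
      = l2_norm M (\<lambda>x. discrete_evolution f (m n) (J n) 0 x - f x)" for n
  proof (rule l2_norm_cong_AE)
    show "AE x in M. discrete_evolution f (m n) (J n) 0 x - E UNIV f x = discrete_evolution f (m n) (J n) 0 x - f x"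
      using proj_UNIV[OF dom(1)] by eventually_elim simp
  qed (auto intro!: l2_spaceD(1)[OF l2.diff_mem] discrete_evolution_mem proj_mem dom J)
  ultimately have "(\<lambda>n. weighted_norm (discrete_evolution f (m n) (J n) 0)) \<longlonglongrightarrow> weighted_norm f"
    by (intro weighted_norm_tendsto discrete_evolution_mem dom J) simp
  moreover have "(\<lambda>n. weighted_norm (discrete_evolution f (m n) (J n) t)) \<longlonglongrightarrow> weighted_norm u"
    unfolding J_def
    by (intro weighted_norm_tendsto discrete_evolution_mem dom discrete_evolution_tendsto[OF u t m(2)]) simp
  ultimately have lim0: "(\<lambda>n. (weighted_norm (discrete_evolution f (m n) (J n) 0))\<^sup>2) \<longlonglongrightarrow> (weighted_norm f)\<^sup>2"
    and limt: "(\<lambda>n. (weighted_norm (discrete_evolution f (m n) (J n) t))\<^sup>2) \<longlonglongrightarrow> (weighted_norm u)\<^sup>2"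
    by (auto intro: tendsto_power)
  have bound: "(weighted_norm (discrete_evolution f (m n) (J n) t))\<^sup>2 \<le> exp (2 * \<kappa> * t) *
      ((weighted_norm (discrete_evolution f (m n) (J n) 0))\<^sup>2 + t * (2 * C * (1 / Suc n) * (l2_norm M f)\<^sup>2))" for n
  proof -
    have m0: "real (m n) > 0" using m(2)[of n] by simp
    have "(weighted_norm (discrete_evolution f (m n) (J n) t))\<^sup>2 \<le> exp (2 * \<kappa> * t) * ((weighted_norm (discrete_evolution f (m n) (J n) 0))\<^sup>2 +
       t * (2 * C * (exp (t * n))\<^sup>2 * (1 / m n * sqrt (card (J n))) * (l2_norm M f)\<^sup>2))"
    proof (rule discrete_evolution_bound[OF dom(1) m0 t J])
      fix j assume "j \<in> J n"
      then have "\<bar>j\<bar> \<le> int n * int (m n)" by (auto simp: J_def)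
      then have "real_of_int \<bar>j\<bar> \<le> real n * real (m n)"
        by (metis of_int_le_iff of_int_mult of_int_of_nat_eq)
      then show "\<bar>j / m n\<bar> \<le> n" using m0 by (simp add: field_simps)
    qed
    also have "\<dots> \<le> exp (2 * \<kappa> * t) *
      ((weighted_norm (discrete_evolution f (m n) (J n) 0))\<^sup>2 + t * (2 * C * (1 / Suc n) * (l2_norm M f)\<^sup>2))"
    proof -
      have "(exp (t * n))\<^sup>2 * (1 / m n * sqrt (card (J n))) \<le> 1 / Suc n"
      proof (rule power2_le_imp_le)
        have "((exp (t * n))\<^sup>2 * (1 / m n * sqrt (card (J n))))\<^sup>2 = (exp (t * n))^4 * (2 * n) / m n"
          unfolding card using m0 by (simp add: power_mult_distrib power_divide power2_eq_square field_simps eval_nat_numeral)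
        also have "\<dots> \<le> (1 / Suc n)\<^sup>2"
          using m(1)[of n] m0 by (simp add: power_divide field_simps)
        finally show "((exp (t * n))\<^sup>2 * (1 / m n * sqrt (card (J n))))\<^sup>2 \<le> (1 / Suc n)\<^sup>2" .
      qed simp
      then have "2 * C * (l2_norm M f)\<^sup>2 * ((exp (t * n))\<^sup>2 * (1 / m n * sqrt (card (J n))))
          \<le> 2 * C * (l2_norm M f)\<^sup>2 * (1 / Suc n)"
        using C_nonneg by (intro mult_left_mono) auto
      then have "2 * C * (exp (t * n))\<^sup>2 * (1 / m n * sqrt (card (J n))) * (l2_norm M f)\<^sup>2
          \<le> 2 * C * (1 / Suc n) * (l2_norm M f)\<^sup>2"
        by (simp only: mult_ac)
      then show ?thesis using t by (intro mult_left_mono add_left_mono) auto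
    qed
    finally show ?thesis .
  qed
  have "(\<lambda>n. 1 / real (Suc n)) \<longlonglongrightarrow> 0" using LIMSEQ_inverse_real_of_nat by (simp add: inverse_eq_divide)
  then have "(\<lambda>n. exp (2 * \<kappa> * t) *
      ((weighted_norm (discrete_evolution f (m n) (J n) 0))\<^sup>2 + t * (2 * C * (1 / real (Suc n)) * (l2_norm M f)\<^sup>2)))
     \<longlonglongrightarrow> exp (2 * \<kappa> * t) * ((weighted_norm f)\<^sup>2 + t * (2 * C * 0 * (l2_norm M f)\<^sup>2))"
    by (intro tendsto_mult tendsto_add tendsto_const lim0)
  from LIMSEQ_le[OF limt this] bound
  have "(weighted_norm u)\<^sup>2 \<le> exp (2 * \<kappa> * t) * (weighted_norm f)\<^sup>2" by auto
  also have "\<dots> = (exp (\<kappa> * t) * weighted_norm f)\<^sup>2"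
    by (simp add: power_mult_distrib flip: exp_double) 
  finally show ?thesis
    by (rule power2_le_imp_le) (simp add: weighted_norm_def)
qed

end

section \<open>Closures of semibounded forms\<close>

text \<open>
  The assumption \<open>adjoint\<close> says that each \<open>f\<close> in the core lies in the domain of the operator of the
  form; this is what makes the form closable.
\<close>

locale closable_form = psd_form D b
  for D :: "('a \<Rightarrow> complex) set" and b +
  fixes M :: "'a measure" and Q :: "('a \<Rightarrow> complex) \<Rightarrow> real"
  assumes D_l2: "D \<subseteq> l2_space M"
    and Q_eq: "\<And>f. f \<in> D \<Longrightarrow> Q f = Re (b f f)"
    and adjoint: "\<And>f. f \<in> D \<Longrightarrow> \<exists>k\<in>l2_space M. \<forall>g\<in>D. b g f = l2_inner M g k"
begin

abbreviation approx where "approx \<equiv> form_approx M D Q"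
abbreviation dom where "dom \<equiv> closure_domain M D Q"
abbreviation clos where "clos \<equiv> closure_form M D Q"

lemma Q_seminorm: "f \<in> D \<Longrightarrow> Q f = (seminorm f)\<^sup>2"
  by (simp add: Q_eq seminorm_square)

text \<open>
  Replacing \<open>Q\<close> by its square root gives access to the triangle inequality.
\<close>

lemma approx_iff:
  "approx \<phi> f \<longleftrightarrow> f \<in> l2_space M \<and> (\<forall>n. \<phi> n \<in> D) \<and>
     (\<lambda>n. l2_norm M (\<lambda>x. \<phi> n x - f x)) \<longlonglongrightarrow> 0 \<and>
     (\<forall>e>0. \<exists>N. \<forall>m\<ge>N. \<forall>n\<ge>N. seminorm (\<lambda>x. \<phi> m x - \<phi> n x) < e)"
proof (cases "\<forall>n. \<phi> n \<in> D")
  case True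
  then have mem: "(\<lambda>x. \<phi> m x - \<phi> n x) \<in> D" for m n by (simp add: diff_mem)
  have "(\<forall>e>0. \<exists>N. \<forall>m\<ge>N. \<forall>n\<ge>N. (seminorm (\<lambda>x. \<phi> m x - \<phi> n x))\<^sup>2 < e) \<longleftrightarrow>
    (\<forall>e>0. \<exists>N. \<forall>m\<ge>N. \<forall>n\<ge>N. seminorm (\<lambda>x. \<phi> m x - \<phi> n x) < e)" (is "?l = ?r")
  proof
    assume l: ?l
    show ?r
    proof (intro allI impI)
      fix e :: real assume e: "0 < e"
      with l obtain N where N: "\<forall>m\<ge>N. \<forall>n\<ge>N. (seminorm (\<lambda>x. \<phi> m x - \<phi> n x))\<^sup>2 < e\<^sup>2"
        using zero_less_power[OF e, of 2] by blast
      have "seminorm (\<lambda>x. \<phi> m x - \<phi> n x) < e" if "m \<ge> N" "n \<ge> N" for m n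
        using N that e by (intro power2_less_imp_less[of _ e]) auto
      then show "\<exists>N. \<forall>m\<ge>N. \<forall>n\<ge>N. seminorm (\<lambda>x. \<phi> m x - \<phi> n x) < e" by blast
    qed
  next
    assume r: ?r
    show ?l
    proof (intro allI impI)
      fix e :: real assume e: "0 < e"
      with r obtain N where N: "\<forall>m\<ge>N. \<forall>n\<ge>N. seminorm (\<lambda>x. \<phi> m x - \<phi> n x) < sqrt e"
        using real_sqrt_gt_zero[OF e] by blast
      have "(seminorm (\<lambda>x. \<phi> m x - \<phi> n x))\<^sup>2 < e" if "m \<ge> N" "n \<ge> N" for m n
      proof -
        have "(seminorm (\<lambda>x. \<phi> m x - \<phi> n x))\<^sup>2 < (sqrt e)\<^sup>2"
          using N that seminorm_nonneg[OF mem] by (intro power_strict_mono) auto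
        then show ?thesis using e by simp
      qed
      then show "\<exists>N. \<forall>m\<ge>N. \<forall>n\<ge>N. (seminorm (\<lambda>x. \<phi> m x - \<phi> n x))\<^sup>2 < e" by blast
    qed
  qed
  with True show ?thesis by (simp add: form_approx_def Q_seminorm[OF mem])
next
  case False
  then show ?thesis by (auto simp: form_approx_def)
qed

lemma approxD:
  assumes "approx \<phi> f"
  shows "f \<in> l2_space M" "\<phi> n \<in> D" "\<phi> n \<in> l2_space M"
    "(\<lambda>n. l2_norm M (\<lambda>x. \<phi> n x - f x)) \<longlonglongrightarrow> 0"
    "e > 0 \<Longrightarrow> \<exists>N. \<forall>m\<ge>N. \<forall>n\<ge>N. seminorm (\<lambda>x. \<phi> m x - \<phi> n x) < e"
  using assms D_l2 by (auto simp: approx_iff)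

lemma approx_lin:
  assumes \<phi>: "approx \<phi> f" and \<psi>: "approx \<psi> g"
  shows "approx (\<lambda>n x. \<phi> n x + c * \<psi> n x) (\<lambda>x. f x + c * g x)"
  unfolding approx_iff
proof (intro conjI allI impI)
  show "(\<lambda>x. f x + c * g x) \<in> l2_space M" by (intro l2_lin_mem approxD(1)[OF \<phi>] approxD(1)[OF \<psi>])
  show "(\<lambda>x. \<phi> n x + c * \<psi> n x) \<in> D" for n
    by (intro lin_mem approxD(2)[OF \<phi>] approxD(2)[OF \<psi>])
  show "(\<lambda>n. l2_norm M (\<lambda>x. \<phi> n x + c * \<psi> n x - (f x + c * g x))) \<longlonglongrightarrow> 0"
  proof (rule Lim_null_comparison)
    show "(\<lambda>n. l2_norm M (\<lambda>x. \<phi> n x - f x) + cmod c * l2_norm M (\<lambda>x. \<psi> n x - g x)) \<longlonglongrightarrow> 0"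
      using tendsto_add[OF approxD(4)[OF \<phi>] tendsto_mult_left[OF approxD(4)[OF \<psi>], of "cmod c"]] by simp
    have "l2_norm M (\<lambda>x. \<phi> n x + c * \<psi> n x - (f x + c * g x))
        \<le> l2_norm M (\<lambda>x. \<phi> n x - f x) + cmod c * l2_norm M (\<lambda>x. \<psi> n x - g x)" for n
    proof -
      have m: "(\<lambda>x. \<phi> n x - f x) \<in> l2_space M" "(\<lambda>x. \<psi> n x - g x) \<in> l2_space M"
        by (intro l2.diff_mem approxD(1,3)[OF \<phi>] approxD(1,3)[OF \<psi>])+
      have "(\<lambda>x. \<phi> n x + c * \<psi> n x - (f x + c * g x)) = (\<lambda>x. (\<phi> n x - f x) + c * (\<psi> n x - g x))"
        by (simp add: algebra_simps)
      then show ?thesis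
        using l2.triangle[OF m(1) l2.scale_mem[OF m(2)], of c] l2.seminorm_scale[OF m(2), of c] by simp
    qed
    then show "\<forall>\<^sub>F n in sequentially. norm (l2_norm M (\<lambda>x. \<phi> n x + c * \<psi> n x - (f x + c * g x)))
        \<le> l2_norm M (\<lambda>x. \<phi> n x - f x) + cmod c * l2_norm M (\<lambda>x. \<psi> n x - g x)" by simp
  qed
  fix e :: real assume e: "e > 0"
  obtain N1 where N1: "\<And>m n. m \<ge> N1 \<Longrightarrow> n \<ge> N1 \<Longrightarrow> seminorm (\<lambda>x. \<phi> m x - \<phi> n x) < e / 2"
    using approxD(5)[OF \<phi>, of "e/2"] e by auto
  obtain N2 where N2: "\<And>m n. m \<ge> N2 \<Longrightarrow> n \<ge> N2 \<Longrightarrow> seminorm (\<lambda>x. \<psi> m x - \<psi> n x) < e / (2 * (cmod c + 1))"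
    using approxD(5)[OF \<psi>, of "e / (2 * (cmod c + 1))"] e by (auto simp: add_pos_nonneg add_nonneg_pos)
  have "seminorm (\<lambda>x. (\<phi> m x + c * \<psi> m x) - (\<phi> n x + c * \<psi> n x)) < e"
    if "m \<ge> max N1 N2" "n \<ge> max N1 N2" for m n
  proof -
    have m: "(\<lambda>x. \<phi> m x - \<phi> n x) \<in> D" "(\<lambda>x. \<psi> m x - \<psi> n x) \<in> D"
      by (intro diff_mem approxD(2)[OF \<phi>] approxD(2)[OF \<psi>])+
    have "(\<lambda>x. (\<phi> m x + c * \<psi> m x) - (\<phi> n x + c * \<psi> n x)) = (\<lambda>x. (\<phi> m x - \<phi> n x) + c * (\<psi> m x - \<psi> n x))"
      by (simp add: algebra_simps)
    then have "seminorm (\<lambda>x. (\<phi> m x + c * \<psi> m x) - (\<phi> n x + c * \<psi> n x))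
       \<le> seminorm (\<lambda>x. \<phi> m x - \<phi> n x) + cmod c * seminorm (\<lambda>x. \<psi> m x - \<psi> n x)"
      using triangle[OF m(1) scale_mem[OF m(2)], of c] seminorm_scale[OF m(2), of c] by simp
    also have "\<dots> \<le> seminorm (\<lambda>x. \<phi> m x - \<phi> n x) + (cmod c + 1) * seminorm (\<lambda>x. \<psi> m x - \<psi> n x)"
      using seminorm_nonneg[OF m(2)] by (simp add: algebra_simps)
    also have "\<dots> < e / 2 + (cmod c + 1) * (e / (2 * (cmod c + 1)))"
      using that by (intro add_strict_mono mult_strict_left_mono N1 N2) (auto simp: add_nonneg_pos)
    also have "\<dots> = e"
    proof -
      have "cmod c + 1 \<noteq> 0" using norm_ge_zero[of c] by linarith
      then show ?thesis by (simp add: field_simps)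
    qed
    finally show ?thesis .
  qed
  then show "\<exists>N. \<forall>m\<ge>N. \<forall>n\<ge>N. seminorm (\<lambda>x. \<phi> m x + c * \<psi> m x - (\<phi> n x + c * \<psi> n x)) < e" by blast
qed

text \<open>
  Closability.  For fixed \<open>n\<close>, \<open>b (\<phi> m) (\<phi> n) = \<langle>\<phi> m, k\<rangle>\<close> tends to zero as \<open>m\<close> grows, and \<open>\<phi> n\<close>
  differs from \<open>\<phi> m\<close> by little in the form seminorm; so \<open>\<phi> n\<close> itself is small.
\<close>

lemma approx_zero:
  assumes \<phi>: "approx \<phi> (\<lambda>x. 0)"
  shows "(\<lambda>n. seminorm (\<phi> n)) \<longlonglongrightarrow> 0"
proof -
  note mem = approxD(2)[OF \<phi>]
  have aux: "x \<le> r + (a + x) / 2 \<Longrightarrow> x \<le> 2 * r + a" for x r a :: real by (simp add: field_simps)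
  have "\<exists>N. \<forall>n\<ge>N. seminorm (\<phi> n) < e" if e: "e > 0" for e
  proof -
    obtain N where N: "\<And>m n. m \<ge> N \<Longrightarrow> n \<ge> N \<Longrightarrow> seminorm (\<lambda>x. \<phi> m x - \<phi> n x) < e / 2"
      using approxD(5)[OF \<phi>, of "e/2"] e by auto
    have "seminorm (\<phi> n) < e" if n: "n \<ge> N" for n
    proof -
      obtain k where k: "k \<in> l2_space M" "\<And>g. g \<in> D \<Longrightarrow> b g (\<phi> n) = l2_inner M g k"
        using adjoint[OF mem] by blast
      have "(\<lambda>m. l2_inner M (\<phi> m) k) \<longlonglongrightarrow> 0"
        using approxD(4)[OF \<phi>] by (intro l2_inner_tendsto_0 approxD(3)[OF \<phi>] k) simp
      then have lim: "(\<lambda>m. 2 * Re (b (\<phi> m) (\<phi> n)) + (e/2)\<^sup>2) \<longlonglongrightarrow> 2 * Re 0 + (e/2)\<^sup>2"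
        unfolding k(2)[OF mem] by (intro tendsto_intros)
      have "(seminorm (\<phi> n))\<^sup>2 \<le> 2 * Re (b (\<phi> m) (\<phi> n)) + (e/2)\<^sup>2" if m: "m \<ge> N" for m
      proof -
        have d: "(\<lambda>x. \<phi> n x - \<phi> m x) \<in> D" by (intro diff_mem mem)
        have eq: "(seminorm (\<phi> n))\<^sup>2 = Re (b (\<phi> m) (\<phi> n)) + Re (b (\<lambda>x. \<phi> n x - \<phi> m x) (\<phi> n))"
          using mem by (simp add: seminorm_square diff_left)
        have "Re (b (\<lambda>x. \<phi> n x - \<phi> m x) (\<phi> n)) \<le> seminorm (\<lambda>x. \<phi> n x - \<phi> m x) * seminorm (\<phi> n)"
          using Cauchy_Schwarz[OF d mem[of n]] complex_Re_le_cmod order_trans by blast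
        also have "\<dots> \<le> e / 2 * seminorm (\<phi> n)"
          using N[OF n m] seminorm_nonneg[OF mem[of n]] by (intro mult_right_mono) auto
        also have "\<dots> \<le> ((e/2)\<^sup>2 + (seminorm (\<phi> n))\<^sup>2) / 2"
          using sum_squares_bound[of "e/2" "seminorm (\<phi> n)"] by simp
        finally show ?thesis by (intro aux) (simp add: eq)
      qed
      then have "(seminorm (\<phi> n))\<^sup>2 \<le> (e/2)\<^sup>2"
        using LIMSEQ_le_const[OF lim] by auto
      then have "seminorm (\<phi> n) \<le> e / 2" by (rule power2_le_imp_le) (use e in simp)
      then show ?thesis using e by simp
    qed
    then show ?thesis by blast
  qed
  then show ?thesis
    using seminorm_nonneg[OF mem] by (auto simp: LIMSEQ_iff)
qed

lemma approx_convergent: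
  assumes \<phi>: "approx \<phi> f"
  shows "convergent (\<lambda>n. Q (\<phi> n))"
proof -
  note mem = approxD(2)[OF \<phi>]
  have "Cauchy (\<lambda>n. seminorm (\<phi> n))"
  proof (rule metric_CauchyI)
    fix e :: real assume "e > 0"
    then obtain N where N: "\<forall>m\<ge>N. \<forall>n\<ge>N. seminorm (\<lambda>x. \<phi> m x - \<phi> n x) < e"
      using approxD(5)[OF \<phi>] by blast
    have "dist (seminorm (\<phi> m)) (seminorm (\<phi> n)) < e" if "m \<ge> N" "n \<ge> N" for m n
      using triangle_diff[OF mem mem, of m n] N that by (simp add: dist_real_def) (meson le_less_trans)
    then show "\<exists>N. \<forall>m\<ge>N. \<forall>n\<ge>N. dist (seminorm (\<phi> m)) (seminorm (\<phi> n)) < e" by blast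
  qed
  then obtain l where "(\<lambda>n. seminorm (\<phi> n)) \<longlonglongrightarrow> l"
    by (auto simp: Cauchy_convergent_iff convergent_def)
  from tendsto_power[OF this, of 2] show ?thesis
    using mem by (auto simp: Q_seminorm convergent_def)
qed

lemma closure_form_lim:
  assumes \<phi>: "approx \<phi> f"
  shows "(\<lambda>n. Q (\<phi> n)) \<longlonglongrightarrow> clos f"
proof -
  obtain c where c: "(\<lambda>n. Q (\<phi> n)) \<longlonglongrightarrow> c"
    using approx_convergent[OF \<phi>] by (auto simp: convergent_def)
  have all: "(\<lambda>n. Q (\<psi> n)) \<longlonglongrightarrow> c" if \<psi>: "approx \<psi> f" for \<psi>
  proof -
    have "approx (\<lambda>n x. \<psi> n x - \<phi> n x) (\<lambda>x. 0)"
      using approx_lin[OF \<psi> \<phi>, of "-1"] by simp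
    then have 0: "(\<lambda>n. seminorm (\<lambda>x. \<psi> n x - \<phi> n x)) \<longlonglongrightarrow> 0" by (rule approx_zero)
    have s: "(\<lambda>n. seminorm (\<phi> n)) \<longlonglongrightarrow> sqrt c"
      using tendsto_real_sqrt[OF c] seminorm_nonneg[OF approxD(2)[OF \<phi>]]
      by (simp add: Q_seminorm approxD(2)[OF \<phi>])
    have d: "(\<lambda>n. seminorm (\<psi> n) - seminorm (\<phi> n)) \<longlonglongrightarrow> 0"
      by (rule Lim_null_comparison[OF _ 0])
        (simp add: triangle_diff approxD(2)[OF \<phi>] approxD(2)[OF \<psi>])
    have "(\<lambda>n. seminorm (\<psi> n)) \<longlonglongrightarrow> sqrt c"
      using tendsto_add[OF d s] by simp
    from tendsto_power[OF this, of 2] have "(\<lambda>n. Q (\<psi> n)) \<longlonglongrightarrow> (sqrt c)\<^sup>2"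
      by (simp add: Q_seminorm approxD(2)[OF \<psi>])
    moreover have "c \<ge> 0"
      using c by (rule LIMSEQ_le_const) (simp add: Q_seminorm approxD(2)[OF \<phi>])
    ultimately show ?thesis by simp
  qed
  have "clos f = c"
    unfolding closure_form_def
    using all \<phi> c LIMSEQ_unique by (intro the_equality) blast+
  with c show ?thesis by simp
qed

text \<open>
  With this lemma every computation with the closed form is reduced to the core.
\<close>

lemma polar_lim:
  assumes \<phi>: "approx \<phi> f" and \<psi>: "approx \<psi> g"
  shows "(\<lambda>n. b (\<phi> n) (\<psi> n)) \<longlonglongrightarrow> polar_form clos f g"
proof -
  have "(\<lambda>n. polar_form Q (\<phi> n) (\<psi> n)) \<longlonglongrightarrow> polar_form clos f g"
    unfolding polar_form_def
    by (intro tendsto_divide tendsto_sum tendsto_mult tendsto_const tendsto_of_real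
        closure_form_lim approx_lin \<phi> \<psi>) simp
  moreover have "polar_form Q (\<phi> n) (\<psi> n) = b (\<phi> n) (\<psi> n)" for n
    by (rule polarization[OF approxD(2)[OF \<phi>] approxD(2)[OF \<psi>] Q_eq])
  ultimately show ?thesis by simp
qed

lemma form_operatorD:
  assumes "(f, h) \<in> form_operator M D Q"
  shows "\<exists>\<phi>. approx \<phi> f" "h \<in> l2_space M"
    "approx \<phi> f \<Longrightarrow> approx \<psi> g \<Longrightarrow> (\<lambda>n. b (\<phi> n) (\<psi> n)) \<longlonglongrightarrow> l2_inner M h g"
proof -
  show "\<exists>\<phi>. approx \<phi> f" "h \<in> l2_space M"
    using assms by (auto simp: form_operator_def closure_domain_def)
  assume *: "approx \<phi> f" "approx \<psi> g"
  then have "g \<in> dom" by (auto simp: closure_domain_def)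
  with assms have "polar_form clos f g = l2_inner M h g" by (simp add: form_operator_def)
  with polar_lim[OF *] show "(\<lambda>n. b (\<phi> n) (\<psi> n)) \<longlonglongrightarrow> l2_inner M h g" by simp
qed

lemma approx_const: "f \<in> D \<Longrightarrow> approx (\<lambda>n. f) f"
  using D_l2 by (auto simp: approx_iff seminorm_def zero_left zero_mem l2_norm_def)

lemma form_operator_zero: "((\<lambda>x. 0), (\<lambda>x. 0)) \<in> form_operator M D Q"
  unfolding form_operator_def
proof (safe)
  have a0: "approx (\<lambda>n x. 0) (\<lambda>x. 0)" by (rule approx_const[OF zero_mem])
  then show "(\<lambda>x. 0) \<in> dom" by (auto simp: closure_domain_def)
  show "(\<lambda>x. 0) \<in> l2_space M" by (rule l2.zero_mem)
  fix g assume "g \<in> dom"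
  then obtain \<psi> where \<psi>: "approx \<psi> g" by (auto simp: closure_domain_def)
  from polar_lim[OF a0 \<psi>] have "polar_form clos (\<lambda>x. 0) g = 0"
    by (simp add: zero_left approxD(2)[OF \<psi>] tendsto_const_iff)
  then show "polar_form clos (\<lambda>x. 0) g = l2_inner M (\<lambda>x. 0) g" by (simp add: l2_inner_def)
qed

text \<open>
  The polarized closed form is linear because it is a limit of linear expressions.
\<close>

lemma form_operator_lin:
  assumes fh: "(f, h) \<in> form_operator M D Q" and fh': "(f', h') \<in> form_operator M D Q"
  shows "((\<lambda>x. f x + c * f' x), (\<lambda>x. h x + c * h' x)) \<in> form_operator M D Q"
  unfolding form_operator_def
proof (safe)
  obtain \<phi> \<phi>' where \<phi>: "approx \<phi> f" and \<phi>': "approx \<phi>' f'"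
    using form_operatorD(1)[OF fh] form_operatorD(1)[OF fh'] by blast
  note lin = approx_lin[OF \<phi> \<phi>', of c]
  then show "(\<lambda>x. f x + c * f' x) \<in> dom" by (auto simp: closure_domain_def)
  note h = form_operatorD(2)[OF fh] form_operatorD(2)[OF fh']
  show "(\<lambda>x. h x + c * h' x) \<in> l2_space M" by (intro l2_lin_mem h)
  fix g assume "g \<in> dom"
  then obtain \<psi> where \<psi>: "approx \<psi> g" by (auto simp: closure_domain_def)
  have "(\<lambda>n. b (\<phi> n) (\<psi> n) + c * b (\<phi>' n) (\<psi> n)) \<longlonglongrightarrow> l2_inner M h g + c * l2_inner M h' g"
    by (intro tendsto_intros form_operatorD(3)[OF fh \<phi> \<psi>] form_operatorD(3)[OF fh' \<phi>' \<psi>])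
  moreover have "b (\<phi> n) (\<psi> n) + c * b (\<phi>' n) (\<psi> n) = b (\<lambda>x. \<phi> n x + c * \<phi>' n x) (\<psi> n)" for n
    by (simp add: left_linear approxD(2)[OF \<phi>] approxD(2)[OF \<phi>'] approxD(2)[OF \<psi>])
  moreover have "l2_inner M h g + c * l2_inner M h' g = l2_inner M (\<lambda>x. h x + c * h' x) g"
    using h approxD(1)[OF \<psi>] by (simp add: l2.left_linear)
  ultimately show "polar_form clos (\<lambda>x. f x + c * f' x) g = l2_inner M (\<lambda>x. h x + c * h' x) g"
    using polar_lim[OF lin \<psi>] LIMSEQ_unique by simp
qed

lemma form_operator_sum:
  "finite J \<Longrightarrow> (\<And>j. j \<in> J \<Longrightarrow> (f j, h j) \<in> form_operator M D Q) \<Longrightarrow>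
    ((\<lambda>x. \<Sum>j\<in>J. c j * f j x), (\<lambda>x. \<Sum>j\<in>J. c j * h j x)) \<in> form_operator M D Q"
proof (induction J rule: finite_induct)
  case empty
  then show ?case using form_operator_zero by simp
next
  case (insert j J)
  then show ?case
    using form_operator_lin[of "\<lambda>x. \<Sum>j\<in>J. c j * f j x" "\<lambda>x. \<Sum>j\<in>J. c j * h j x" "f j" "h j" "c j"]
    by (simp add: add.commute)
qed

end

section \<open>Smooth functions and integration by parts\<close>

text \<open>
  A local version of \<open>C_k\<close>: the magnetic potential is smooth only away from the origin, and its
  product with a test function is seen to be smooth by gluing.
\<close>

primrec Ck_on :: "(real^2) set \<Rightarrow> nat \<Rightarrow> (real^2 \<Rightarrow> complex) \<Rightarrow> bool" where
  "Ck_on U 0 f \<longleftrightarrow> continuous_on U f"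
| "Ck_on U (Suc n) f \<longleftrightarrow>
     (\<forall>x\<in>U. f differentiable (at x)) \<and> (\<forall>v. Ck_on U n (\<lambda>x. frechet_derivative f (at x) v))"

definition smooth_on :: "(real^2) set \<Rightarrow> (real^2 \<Rightarrow> complex) \<Rightarrow> bool" where
  "smooth_on U f \<longleftrightarrow> (\<forall>k. Ck_on U k f)"

lemma C_k_iff: "C_k n f \<longleftrightarrow> Ck_on UNIV n f"
  by (induction n arbitrary: f) auto

lemma Ck_on_Un: "open U \<Longrightarrow> open V \<Longrightarrow> Ck_on U n f \<Longrightarrow> Ck_on V n f \<Longrightarrow> Ck_on (U \<union> V) n f"
  by (induction n arbitrary: f) (auto intro: continuous_on_open_Un)

lemma Ck_on_cong:
  assumes U: "open U"
  shows "(\<And>x. x \<in> U \<Longrightarrow> f x = g x) \<Longrightarrow> Ck_on U n f \<Longrightarrow> Ck_on U n g"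
proof (induction n arbitrary: f g)
  case 0 then show ?case by (auto cong: continuous_on_cong)
next
  case (Suc n)
  have diff: "f differentiable (at x)" if "x \<in> U" for x using Suc.prems(2) that by simp
  have g: "g differentiable (at x) \<and> frechet_derivative g (at x) = frechet_derivative f (at x)" if x: "x \<in> U" for x
  proof -
    have "(f has_derivative frechet_derivative f (at x)) (at x)"
      using diff[OF x] by (simp add: frechet_derivative_works)
    then have "(g has_derivative frechet_derivative f (at x)) (at x)"
      using Suc.prems(1) by (rule has_derivative_transform_within_open[OF _ U x])
    then show ?thesis by (auto simp: differentiable_def frechet_derivative_at[symmetric])
  qed
  show ?case
    unfolding Ck_on.simps
  proof (intro conjI allI ballI)
    show "g differentiable (at x)" if "x \<in> U" for x using g[OF that] by simp
    show "Ck_on U n (\<lambda>x. frechet_derivative g (at x) v)" for v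
      by (rule Suc.IH[of "\<lambda>x. frechet_derivative f (at x) v"]) (use g Suc.prems(2) in auto)
  qed
qed

lemma Ck_on_SucI:
  assumes U: "open U" and D: "\<And>x. x \<in> U \<Longrightarrow> (f has_derivative D x) (at x)"
    and k: "\<And>v. Ck_on U n (\<lambda>x. D x v)"
  shows "Ck_on U (Suc n) f"
  unfolding Ck_on.simps
proof (intro conjI allI ballI)
  show "f differentiable (at x)" if "x \<in> U" for x using D[OF that] by (auto simp: differentiable_def)
  show "Ck_on U n (\<lambda>x. frechet_derivative f (at x) v)" for v
    by (rule Ck_on_cong[OF U _ k[of v]]) (simp add: frechet_derivative_at[OF D, symmetric])
qed

lemma Ck_on_Suc_has_derivative:
  "Ck_on U (Suc n) f \<Longrightarrow> x \<in> U \<Longrightarrow> (f has_derivative frechet_derivative f (at x)) (at x)"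
  by (simp add: frechet_derivative_works)

lemma Ck_on_SucD: "Ck_on U (Suc n) f \<Longrightarrow> Ck_on U n f"
proof (induction n arbitrary: f)
  case 0
  then show ?case
    by (auto intro!: continuous_at_imp_continuous_on differentiable_imp_continuous_within)
next
  case (Suc n)
  then show ?case by (subst Ck_on.simps) auto
qed

lemma Ck_on_const: "open U \<Longrightarrow> Ck_on U n (\<lambda>x. c)"
proof (induction n arbitrary: c)
  case (Suc n)
  then show ?case by (intro Ck_on_SucI[where D="\<lambda>x v. 0"]) auto
qed auto

lemma Ck_on_add: "open U \<Longrightarrow> Ck_on U n f \<Longrightarrow> Ck_on U n g \<Longrightarrow> Ck_on U n (\<lambda>x. f x + g x)"
proof (induction n arbitrary: f g)
  case (Suc n)
  show ?case
  proof (rule Ck_on_SucI[OF Suc.prems(1)])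
    fix x assume "x \<in> U"
    then show "((\<lambda>x. f x + g x) has_derivative
        (\<lambda>v. frechet_derivative f (at x) v + frechet_derivative g (at x) v)) (at x)"
      using Suc.prems by (intro has_derivative_add Ck_on_Suc_has_derivative)
  next
    fix v show "Ck_on U n (\<lambda>x. frechet_derivative f (at x) v + frechet_derivative g (at x) v)"
      using Suc.prems by (intro Suc.IH) auto
  qed
qed (auto intro: continuous_on_add)

lemma Ck_on_mult: "open U \<Longrightarrow> Ck_on U n f \<Longrightarrow> Ck_on U n g \<Longrightarrow> Ck_on U n (\<lambda>x. f x * g x)"
proof (induction n arbitrary: f g)
  case (Suc n)
  show ?case
  proof (rule Ck_on_SucI[OF Suc.prems(1)])
    fix x assume "x \<in> U"
    then show "((\<lambda>x. f x * g x) has_derivative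
        (\<lambda>v. f x * frechet_derivative g (at x) v + frechet_derivative f (at x) v * g x)) (at x)"
      using Suc.prems by (intro has_derivative_mult Ck_on_Suc_has_derivative)
  next
    fix v
    show "Ck_on U n (\<lambda>x. f x * frechet_derivative g (at x) v + frechet_derivative f (at x) v * g x)"
      using Suc.prems Ck_on_SucD[OF Suc.prems(2)] Ck_on_SucD[OF Suc.prems(3)]
      by (intro Ck_on_add Suc.IH) auto
  qed
qed (auto intro: continuous_on_mult)

lemma Ck_on_bounded_linear:
  assumes L: "bounded_linear L"
  shows "open U \<Longrightarrow> Ck_on U n f \<Longrightarrow> Ck_on U n (\<lambda>x. L (f x))"
proof (induction n arbitrary: f)
  case 0
  then show ?case by (auto intro: bounded_linear.continuous_on[OF L])
next
  case (Suc n)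
  show ?case
  proof (rule Ck_on_SucI[OF Suc.prems(1)])
    fix x assume "x \<in> U"
    then show "((\<lambda>x. L (f x)) has_derivative (\<lambda>v. L (frechet_derivative f (at x) v))) (at x)"
      using Suc.prems by (intro bounded_linear.has_derivative[OF L] Ck_on_Suc_has_derivative)
  next
    fix v show "Ck_on U n (\<lambda>x. L (frechet_derivative f (at x) v))"
      using Suc.prems by (intro Suc.IH) auto
  qed
qed

lemma Ck_on_coordinate:
  assumes U: "open U"
  shows "Ck_on U n (\<lambda>x. complex_of_real (x $ i))"
proof (cases n)
  case 0
  then show ?thesis by (auto intro!: continuous_intros)
next
  case (Suc m)
  have "((\<lambda>x::real^2. complex_of_real (x $ i)) has_derivative (\<lambda>v. complex_of_real (v $ i))) (at x)" for x
    by (auto intro!: derivative_eq_intros bounded_linear.has_derivative[OF bounded_linear_of_real]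
        bounded_linear.has_derivative[OF bounded_linear_vec_nth])
  then show ?thesis unfolding Suc by (intro Ck_on_SucI[OF U]) (auto intro: Ck_on_const[OF U])
qed

text \<open>
  The chain rule reproduces the statement for \<open>deriv h\<close>, which is again holomorphic; so square
  roots, exponentials and logarithms of smooth functions need no separate treatment.
\<close>

lemma Ck_on_holomorphic_compose:
  assumes T: "open T"
  shows "open U \<Longrightarrow> Ck_on U n f \<Longrightarrow> f ` U \<subseteq> T \<Longrightarrow> h holomorphic_on T \<Longrightarrow> Ck_on U n (\<lambda>x. h (f x))"
proof (induction n arbitrary: h)
  case 0
  then show ?case
    by (auto intro: continuous_on_compose2[OF holomorphic_on_imp_continuous_on])
next
  case (Suc n)
  show ?case
  proof (rule Ck_on_SucI[OF Suc.prems(1)])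
    fix x assume x: "x \<in> U"
    then have "(h has_derivative (*) (deriv h (f x))) (at (f x))"
      using holomorphic_derivI[OF Suc.prems(4) T] Suc.prems(3)
      by (auto simp: has_field_derivative_def)
    from has_derivative_compose[OF Ck_on_Suc_has_derivative[OF Suc.prems(2) x] this]
    show "((\<lambda>x. h (f x)) has_derivative (\<lambda>v. deriv h (f x) * frechet_derivative f (at x) v)) (at x)" .
  next
    fix v
    show "Ck_on U n (\<lambda>x. deriv h (f x) * frechet_derivative f (at x) v)"
    proof (rule Ck_on_mult[OF Suc.prems(1)])
      show "Ck_on U n (\<lambda>x. deriv h (f x))"
        using Suc.prems Ck_on_SucD[OF Suc.prems(2)]
        by (intro Suc.IH[of "deriv h"] holomorphic_deriv T) auto
      show "Ck_on U n (\<lambda>x. frechet_derivative f (at x) v)" using Suc.prems(2) by simp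
    qed
  qed
qed

lemma smooth_const: "open U \<Longrightarrow> smooth_on U (\<lambda>x. c)"
  by (simp add: smooth_on_def Ck_on_const)
lemma smooth_add: "open U \<Longrightarrow> smooth_on U f \<Longrightarrow> smooth_on U g \<Longrightarrow> smooth_on U (\<lambda>x. f x + g x)"
  by (simp add: smooth_on_def Ck_on_add)
lemma smooth_mult: "open U \<Longrightarrow> smooth_on U f \<Longrightarrow> smooth_on U g \<Longrightarrow> smooth_on U (\<lambda>x. f x * g x)"
  by (simp add: smooth_on_def Ck_on_mult)
lemma smooth_cnj: "open U \<Longrightarrow> smooth_on U f \<Longrightarrow> smooth_on U (\<lambda>x. cnj (f x))"
  by (simp add: smooth_on_def Ck_on_bounded_linear[OF bounded_linear_cnj])
lemma smooth_coordinate: "open U \<Longrightarrow> smooth_on U (\<lambda>x. complex_of_real (x $ i))"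
  by (simp add: smooth_on_def Ck_on_coordinate)
lemma smooth_holomorphic_compose:
  "open U \<Longrightarrow> smooth_on U f \<Longrightarrow> open T \<Longrightarrow> f ` U \<subseteq> T \<Longrightarrow> h holomorphic_on T \<Longrightarrow> smooth_on U (\<lambda>x. h (f x))"
  by (simp add: smooth_on_def Ck_on_holomorphic_compose)
lemma smooth_Un: "open U \<Longrightarrow> open V \<Longrightarrow> smooth_on U f \<Longrightarrow> smooth_on V f \<Longrightarrow> smooth_on (U \<union> V) f"
  by (simp add: smooth_on_def Ck_on_Un)
lemma smooth_cong: "open U \<Longrightarrow> smooth_on U f \<Longrightarrow> (\<And>x. x \<in> U \<Longrightarrow> f x = g x) \<Longrightarrow> smooth_on U g"
  by (auto simp: smooth_on_def intro: Ck_on_cong)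
lemma smooth_derivative: "smooth_on U f \<Longrightarrow> smooth_on U (\<lambda>x. frechet_derivative f (at x) v)"
  unfolding smooth_on_def by (metis Ck_on.simps(2))
lemma smooth_has_derivative:
  "smooth_on U f \<Longrightarrow> x \<in> U \<Longrightarrow> (f has_derivative frechet_derivative f (at x)) (at x)"
  by (meson smooth_on_def Ck_on_Suc_has_derivative)
lemma smooth_continuous: "smooth_on U f \<Longrightarrow> continuous_on U f"
  by (metis smooth_on_def Ck_on.simps(1))
lemma smooth_subset: "open V \<Longrightarrow> smooth_on U f \<Longrightarrow> V \<subseteq> U \<Longrightarrow> smooth_on V f"
proof -
  have "Ck_on V n f" if "V \<subseteq> U" "Ck_on U n f" for n
    using that by (induction n arbitrary: f) (auto intro: continuous_on_subset)
  then show "open V \<Longrightarrow> smooth_on U f \<Longrightarrow> V \<subseteq> U \<Longrightarrow> smooth_on V f" by (simp add: smooth_on_def)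
qed
lemma smooth_sum:
  "open U \<Longrightarrow> (\<And>i. i \<in> I \<Longrightarrow> smooth_on U (f i)) \<Longrightarrow> smooth_on U (\<lambda>x. \<Sum>i\<in>I. f i x)"
  by (induction I rule: infinite_finite_induct) (auto intro: smooth_const smooth_add)

lemma test_functionI:
  assumes "smooth_on UNIV f" "compact K" "0 \<notin> K" "\<And>x. x \<notin> K \<Longrightarrow> f x = 0"
  shows "f \<in> test_functions"
proof -
  have "closure {x. f x \<noteq> 0} \<subseteq> K"
    using assms by (intro closure_minimal) (auto intro: compact_imp_closed)
  moreover from this have "compact (closure {x. f x \<noteq> 0})"
    using assms(2) compact_Int_closed[of K "closure {x. f x \<noteq> 0}"] by (simp add: inf.absorb2)
  ultimately show ?thesis
    using assms(1,3) by (auto simp: test_functions_def C_k_iff smooth_on_def)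
qed

lemma test_functionE:
  assumes "f \<in> test_functions"
  obtains K where "smooth_on UNIV f" "compact K" "0 \<notin> K" "\<And>x. x \<notin> K \<Longrightarrow> f x = 0"
proof (rule that[of "closure {x. f x \<noteq> 0}"])
  show "smooth_on UNIV f" "compact (closure {x. f x \<noteq> 0})" "0 \<notin> closure {x. f x \<noteq> 0}"
    using assms by (auto simp: test_functions_def C_k_iff smooth_on_def)
  show "x \<notin> closure {x. f x \<noteq> 0} \<Longrightarrow> f x = 0" for x
    using closure_subset[of "{x. f x \<noteq> 0}"] by auto
qed

lemma test_smooth: "f \<in> test_functions \<Longrightarrow> smooth_on UNIV f"
  by (erule test_functionE)

lemma test_has_derivative:
  "f \<in> test_functions \<Longrightarrow> (f has_derivative frechet_derivative f (at x)) (at x)"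
  by (rule smooth_has_derivative[OF test_smooth]) auto

lemma derivative_outside_support:
  fixes f :: "real^2 \<Rightarrow> complex"
  assumes "closed K" "\<And>x. x \<notin> K \<Longrightarrow> f x = 0" "x \<notin> K"
  shows "frechet_derivative f (at x) v = 0"
proof -
  have "((\<lambda>x. 0::complex) has_derivative (\<lambda>v. 0)) (at x)" by simp
  then have "(f has_derivative (\<lambda>v. 0)) (at x)"
    by (rule has_derivative_transform_within_open[of _ _ _ _ "-K"]) (use assms in auto)
  from frechet_derivative_at[OF this] show ?thesis by (metis)
qed

lemma test_lin:
  assumes "f \<in> test_functions" "g \<in> test_functions"
  shows "(\<lambda>x. f x + c * g x) \<in> test_functions"
proof -
  obtain K where K: "smooth_on UNIV f" "compact K" "0 \<notin> K" "\<And>x. x \<notin> K \<Longrightarrow> f x = 0"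
    using test_functionE[OF assms(1)] by blast
  obtain L where L: "smooth_on UNIV g" "compact L" "0 \<notin> L" "\<And>x. x \<notin> L \<Longrightarrow> g x = 0"
    using test_functionE[OF assms(2)] by blast
  show ?thesis
    using K L by (intro test_functionI[of _ "K \<union> L"] smooth_add smooth_mult smooth_const) auto
qed

text \<open>
  The support of \<open>f\<close> avoids the origin, so a singularity of \<open>w\<close> there does no harm: the product
  vanishes near the origin.
\<close>

lemma test_mult:
  assumes "f \<in> test_functions" "smooth_on (-{0}) w"
  shows "(\<lambda>x. w x * f x) \<in> test_functions"
proof -
  obtain K where K: "smooth_on UNIV f" "compact K" "0 \<notin> K" "\<And>x. x \<notin> K \<Longrightarrow> f x = 0"
    using test_functionE[OF assms(1)] by blast
  have oK: "open (-K)" using compact_imp_closed[OF K(2)] by (simp add: open_Compl)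
  have "smooth_on (-{0} \<union> -K) (\<lambda>x. w x * f x)"
  proof (rule smooth_Un)
    show "smooth_on (-{0}) (\<lambda>x. w x * f x)"
      using assms(2) K(1) by (intro smooth_mult) (auto intro: smooth_subset)
    show "smooth_on (-K) (\<lambda>x. w x * f x)"
      by (rule smooth_cong[OF oK smooth_const[OF oK, of 0]]) (simp add: K)
  qed (use oK in auto)
  also have "-{0} \<union> -K = UNIV" using K(3) by auto
  finally show ?thesis
    using K by (intro test_functionI[of _ K]) auto
qed

lemma test_derivative:
  assumes "f \<in> test_functions"
  shows "(\<lambda>x. frechet_derivative f (at x) v) \<in> test_functions"
proof -
  obtain K where K: "smooth_on UNIV f" "compact K" "0 \<notin> K" "\<And>x. x \<notin> K \<Longrightarrow> f x = 0"
    using test_functionE[OF assms(1)] by blast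
  then show ?thesis
    by (intro test_functionI[of _ K] smooth_derivative derivative_outside_support[of K])
      (auto intro: compact_imp_closed)
qed

lemma test_cnj: "f \<in> test_functions \<Longrightarrow> (\<lambda>x. cnj (f x)) \<in> test_functions"
  by (erule test_functionE, rule test_functionI) (auto intro: smooth_cnj)

lemma compact_support_integrable:
  fixes f :: "real^2 \<Rightarrow> 'b :: {banach, second_countable_topology}"
  assumes "continuous_on UNIV f" "compact K" "\<And>x. x \<notin> K \<Longrightarrow> f x = 0"
  shows "integrable lborel f" "integrable lebesgue f"
proof -
  have "integrable lborel (\<lambda>x. indicator K x *\<^sub>R f x)"
    using assms by (intro borel_integrable_compact) (auto intro: continuous_on_subset)
  also have "(\<lambda>x. indicator K x *\<^sub>R f x) = f" using assms(3) by (auto simp: indicator_def)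
  finally show 1: "integrable lborel f" .
  then show "integrable lebesgue f" by (simp add: integrable_completion)
qed

lemma test_continuous: "f \<in> test_functions \<Longrightarrow> continuous_on UNIV f"
  by (rule smooth_continuous[OF test_smooth])

lemma test_integrable:
  assumes "f \<in> test_functions"
  shows "integrable lborel f" "integrable lebesgue f"
proof -
  obtain K where K: "smooth_on UNIV f" "compact K" "\<And>x. x \<notin> K \<Longrightarrow> f x = 0"
    using test_functionE[OF assms] by blast
  then show "integrable lborel f" "integrable lebesgue f"
    using compact_support_integrable[of f K] smooth_continuous by blast+
qed

lemma test_l2: assumes "f \<in> test_functions" shows "f \<in> l2_space lebesgue"
proof -
  have "f \<in> borel_measurable lebesgue"
    using borel_measurable_integrable[OF test_integrable(2)[OF assms]] .
  moreover have "integrable lebesgue (\<lambda>x. (cmod (f x))\<^sup>2)"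
    by (rule test_functionE[OF assms], rule compact_support_integrable)
      (auto intro!: continuous_intros dest: smooth_continuous)
  ultimately show ?thesis by (simp add: l2_space_def)
qed

lemma test_bounded:
  assumes "f \<in> test_functions"
  obtains C where "C > 0" "\<And>x. cmod (f x) \<le> C"
proof -
  obtain K where K: "smooth_on UNIV f" "compact K" "\<And>x. x \<notin> K \<Longrightarrow> f x = 0"
    using test_functionE[OF assms] by blast
  have "compact (f ` K)"
    using K by (intro compact_continuous_image) (auto intro: continuous_on_subset smooth_continuous)
  then obtain C where C: "C > 0" "\<And>x. x \<in> K \<Longrightarrow> cmod (f x) \<le> C"
    using bounded_pos[of "f ` K"] by (auto dest: compact_imp_bounded)
  show ?thesis by (rule that[of C]) (use C K(3) in \<open>metis less_imp_le norm_zero\<close>)+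
qed

text \<open>
  Lebesgue measure is invariant under translations, so the difference quotients of \<open>f\<close> in direction
  \<open>v\<close> have integral zero; by the mean value inequality they are dominated by a multiple of the indicator
  function of a ball.
\<close>

lemma integral_derivative_zero:
  assumes f: "f \<in> test_functions"
  shows "(\<integral>x. frechet_derivative f (at x) v \<partial>lebesgue) = 0"
proof (cases "v = 0")
  case True
  then show ?thesis
    using linear_0[OF has_derivative_linear[OF test_has_derivative[OF f]]] by simp
next
  case False
  define D where "D x = frechet_derivative f (at x) v" for x
  have D: "D \<in> test_functions" unfolding D_def by (rule test_derivative[OF f])
  obtain C where C: "C > 0" "\<And>x. cmod (D x) \<le> C" using test_bounded[OF D] by blast
  obtain K where K: "smooth_on UNIV f" "compact K" "0 \<notin> K" "\<And>x. x \<notin> K \<Longrightarrow> f x = 0"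
    using test_functionE[OF f] by blast
  obtain R where R: "\<And>x. x \<in> K \<Longrightarrow> norm x \<le> R"
    using compact_imp_bounded[OF K(2)] by (auto simp: bounded_iff)
  define h where "h n = inverse (real (Suc n))" for n
  have h: "h n > 0" "h n \<le> 1" for n by (auto simp: h_def field_simps)
  have h0: "h \<longlonglongrightarrow> 0" unfolding h_def by (rule LIMSEQ_inverse_real_of_nat)
  have deriv: "((\<lambda>s. f (x + s *\<^sub>R v)) has_derivative (\<lambda>t. t *\<^sub>R D (x + s *\<^sub>R v))) (at s within S)" for x s S
  proof -
    have "((\<lambda>s. x + s *\<^sub>R v) has_derivative (\<lambda>t. t *\<^sub>R v)) (at s within S)"
      by (auto intro!: derivative_eq_intros)
    from has_derivative_compose[OF this test_has_derivative[OF f]]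
    have "((\<lambda>s. f (x + s *\<^sub>R v)) has_derivative (\<lambda>t. frechet_derivative f (at (x + s *\<^sub>R v)) (t *\<^sub>R v))) (at s within S)" .
    moreover have "frechet_derivative f (at y) (t *\<^sub>R v) = t *\<^sub>R D y" for y t
      unfolding D_def by (rule linear_scale[OF has_derivative_linear[OF test_has_derivative[OF f]]])
    ultimately show ?thesis by simp
  qed
  have quot: "(\<lambda>n. (f (x + h n *\<^sub>R v) - f x) /\<^sub>R h n) \<longlonglongrightarrow> D x" for x
  proof -
    have "((\<lambda>t. norm (f (x + (0 + t) *\<^sub>R v) - f (x + 0 *\<^sub>R v) - t *\<^sub>R D (x + 0 *\<^sub>R v)) / norm t) \<longlongrightarrow> 0) (at 0)"
      using deriv[of x 0 UNIV] by (simp only: has_derivative_at)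
    then have "((\<lambda>t. norm (f (x + t *\<^sub>R v) - f x - t *\<^sub>R D x) / norm t) \<longlongrightarrow> 0) (at 0)" by simp
    moreover have "filterlim h (at 0) sequentially"
      using h0 h(1) by (auto simp: filterlim_at less_imp_neq[symmetric])
    ultimately have "(\<lambda>n. norm (f (x + h n *\<^sub>R v) - f x - h n *\<^sub>R D x) / norm (h n)) \<longlonglongrightarrow> 0"
      by (rule filterlim_compose)
    moreover have "norm (f (x + h n *\<^sub>R v) - f x - h n *\<^sub>R D x) / norm (h n)
        = norm ((f (x + h n *\<^sub>R v) - f x) /\<^sub>R h n - D x)" for n
    proof -
      have "(f (x + h n *\<^sub>R v) - f x) /\<^sub>R h n - D x = (f (x + h n *\<^sub>R v) - f x - h n *\<^sub>R D x) /\<^sub>R h n"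
        using h(1)[of n] by (simp add: scaleR_diff_right)
      then show ?thesis by (simp add: divide_inverse mult.commute)
    qed
    ultimately have "(\<lambda>n. norm ((f (x + h n *\<^sub>R v) - f x) /\<^sub>R h n - D x)) \<longlonglongrightarrow> 0" by simp
    then show ?thesis by (simp add: tendsto_norm_zero_iff LIM_zero_iff)
  qed
  have bound: "norm ((f (x + h n *\<^sub>R v) - f x) /\<^sub>R h n) \<le> indicator (cball 0 (R + norm v)) x *\<^sub>R C" for x n
  proof (cases "x \<in> cball 0 (R + norm v)")
    case True
    have "norm (f (x + h n *\<^sub>R v) - f (x + 0 *\<^sub>R v)) \<le> C * norm (h n - 0)"
    proof (rule differentiable_bound[OF _ deriv, of "{0..h n}"])
      show "onorm (\<lambda>t. t *\<^sub>R D (x + s *\<^sub>R v)) \<le> C" for s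
        by (rule onorm_le) (simp add: mult.commute[of C] mult_left_mono C(2))
    qed (use h(1)[of n] in auto)
    then have "norm (f (x + h n *\<^sub>R v) - f x) / h n \<le> C"
      using h(1)[of n] by (simp add: pos_divide_le_eq)
    then show ?thesis using True h(1)[of n]
      by (simp add: divide_inverse mult.commute del: inverse_eq_divide)
  next
    case False
    then have "norm x > R + norm v" by simp
    moreover have "norm x \<le> norm (x + h n *\<^sub>R v) + norm v"
    proof -
      have "norm x \<le> norm (x + h n *\<^sub>R v) + norm (h n *\<^sub>R v)"
        using norm_triangle_ineq4[of "x + h n *\<^sub>R v" "h n *\<^sub>R v"] by simp
      also have "norm (h n *\<^sub>R v) \<le> norm v" using h[of n] by (simp add: mult_left_le_one_le)
      finally show ?thesis by simp
    qed
    ultimately have "x + h n *\<^sub>R v \<notin> K" "x \<notin> K" using R[of x] R[of "x + h n *\<^sub>R v"] norm_ge_zero[of v] by auto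
    then show ?thesis using C(1) by (simp add: K(4))
  qed
  have fm[measurable]: "f \<in> borel_measurable borel"
    using test_continuous[OF f] by (rule borel_measurable_continuous_onI)
  have Dm[measurable]: "D \<in> borel_measurable borel"
    using test_continuous[OF D] by (rule borel_measurable_continuous_onI)
  have shift: "integrable lborel (\<lambda>x. f (x + c))" "(\<integral>x. f (x + c) \<partial>lborel) = (\<integral>x. f x \<partial>lborel)" for c
  proof -
    have "integrable (distr lborel borel ((+) c)) f"
      unfolding lborel_distr_plus by (rule test_integrable(1)[OF f])
    then show "integrable lborel (\<lambda>x. f (x + c))"
      by (subst (asm) integrable_distr_eq) (auto simp: add.commute)
    have "(\<integral>x. f x \<partial>lborel) = (\<integral>x. f x \<partial>distr lborel borel ((+) c))" unfolding lborel_distr_plus ..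
    also have "\<dots> = (\<integral>x. f (x + c) \<partial>lborel)"
      by (subst integral_distr) (auto simp: add.commute)
    finally show "(\<integral>x. f (x + c) \<partial>lborel) = (\<integral>x. f x \<partial>lborel)" by simp
  qed
  have "(\<lambda>n. \<integral>x. (f (x + h n *\<^sub>R v) - f x) /\<^sub>R h n \<partial>lborel) \<longlonglongrightarrow> (\<integral>x. D x \<partial>lborel)"
  proof (rule integral_dominated_convergence)
    show "integrable lborel (\<lambda>x. indicator (cball 0 (R + norm v)) x *\<^sub>R C)"
      by (rule borel_integrable_compact) (auto intro: continuous_intros)
    show "AE x in lborel. (\<lambda>n. (f (x + h n *\<^sub>R v) - f x) /\<^sub>R h n) \<longlonglongrightarrow> D x"
      using quot by simp
    show "AE x in lborel. norm ((f (x + h n *\<^sub>R v) - f x) /\<^sub>R h n)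
        \<le> indicator (cball 0 (R + norm v)) x *\<^sub>R C" for n
      using bound by simp
  qed measurable
  moreover have "(\<integral>x. (f (x + h n *\<^sub>R v) - f x) /\<^sub>R h n \<partial>lborel) = 0" for n
    using shift[of "h n *\<^sub>R v"] test_integrable(1)[OF f] by simp
  ultimately have "(\<lambda>n::nat. 0) \<longlonglongrightarrow> (\<integral>x. D x \<partial>lborel)" by (simp only:)
  then have "(\<integral>x. D x \<partial>lborel) = 0" by (simp add: LIMSEQ_const_iff)
  then show ?thesis
    unfolding D_def[symmetric] by (subst integral_completion) (use Dm in auto)
qed

section \<open>The magnetic form\<close>

definition potential :: "real \<Rightarrow> real \<Rightarrow> 2 \<Rightarrow> real^2 \<Rightarrow> real" where
  "potential \<alpha> B j x = (A_B \<alpha> x + A_hmf B x) $ j"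

text \<open>
  The components of the covariant gradient, in place of a vector-valued function, let scalar \<open>L\<^sup>2\<close> theory apply.
\<close>

definition cov_deriv :: "real \<Rightarrow> real \<Rightarrow> 2 \<Rightarrow> (real^2 \<Rightarrow> complex) \<Rightarrow> real^2 \<Rightarrow> complex" where
  "cov_deriv \<alpha> B j f x = magnetic_gradient \<alpha> B f x $ j"

definition magnetic_form :: "real \<Rightarrow> real \<Rightarrow> (real^2 \<Rightarrow> complex) \<Rightarrow> (real^2 \<Rightarrow> complex) \<Rightarrow> complex" where
  "magnetic_form \<alpha> B f g = (\<Sum>j\<in>UNIV. l2_inner lebesgue (cov_deriv \<alpha> B j f) (cov_deriv \<alpha> B j g))"

lemma cov_deriv_eq:
  "cov_deriv \<alpha> B j f x = frechet_derivative f (at x) (axis j 1) + \<i> * complex_of_real (potential \<alpha> B j x) * f x"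
  by (simp add: cov_deriv_def magnetic_gradient_def potential_def)

lemma smooth_potential: "smooth_on (-{0}) (\<lambda>x. complex_of_real (potential \<alpha> B j x))"
proof -
  have o: "open (-{0::real^2})" by auto
  have n2: "complex_of_real ((norm x)\<^sup>2) = complex_of_real (x$1) * complex_of_real (x$1) + complex_of_real (x$2) * complex_of_real (x$2)" for x :: "real^2"
    by (simp add: norm_vec_def L2_set_def sum_2 power2_eq_square)
  have n0: "complex_of_real ((norm x)\<^sup>2) \<noteq> 0" if "x \<noteq> 0" for x :: "real^2" using that by simp
  have sn: "smooth_on (-{0}) (\<lambda>x::real^2. complex_of_real ((norm x)\<^sup>2))"
    by (rule smooth_cong[OF o _ n2[symmetric]]) (rule smooth_add smooth_mult smooth_coordinate o)+
  have inv: "smooth_on (-{0}) (\<lambda>x::real^2. inverse (complex_of_real ((norm x)\<^sup>2)))"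
    by (rule smooth_holomorphic_compose[OF o sn, of "-{0}"]) (auto intro!: holomorphic_intros)
  have "potential \<alpha> B 1 x = - \<alpha> * (x$2 * inverse ((norm x)\<^sup>2)) + - B / 2 * (x$2)"
    "potential \<alpha> B 2 x = \<alpha> * (x$1 * inverse ((norm x)\<^sup>2)) + B / 2 * (x$1)" for x
    by (simp_all add: potential_def A_B_def A_hmf_def field_simps)
  from this[THEN arg_cong[where f=complex_of_real]]
  have 1: "complex_of_real (potential \<alpha> B 1 x) =
      complex_of_real (- \<alpha>) * (complex_of_real (x$2) * inverse (complex_of_real ((norm x)\<^sup>2)))
      + complex_of_real (- B / 2) * complex_of_real (x$2)"
    and 2: "complex_of_real (potential \<alpha> B 2 x) =
      complex_of_real \<alpha> * (complex_of_real (x$1) * inverse (complex_of_real ((norm x)\<^sup>2)))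
      + complex_of_real (B / 2) * complex_of_real (x$1)" for x
    by (simp_all only: of_real_add of_real_mult of_real_inverse)
  have "smooth_on (-{0}) (\<lambda>x. complex_of_real (potential \<alpha> B 1 x))"
    "smooth_on (-{0}) (\<lambda>x. complex_of_real (potential \<alpha> B 2 x))"
    unfolding 1 2 by (rule smooth_add smooth_mult smooth_const smooth_coordinate inv o)+
  then show ?thesis using exhaust_2[of j] by auto
qed

lemma cov_deriv_test:
  assumes f: "f \<in> test_functions"
  shows "cov_deriv \<alpha> B j f \<in> test_functions"
proof -
  have "(\<lambda>x. frechet_derivative f (at x) (axis j 1) + \<i> * (complex_of_real (potential \<alpha> B j x) * f x)) \<in> test_functions"
    by (intro test_lin test_derivative test_mult f smooth_potential)
  moreover have "cov_deriv \<alpha> B j f = (\<lambda>x. frechet_derivative f (at x) (axis j 1) + \<i> * (complex_of_real (potential \<alpha> B j x) * f x))"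
    by (rule ext) (simp add: cov_deriv_eq)
  ultimately show ?thesis by simp
qed

lemma cov_deriv_lin:
  assumes "f \<in> test_functions" "g \<in> test_functions"
  shows "cov_deriv \<alpha> B j (\<lambda>x. f x + c * g x) = (\<lambda>x. cov_deriv \<alpha> B j f x + c * cov_deriv \<alpha> B j g x)"
proof
  fix x
  have "((\<lambda>x. f x + c * g x) has_derivative
      (\<lambda>v. frechet_derivative f (at x) v + c * frechet_derivative g (at x) v)) (at x)"
    by (intro has_derivative_add has_derivative_mult_right test_has_derivative assms)
  from frechet_derivative_at[OF this, symmetric]
  show "cov_deriv \<alpha> B j (\<lambda>x. f x + c * g x) x = cov_deriv \<alpha> B j f x + c * cov_deriv \<alpha> B j g x"
    by (simp add: cov_deriv_eq algebra_simps)
qed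

text \<open>
  The potential does not act on the factor \<open>w\<close>.
\<close>

lemma cov_deriv_times:
  assumes f: "f \<in> test_functions" and w: "(w has_derivative w') (at x)"
  shows "cov_deriv \<alpha> B j (\<lambda>x. w x * f x) x = w x * cov_deriv \<alpha> B j f x + w' (axis j 1) * f x"
proof -
  have "((\<lambda>x. w x * f x) has_derivative (\<lambda>v. w x * frechet_derivative f (at x) v + w' v * f x)) (at x)"
    by (intro has_derivative_mult test_has_derivative f w)
  from frechet_derivative_at[OF this, symmetric]
  show ?thesis by (simp add: cov_deriv_eq algebra_simps)
qed

text \<open>
  The derivative of \<open>f cnj(g)\<close> has integral zero.  In its product rule the partial derivatives may be
  replaced by covariant ones, because the contributions \<open>\<i>A\<close> and \<open>-\<i>A\<close> of the real potential cancel.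
\<close>

lemma integration_by_parts:
  assumes f: "f \<in> test_functions" and g: "g \<in> test_functions"
  shows "l2_inner lebesgue (cov_deriv \<alpha> B j f) g = l2_inner lebesgue f (\<lambda>x. - 1 * cov_deriv \<alpha> B j g x)"
proof -
  have fg: "(\<lambda>x. f x * cnj (g x)) \<in> test_functions"
    by (intro test_mult test_cnj g smooth_subset[OF _ test_smooth[OF f]]) auto
  have "frechet_derivative (\<lambda>x. f x * cnj (g x)) (at x) (axis j 1)
      = cov_deriv \<alpha> B j f x * cnj (g x) - f x * cnj (- 1 * cov_deriv \<alpha> B j g x)" for x
  proof -
    have "((\<lambda>x. f x * cnj (g x)) has_derivative
       (\<lambda>v. f x * cnj (frechet_derivative g (at x) v) + frechet_derivative f (at x) v * cnj (g x))) (at x)"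
      by (intro has_derivative_mult bounded_linear.has_derivative[OF bounded_linear_cnj] test_has_derivative f g)
    from frechet_derivative_at[OF this, symmetric] show ?thesis
      by (simp add: cov_deriv_eq algebra_simps)
  qed
  then have "(\<integral>x. cov_deriv \<alpha> B j f x * cnj (g x) - f x * cnj (- 1 * cov_deriv \<alpha> B j g x) \<partial>lebesgue) = 0"
    using integral_derivative_zero[OF fg, of "axis j 1"] by simp
  moreover have "integrable lebesgue (\<lambda>x. cov_deriv \<alpha> B j f x * cnj (g x))"
    "integrable lebesgue (\<lambda>x. f x * cnj (- 1 * cov_deriv \<alpha> B j g x))"
    by (intro l2_product_integrable test_l2 l2.scale_mem cov_deriv_test f g)+
  ultimately show ?thesis
    unfolding l2_inner_def
    by (subst (asm) Bochner_Integration.integral_diff) (auto simp: eq_neg_iff_add_eq_0)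
qed

lemma Q_form_eq:
  assumes f: "f \<in> test_functions"
  shows "Q_form \<alpha> B f = (\<Sum>j\<in>UNIV. (l2_norm lebesgue (cov_deriv \<alpha> B j f))\<^sup>2)"
proof -
  have "(norm (magnetic_gradient \<alpha> B f x))\<^sup>2 = (\<Sum>j\<in>UNIV. (cmod (cov_deriv \<alpha> B j f x))\<^sup>2)" for x
    by (simp add: norm_vec_def L2_set_def cov_deriv_def sum_nonneg)
  then have "Q_form \<alpha> B f = (\<integral>x. (\<Sum>j\<in>UNIV. (cmod (cov_deriv \<alpha> B j f x))\<^sup>2) \<partial>lebesgue)"
    by (simp add: Q_form_def)
  also have "\<dots> = (\<Sum>j\<in>UNIV. (l2_norm lebesgue (cov_deriv \<alpha> B j f))\<^sup>2)"
    unfolding l2_norm_square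
    by (intro Bochner_Integration.integral_sum l2_spaceD(2) test_l2 cov_deriv_test f)
  finally show ?thesis .
qed

global_interpretation magnetic: closable_form test_functions "magnetic_form \<alpha> B" lebesgue "Q_form \<alpha> B"
  for \<alpha> B :: real
proof
  note l2c = test_l2[OF cov_deriv_test]
  show "(\<lambda>x. 0) \<in> test_functions"
    by (rule test_functionI[of _ "{}"]) (auto intro: smooth_const)
  show "(\<lambda>x. f x + c * g x) \<in> test_functions" if "f \<in> test_functions" "g \<in> test_functions" for f g c
    using that by (rule test_lin)
  show "magnetic_form \<alpha> B (\<lambda>x. f x + c * g x) h = magnetic_form \<alpha> B f h + c * magnetic_form \<alpha> B g h"
    if "f \<in> test_functions" "g \<in> test_functions" "h \<in> test_functions" for f g h c
    using that by (simp add: magnetic_form_def cov_deriv_lin l2.left_linear l2c sum.distrib sum_distrib_left)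
  show "magnetic_form \<alpha> B g f = cnj (magnetic_form \<alpha> B f g)"
    if "f \<in> test_functions" "g \<in> test_functions" for f g
    unfolding magnetic_form_def cnj_sum
    by (intro sum.cong refl l2.hermitian l2c that)
  show "0 \<le> Re (magnetic_form \<alpha> B f f)" if "f \<in> test_functions" for f
    unfolding magnetic_form_def Re_sum by (intro sum_nonneg l2.nonneg l2c that)
  show "test_functions \<subseteq> l2_space lebesgue" using test_l2 by blast
  show "Q_form \<alpha> B f = Re (magnetic_form \<alpha> B f f)" if "f \<in> test_functions" for f
    by (simp add: Q_form_eq[OF that] magnetic_form_def l2_inner_self l2_norm_square)
  show "\<exists>k\<in>l2_space lebesgue. \<forall>g\<in>test_functions. magnetic_form \<alpha> B g f = l2_inner lebesgue g k"
    if f: "f \<in> test_functions" for f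
  proof (intro bexI ballI)
    \<comment> \<open>Minus the magnetic Laplacian of \<open>f\<close>, again a test function.\<close>
    let ?k = "\<lambda>x. \<Sum>j\<in>UNIV. (-1) * cov_deriv \<alpha> B j (cov_deriv \<alpha> B j f) x"
    have c: "cov_deriv \<alpha> B j (cov_deriv \<alpha> B j f) \<in> l2_space lebesgue" for j by (intro l2c cov_deriv_test f)
    show "?k \<in> l2_space lebesgue" by (intro l2.sum_mem c) auto
    fix g assume g: "g \<in> test_functions"
    have "l2_inner lebesgue g ?k = (\<Sum>j\<in>UNIV. cnj (-1) * l2_inner lebesgue g (cov_deriv \<alpha> B j (cov_deriv \<alpha> B j f)))"
      by (intro l2.sum_right c test_l2 g) auto
    also have "\<dots> = magnetic_form \<alpha> B g f"
      unfolding magnetic_form_def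
    proof (intro sum.cong refl)
      fix j
      have "l2_inner lebesgue (cov_deriv \<alpha> B j g) (cov_deriv \<alpha> B j f) = l2_inner lebesgue g (\<lambda>x. -1 * cov_deriv \<alpha> B j (cov_deriv \<alpha> B j f) x)"
        by (rule integration_by_parts[OF g cov_deriv_test[OF f]])
      also have "\<dots> = cnj (-1) * l2_inner lebesgue g (cov_deriv \<alpha> B j (cov_deriv \<alpha> B j f))"
        by (intro l2.scale_right test_l2 g c)
      finally show "cnj (-1) * l2_inner lebesgue g (cov_deriv \<alpha> B j (cov_deriv \<alpha> B j f))
          = l2_inner lebesgue (cov_deriv \<alpha> B j g) (cov_deriv \<alpha> B j f)" ..
    qed
    finally show "magnetic_form \<alpha> B g f = l2_inner lebesgue g ?k" ..
  qed
qed

section \<open>Weights with bounded logarithmic gradient\<close>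

text \<open>
  Test the functional on its own gradient vector.
\<close>

lemma gradient_square_le:
  fixes L :: "real^2 \<Rightarrow> real"
  assumes L: "linear L" and le: "\<And>v. \<bar>L v\<bar> \<le> c * norm v"
  shows "(\<Sum>j\<in>UNIV. (L (axis j 1))\<^sup>2) \<le> c\<^sup>2"
proof -
  define v :: "real^2" where "v = (\<Sum>j\<in>UNIV. L (axis j 1) *\<^sub>R axis j 1)"
  have Lv: "L v = (\<Sum>j\<in>UNIV. (L (axis j 1))\<^sup>2)"
    unfolding v_def by (simp add: linear_sum[OF L] linear_scale[OF L] power2_eq_square)
  have vi: "v $ i = L (axis i 1)" for i
    using exhaust_2[of i] by (auto simp: v_def sum_2 axis_def)
  have nv: "(norm v)\<^sup>2 = (\<Sum>j\<in>UNIV. (L (axis j 1))\<^sup>2)"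
    by (simp add: norm_vec_def L2_set_def vi sum_nonneg)
  have "(norm v)\<^sup>2 \<le> c * norm v" using le[of v] unfolding Lv nv by linarith
  then have "norm v \<le> c \<or> norm v = 0" by (auto simp: power2_eq_square mult_le_cancel_right)
  then have "(norm v)\<^sup>2 \<le> c\<^sup>2" by (auto intro: power_mono)
  then show ?thesis by (simp add: nv)
qed

text \<open>
  The bound \<open>slope\<close> says, for \<open>a > 0\<close>, that \<open>\<omega>\<close> is \<open>exp (- 2 a \<rho>)\<close> with \<open>\<bar>\<nabla>\<rho>\<bar> \<le> 1\<close>.
\<close>

locale smooth_weight = bounded_weight lebesgue \<omega> C
  for \<omega> :: "real^2 \<Rightarrow> real" and C +
  fixes \<omega>' :: "real^2 \<Rightarrow> real^2 \<Rightarrow> real" and a :: real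
  assumes smooth: "smooth_on UNIV (\<lambda>x. complex_of_real (\<omega> x))"
    and pos: "\<And>x. 0 < \<omega> x"
    and deriv: "\<And>x. (\<omega> has_derivative \<omega>' x) (at x)"
    and slope: "\<And>x v. \<bar>\<omega>' x v\<bar> \<le> 2 * a * \<omega> x * norm v"
    and a_nonneg: "0 \<le> a"
begin

lemma weigh_test: "f \<in> test_functions \<Longrightarrow> weigh f \<in> test_functions"
  unfolding weigh_def[abs_def] by (intro test_mult smooth_subset[OF _ smooth]) auto

lemma deriv_complex:
  "((\<lambda>x. complex_of_real (\<omega> x)) has_derivative (\<lambda>v. complex_of_real (\<omega>' x v))) (at x)"
  by (rule bounded_linear.has_derivative[OF bounded_linear_of_real deriv])

lemma cov_deriv_weigh:
  assumes f: "f \<in> test_functions"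
  shows "cov_deriv \<alpha> B j (weigh f) x = complex_of_real (\<omega> x) * cov_deriv \<alpha> B j f x + complex_of_real (\<omega>' x (axis j 1)) * f x"
  unfolding weigh_def[abs_def] by (rule cov_deriv_times[OF f deriv_complex])

lemma partial_measurable: "(\<lambda>x. \<omega>' x v) \<in> borel_measurable lebesgue"
proof -
  have eq: "(\<lambda>x. frechet_derivative (\<lambda>x. complex_of_real (\<omega> x)) (at x) v) = (\<lambda>x. complex_of_real (\<omega>' x v))"
    by (simp add: frechet_derivative_at[OF deriv_complex, symmetric])
  have "continuous_on UNIV (\<lambda>x. complex_of_real (\<omega>' x v))"
    using smooth_continuous[OF smooth_derivative[OF smooth, of v]] unfolding eq .
  then have "continuous_on UNIV (\<lambda>x. Re (complex_of_real (\<omega>' x v)))" by (rule continuous_on_Re)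
  then have "(\<lambda>x. \<omega>' x v) \<in> borel_measurable borel" by (intro borel_measurable_continuous_onI) simp
  then show ?thesis by (simp add: measurable_completion)
qed

lemma partial_le: "\<bar>\<omega>' x (axis j 1)\<bar> \<le> 2 * a * C"
proof -
  have "\<bar>\<omega>' x (axis j 1)\<bar> \<le> 2 * a * \<omega> x" using slope[of x "axis j 1"] by (simp add: norm_axis_1)
  also have "\<dots> \<le> 2 * a * C" using a_nonneg weight_le[of x] by (intro mult_left_mono) auto
  finally show ?thesis .
qed

text \<open>
  Multiplication by the weight is bounded in the form norm, so it preserves the domain of the closure.
\<close>

lemma seminorm_weigh_le:
  assumes f: "f \<in> test_functions"
  shows "magnetic.seminorm \<alpha> B (weigh f) \<le> 2 * C * magnetic.seminorm \<alpha> B f + 4 * a * C * l2_norm lebesgue f"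
proof -
  have sq: "magnetic.seminorm \<alpha> B g = sqrt (\<Sum>j\<in>UNIV. (l2_norm lebesgue (cov_deriv \<alpha> B j g))\<^sup>2)" for g
    by (simp add: magnetic.seminorm_def magnetic_form_def l2_inner_self l2_norm_square)
  have comp: "l2_norm lebesgue (cov_deriv \<alpha> B j f) \<le> magnetic.seminorm \<alpha> B f" for j
    unfolding sq by (intro real_le_rsqrt member_le_sum) auto
  have "l2_norm lebesgue (cov_deriv \<alpha> B j (weigh f)) \<le> C * magnetic.seminorm \<alpha> B f + 2 * a * C * l2_norm lebesgue f" for j
  proof -
    have c: "cov_deriv \<alpha> B j f \<in> l2_space lebesgue" by (intro test_l2 cov_deriv_test f)
    have d: "(\<lambda>x. complex_of_real (\<omega>' x (axis j 1)) * f x) \<in> l2_space lebesgue"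
      "l2_norm lebesgue (\<lambda>x. complex_of_real (\<omega>' x (axis j 1)) * f x) \<le> 2 * a * C * l2_norm lebesgue f"
      by (rule bounded_mult[OF partial_measurable partial_le test_l2[OF f]])+
    have "cov_deriv \<alpha> B j (weigh f) = (\<lambda>x. weigh (cov_deriv \<alpha> B j f) x + complex_of_real (\<omega>' x (axis j 1)) * f x)"
      by (rule ext) (simp add: cov_deriv_weigh[OF f] weigh_def)
    then have "l2_norm lebesgue (cov_deriv \<alpha> B j (weigh f)) \<le> l2_norm lebesgue (weigh (cov_deriv \<alpha> B j f)) + 2 * a * C * l2_norm lebesgue f"
      using l2.triangle[OF weigh_mem[OF c] d(1)] d(2) by simp
    moreover have "l2_norm lebesgue (weigh (cov_deriv \<alpha> B j f)) \<le> C * magnetic.seminorm \<alpha> B f"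
      using weigh_norm[OF c] mult_left_mono[OF comp[of j] C_nonneg] by linarith
    ultimately show ?thesis by linarith
  qed
  then have "(\<Sum>j\<in>UNIV. l2_norm lebesgue (cov_deriv \<alpha> B j (weigh f)))
      \<le> (\<Sum>j\<in>(UNIV::2 set). C * magnetic.seminorm \<alpha> B f + 2 * a * C * l2_norm lebesgue f)"
    by (intro sum_mono)
  moreover have "magnetic.seminorm \<alpha> B (weigh f) \<le> (\<Sum>j\<in>UNIV. l2_norm lebesgue (cov_deriv \<alpha> B j (weigh f)))"
    unfolding sq L2_set_def[symmetric] by (rule L2_set_le_sum) simp
  ultimately show ?thesis by simp
qed

lemma approx_weigh:
  assumes \<phi>: "form_approx lebesgue test_functions (Q_form \<alpha> B) \<phi> f"
  shows "form_approx lebesgue test_functions (Q_form \<alpha> B) (\<lambda>n. weigh (\<phi> n)) (weigh f)"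
  unfolding magnetic.approx_iff
proof (intro conjI allI impI)
  note D = magnetic.approxD[OF \<phi>]
  have diff: "(\<lambda>x. weigh g x - weigh h x) = weigh (\<lambda>x. g x - h x)" for g h
    by (rule ext) (simp add: weigh_def right_diff_distrib)
  show "weigh f \<in> l2_space lebesgue" by (intro weigh_mem D)
  show "weigh (\<phi> n) \<in> test_functions" for n by (intro weigh_test D)
  show "(\<lambda>n. l2_norm lebesgue (\<lambda>x. weigh (\<phi> n) x - weigh f x)) \<longlonglongrightarrow> 0"
  proof (rule Lim_null_comparison)
    show "(\<lambda>n. C * l2_norm lebesgue (\<lambda>x. \<phi> n x - f x)) \<longlonglongrightarrow> 0"
      using tendsto_mult_left[OF D(4), of C] by simp
    show "\<forall>\<^sub>F n in sequentially. norm (l2_norm lebesgue (\<lambda>x. weigh (\<phi> n) x - weigh f x))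
        \<le> C * l2_norm lebesgue (\<lambda>x. \<phi> n x - f x)"
      unfolding diff using weigh_norm[OF l2.diff_mem[OF D(3) D(1)]] by simp
  qed
  fix e :: real assume e: "e > 0"
  \<comment> \<open>The two bounds below are \<open>\<delta>\<close> and \<open>2\<delta>\<close>; the summand \<open>1\<close> keeps the final inequality strict.\<close>
  define \<delta> where "\<delta> = e / (2 * C + 8 * a * C + 1)"
  have K: "2 * C + 8 * a * C + 1 > 0" using C_nonneg a_nonneg by (simp add: add_nonneg_pos)
  then have \<delta>: "\<delta> > 0" using e by (simp add: \<delta>_def)
  obtain N1 where N1: "\<forall>m\<ge>N1. \<forall>n\<ge>N1. magnetic.seminorm \<alpha> B (\<lambda>x. \<phi> m x - \<phi> n x) < \<delta>"
    using D(5)[OF \<delta>] by blast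
  obtain N2 where N2: "\<And>n. n \<ge> N2 \<Longrightarrow> l2_norm lebesgue (\<lambda>x. \<phi> n x - f x) < \<delta>"
    using order_tendstoD(2)[OF D(4) \<delta>] by (auto simp: eventually_sequentially)
  have "magnetic.seminorm \<alpha> B (\<lambda>x. weigh (\<phi> m) x - weigh (\<phi> n) x) < e"
    if m: "m \<ge> max N1 N2" and n: "n \<ge> max N1 N2" for m n
  proof -
    have s: "magnetic.seminorm \<alpha> B (\<lambda>x. \<phi> m x - \<phi> n x) \<le> \<delta>" using N1 m n by (simp add: less_imp_le)
    have "l2_norm lebesgue (\<lambda>x. \<phi> m x - \<phi> n x) \<le> l2_norm lebesgue (\<lambda>x. \<phi> m x - f x) + l2_norm lebesgue (\<lambda>x. f x - \<phi> n x)"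
      using l2.triangle_mid[OF D(3) D(1) D(3), of m n] by simp
    also have "l2_norm lebesgue (\<lambda>x. f x - \<phi> n x) = l2_norm lebesgue (\<lambda>x. \<phi> n x - f x)"
      using l2.seminorm_minus[OF D(1) D(3), of n] by simp
    finally have l: "l2_norm lebesgue (\<lambda>x. \<phi> m x - \<phi> n x) \<le> 2 * \<delta>"
      using N2[of m] N2[of n] m n by simp
    have "magnetic.seminorm \<alpha> B (\<lambda>x. weigh (\<phi> m) x - weigh (\<phi> n) x) \<le>
        2 * C * magnetic.seminorm \<alpha> B (\<lambda>x. \<phi> m x - \<phi> n x) + 4 * a * C * l2_norm lebesgue (\<lambda>x. \<phi> m x - \<phi> n x)"
      unfolding diff by (intro seminorm_weigh_le magnetic.diff_mem D)
    also have "\<dots> \<le> 2 * C * \<delta> + 4 * a * C * (2 * \<delta>)"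
      using C_nonneg a_nonneg by (intro add_mono mult_left_mono s l) auto
    also have "\<dots> < (2 * C + 8 * a * C + 1) * \<delta>" using \<delta> by (simp add: algebra_simps)
    also have "\<dots> = e" using K by (simp add: \<delta>_def)
    finally show ?thesis .
  qed
  then show "\<exists>N. \<forall>m\<ge>N. \<forall>n\<ge>N. magnetic.seminorm \<alpha> B (\<lambda>x. weigh (\<phi> m) x - weigh (\<phi> n) x) < e" by blast
qed

text \<open>
  Absorb the cross term \<open>d\<^sub>j Re (c\<^sub>j cnj z)\<close> into \<open>w \<bar>c\<^sub>j\<bar>\<^sup>2\<close>.  Here \<open>c\<close> plays the covariant
  gradient, \<open>d\<close> the gradient of the weight, \<open>z\<close> the value of the function and \<open>w\<close> the value of the weight.
\<close>

lemma pointwise_lower_bound: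
  fixes c :: "2 \<Rightarrow> complex" and d :: "2 \<Rightarrow> real" and z :: complex and w :: real
  assumes w: "0 < w" and d: "(\<Sum>j\<in>UNIV. (d j)\<^sup>2) \<le> (2 * a * w)\<^sup>2"
  shows "- a\<^sup>2 * (w * (cmod z)\<^sup>2) \<le> (\<Sum>j\<in>UNIV. Re (c j * cnj (complex_of_real w * c j + complex_of_real (d j) * z)))"
proof -
  have j: "- ((d j)\<^sup>2 * (cmod z)\<^sup>2 / (4 * w)) \<le> Re (c j * cnj (complex_of_real w * c j + complex_of_real (d j) * z))" for j
  proof -
    have eq: "Re (c j * cnj (complex_of_real w * c j + complex_of_real (d j) * z)) = w * (cmod (c j))\<^sup>2 + d j * Re (c j * cnj z)"
      unfolding cmod_power2 by (simp add: algebra_simps power2_eq_square)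
    have "\<bar>d j * Re (c j * cnj z)\<bar> \<le> \<bar>d j\<bar> * (cmod (c j) * cmod z)"
      using abs_Re_le_cmod[of "c j * cnj z"] by (simp add: abs_mult norm_mult mult_left_mono)
    moreover have "\<bar>d j\<bar> * (cmod (c j) * cmod z) \<le> w * (cmod (c j))\<^sup>2 + (d j)\<^sup>2 * (cmod z)\<^sup>2 / (4 * w)"
    proof -
      have "0 \<le> (2 * w * cmod (c j) - \<bar>d j\<bar> * cmod z)\<^sup>2 / (4 * w)" using w by simp
      also have "\<dots> = w * (cmod (c j))\<^sup>2 + (d j)\<^sup>2 * (cmod z)\<^sup>2 / (4 * w) - \<bar>d j\<bar> * (cmod (c j) * cmod z)"
        using w by (simp add: power2_diff power_mult_distrib field_simps power2_eq_square)
      finally show ?thesis by simp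
    qed
    ultimately show ?thesis unfolding eq by linarith
  qed
  have "- a\<^sup>2 * (w * (cmod z)\<^sup>2) = - ((2 * a * w)\<^sup>2 * ((cmod z)\<^sup>2 / (4 * w)))"
    using w by (simp add: power2_eq_square field_simps)
  also have "\<dots> \<le> - ((\<Sum>j\<in>UNIV. (d j)\<^sup>2) * ((cmod z)\<^sup>2 / (4 * w)))"
    using w by (intro le_imp_neg_le mult_right_mono d) auto
  also have "\<dots> = (\<Sum>j\<in>UNIV. - ((d j)\<^sup>2 * (cmod z)\<^sup>2 / (4 * w)))"
    by (simp add: sum_negf sum_distrib_right sum_divide_distrib)
  also have "\<dots> \<le> (\<Sum>j\<in>UNIV. Re (c j * cnj (complex_of_real w * c j + complex_of_real (d j) * z)))"
    by (intro sum_mono j)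
  finally show ?thesis .
qed

lemma form_lower_bound:
  assumes f: "f \<in> test_functions"
  shows "- a\<^sup>2 * (weighted_norm f)\<^sup>2 \<le> Re (magnetic_form \<alpha> B f (weigh f))"
proof -
  have i1: "integrable lebesgue (\<lambda>x. cov_deriv \<alpha> B j f x * cnj (cov_deriv \<alpha> B j (weigh f) x))" for j
    by (intro l2_product_integrable test_l2 cov_deriv_test weigh_test f)
  have i2: "integrable lebesgue (\<lambda>x. f x * cnj (weigh f x))"
    by (intro l2_product_integrable test_l2 weigh_test f)
  have "(weighted_norm f)\<^sup>2 = Re (l2_inner lebesgue f (weigh f))" by (simp add: weighted_norm_square del: of_real_power)
  also have "\<dots> = (\<integral>x. Re (f x * cnj (weigh f x)) \<partial>lebesgue)"
    unfolding l2_inner_def by (rule integral_Re[OF i2, symmetric])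
  finally have wn: "- a\<^sup>2 * (weighted_norm f)\<^sup>2 = (\<integral>x. - a\<^sup>2 * Re (f x * cnj (weigh f x)) \<partial>lebesgue)" by simp
  have "Re (magnetic_form \<alpha> B f (weigh f)) = (\<Sum>j\<in>UNIV. \<integral>x. Re (cov_deriv \<alpha> B j f x * cnj (cov_deriv \<alpha> B j (weigh f) x)) \<partial>lebesgue)"
    unfolding magnetic_form_def l2_inner_def Re_sum by (intro sum.cong refl integral_Re[OF i1, symmetric])
  also have "\<dots> = (\<integral>x. (\<Sum>j\<in>UNIV. Re (cov_deriv \<alpha> B j f x * cnj (cov_deriv \<alpha> B j (weigh f) x))) \<partial>lebesgue)"
    by (intro Bochner_Integration.integral_sum[symmetric] integrable_Re i1)
  finally have mf: "Re (magnetic_form \<alpha> B f (weigh f)) = \<dots>" .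
  show ?thesis
    unfolding wn mf
  proof (rule integral_mono)
    show "integrable lebesgue (\<lambda>x. - a\<^sup>2 * Re (f x * cnj (weigh f x)))"
      by (intro integrable_mult_right integrable_Re i2)
    show "integrable lebesgue (\<lambda>x. \<Sum>j\<in>UNIV. Re (cov_deriv \<alpha> B j f x * cnj (cov_deriv \<alpha> B j (weigh f) x)))"
      by (intro Bochner_Integration.integrable_sum integrable_Re i1)
    fix x
    have "Re (f x * cnj (weigh f x)) = \<omega> x * (cmod (f x))\<^sup>2"
      unfolding cmod_power2 by (simp add: weigh_def algebra_simps power2_eq_square)
    moreover have "(\<Sum>j\<in>UNIV. (\<omega>' x (axis j 1))\<^sup>2) \<le> (2 * a * \<omega> x)\<^sup>2"
      by (rule gradient_square_le[OF has_derivative_linear[OF deriv] slope])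
    ultimately show "- a\<^sup>2 * Re (f x * cnj (weigh f x)) \<le> (\<Sum>j\<in>UNIV. Re (cov_deriv \<alpha> B j f x * cnj (cov_deriv \<alpha> B j (weigh f) x)))"
      using pointwise_lower_bound[OF pos[of x], of "\<lambda>j. \<omega>' x (axis j 1)" "f x" "\<lambda>j. cov_deriv \<alpha> B j f x"]
      by (simp only: cov_deriv_weigh[OF f])
  qed
qed

lemma generator_lower_bound:
  assumes "(f, h) \<in> H_op \<alpha> B"
  shows "- a\<^sup>2 * (weighted_norm f)\<^sup>2 \<le> Re (l2_inner lebesgue h (weigh f))"
proof -
  note op = assms[unfolded H_op_def]
  obtain \<phi> where \<phi>: "form_approx lebesgue test_functions (Q_form \<alpha> B) \<phi> f"
    using magnetic.form_operatorD(1)[OF op] by blast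
  note D = magnetic.approxD[OF \<phi>]
  have lim: "(\<lambda>n. Re (magnetic_form \<alpha> B (\<phi> n) (weigh (\<phi> n)))) \<longlonglongrightarrow> Re (l2_inner lebesgue h (weigh f))"
    by (rule tendsto_Re[OF magnetic.form_operatorD(3)[OF op \<phi> approx_weigh[OF \<phi>]]])
  have "(\<lambda>n. - a\<^sup>2 * (weighted_norm (\<phi> n))\<^sup>2) \<longlonglongrightarrow> - a\<^sup>2 * (weighted_norm f)\<^sup>2"
    by (intro tendsto_intros weighted_norm_tendsto D)
  from LIMSEQ_le[OF this lim] show ?thesis
    using form_lower_bound[OF D(2)] by blast
qed

lemma heat_weighted_bound:
  assumes "(f, u) \<in> heat_semigroup \<alpha> B t" and t: "t \<ge> 0"
  shows "f \<in> l2_space lebesgue" "u \<in> l2_space lebesgue" "weighted_norm u \<le> exp (a\<^sup>2 * t) * weighted_norm f"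
proof -
  obtain E where E: "projection_valued_measure lebesgue E"
    and H: "H_op \<alpha> B = spectral_integral lebesgue E complex_of_real"
    and u: "(f, u) \<in> spectral_integral lebesgue E (\<lambda>r. complex_of_real (exp (- t * r)))"
    using assms(1) by (auto simp: heat_semigroup_def functional_calculus_def)
  interpret weighted_resolution lebesgue E \<omega> C "a\<^sup>2"
  proof
    show "projection_valued_measure lebesgue E" by (rule E)
    show "((\<lambda>x. \<Sum>j\<in>J. c j * f j x), (\<lambda>x. \<Sum>j\<in>J. c j * h j x)) \<in> spectral_integral lebesgue E complex_of_real"
      if "finite J" "\<And>j. j \<in> J \<Longrightarrow> (f j, h j) \<in> spectral_integral lebesgue E complex_of_real"
      for J :: "int set" and f h c
      using magnetic.form_operator_sum[of J f h \<alpha> B c] that unfolding H[symmetric] H_op_def by blast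
    show "- a\<^sup>2 * (weighted_norm f)\<^sup>2 \<le> Re (l2_inner lebesgue h (weigh f))"
      if "(f, h) \<in> spectral_integral lebesgue E complex_of_real" for f h
      using generator_lower_bound[of f h \<alpha> B] that unfolding H by blast
  qed simp
  show "f \<in> l2_space lebesgue" "u \<in> l2_space lebesgue"
    using spectral_integral_domain[OF u] by auto
  show "weighted_norm u \<le> exp (a\<^sup>2 * t) * weighted_norm f"
    by (rule weighted_semigroup_bound[OF u t])
qed

end

section \<open>A smooth distance from a finite set\<close>

definition rounded_dist :: "real \<Rightarrow> real^2 \<Rightarrow> real^2 \<Rightarrow> real" where
  "rounded_dist \<epsilon> y x = sqrt (\<epsilon>\<^sup>2 + (norm (x - y))\<^sup>2)"

definition soft_sum :: "(real^2) set \<Rightarrow> real \<Rightarrow> real \<Rightarrow> real^2 \<Rightarrow> real" where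
  "soft_sum Y k \<epsilon> x = (\<Sum>y\<in>Y. exp (- k * rounded_dist \<epsilon> y x))"

text \<open>
  With \<open>\<rho> = - (1/k) ln soft_sum\<close>, a smooth version of the distance from \<open>Y\<close>, this is
  \<open>exp (- 2 a \<rho>)\<close>.
\<close>

definition soft_weight :: "(real^2) set \<Rightarrow> real \<Rightarrow> real \<Rightarrow> real \<Rightarrow> real^2 \<Rightarrow> real" where
  "soft_weight Y k \<epsilon> a x = soft_sum Y k \<epsilon> x powr (2 * a / k)"

definition soft_sum_deriv :: "(real^2) set \<Rightarrow> real \<Rightarrow> real \<Rightarrow> real^2 \<Rightarrow> real^2 \<Rightarrow> real" where
  "soft_sum_deriv Y k \<epsilon> x v =
    (\<Sum>y\<in>Y. - k * exp (- k * rounded_dist \<epsilon> y x) * (inner (x - y) v / rounded_dist \<epsilon> y x))"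

lemma rounded_dist_pos: "\<epsilon> > 0 \<Longrightarrow> 0 < rounded_dist \<epsilon> y x"
  by (simp add: rounded_dist_def add_pos_nonneg)

lemma rounded_dist_ge: "norm (x - y) \<le> rounded_dist \<epsilon> y x"
  unfolding rounded_dist_def by (rule real_le_rsqrt) simp

lemma rounded_dist_le: "norm (x - y) \<le> \<epsilon> \<Longrightarrow> rounded_dist \<epsilon> y x \<le> 2 * \<epsilon>"
proof -
  assume le: "norm (x - y) \<le> \<epsilon>"
  then have e: "0 \<le> \<epsilon>" using norm_ge_zero order_trans by blast
  have "(norm (x - y))\<^sup>2 \<le> \<epsilon>\<^sup>2" using le by (intro power_mono) auto
  then have "\<epsilon>\<^sup>2 + (norm (x - y))\<^sup>2 \<le> 4 * \<epsilon>\<^sup>2"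
    using zero_le_power2[of \<epsilon>] by linarith
  then have "\<epsilon>\<^sup>2 + (norm (x - y))\<^sup>2 \<le> (2 * \<epsilon>)\<^sup>2" by (simp add: power_mult_distrib)
  then show ?thesis unfolding rounded_dist_def using e by (intro real_le_lsqrt) auto
qed

lemma soft_sum_pos: "finite Y \<Longrightarrow> Y \<noteq> {} \<Longrightarrow> 0 < soft_sum Y k \<epsilon> x"
  unfolding soft_sum_def by (intro sum_pos) auto

lemma smooth_of_real_rounded_dist:
  assumes "\<epsilon> > 0"
  shows "smooth_on UNIV (\<lambda>x. complex_of_real (rounded_dist \<epsilon> y x))"
proof -
  have eq: "complex_of_real (\<epsilon>\<^sup>2 + (norm (x - y))\<^sup>2) = complex_of_real (\<epsilon>\<^sup>2) +
    ((complex_of_real (x$1) + complex_of_real (- (y$1))) * (complex_of_real (x$1) + complex_of_real (- (y$1)))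
     + (complex_of_real (x$2) + complex_of_real (- (y$2))) * (complex_of_real (x$2) + complex_of_real (- (y$2))))" for x
    by (simp add: norm_vec_def L2_set_def sum_2 power2_eq_square)
  have "smooth_on UNIV (\<lambda>x. complex_of_real (\<epsilon>\<^sup>2 + (norm (x - y))\<^sup>2))"
    by (rule smooth_cong[OF open_UNIV _ eq[symmetric]]) (rule smooth_add smooth_mult smooth_coordinate smooth_const open_UNIV)+
  then have "smooth_on UNIV (\<lambda>x. csqrt (complex_of_real (\<epsilon>\<^sup>2 + (norm (x - y))\<^sup>2)))"
  proof (rule smooth_holomorphic_compose[OF open_UNIV, where T="- \<real>\<^sub>\<le>\<^sub>0"])
    have "\<epsilon>\<^sup>2 + (norm (x - y))\<^sup>2 > 0" for x using assms by (simp add: add_pos_nonneg)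
    then show "(\<lambda>x. complex_of_real (\<epsilon>\<^sup>2 + (norm (x - y))\<^sup>2)) ` UNIV \<subseteq> - \<real>\<^sub>\<le>\<^sub>0"
      by (auto simp: complex_nonpos_Reals_iff dest!: leD simp del: of_real_add of_real_power)
  qed (auto intro: holomorphic_on_csqrt)
  then show ?thesis
    by (rule smooth_cong[OF open_UNIV]) (simp add: rounded_dist_def csqrt_of_real del: of_real_add of_real_power)
qed

lemma smooth_of_real_exp:
  "smooth_on UNIV (\<lambda>x. complex_of_real (h x)) \<Longrightarrow> smooth_on UNIV (\<lambda>x. complex_of_real (exp (c * h x)))"
proof -
  assume h: "smooth_on UNIV (\<lambda>x. complex_of_real (h x))"
  have "smooth_on UNIV (\<lambda>x. exp (complex_of_real c * complex_of_real (h x)))"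
    by (rule smooth_holomorphic_compose[OF open_UNIV smooth_mult[OF open_UNIV smooth_const[OF open_UNIV] h] open_UNIV])
      (auto intro: holomorphic_intros)
  then show ?thesis
    by (rule smooth_cong[OF open_UNIV]) (simp flip: of_real_mult exp_of_real)
qed

lemma smooth_soft_weight:
  assumes Y: "finite Y" "Y \<noteq> {}" and "\<epsilon> > 0"
  shows "smooth_on UNIV (\<lambda>x. complex_of_real (soft_weight Y k \<epsilon> a x))"
proof -
  have "smooth_on UNIV (\<lambda>x. \<Sum>y\<in>Y. complex_of_real (exp (- k * rounded_dist \<epsilon> y x)))"
    by (intro smooth_sum smooth_of_real_exp smooth_of_real_rounded_dist open_UNIV assms)
  then have "smooth_on UNIV (\<lambda>x. complex_of_real (soft_sum Y k \<epsilon> x))" by (simp add: soft_sum_def)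
  then have "smooth_on UNIV (\<lambda>x. Ln (complex_of_real (soft_sum Y k \<epsilon> x)))"
    by (rule smooth_holomorphic_compose[OF open_UNIV, where T="- \<real>\<^sub>\<le>\<^sub>0"])
      (auto simp: complex_nonpos_Reals_iff soft_sum_pos[OF Y] dest!: leD intro!: holomorphic_intros)
  then have "smooth_on UNIV (\<lambda>x. complex_of_real (ln (soft_sum Y k \<epsilon> x)))"
    by (simp add: Ln_of_real soft_sum_pos[OF Y])
  from smooth_of_real_exp[OF this, of "2 * a / k"] show ?thesis
    using soft_sum_pos[OF Y] by (simp add: soft_weight_def powr_def less_imp_neq[symmetric])
qed

lemma soft_sum_has_derivative:
  assumes "\<epsilon> > 0"
  shows "(soft_sum Y k \<epsilon> has_derivative soft_sum_deriv Y k \<epsilon> x) (at x)"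
proof -
  have q: "(rounded_dist \<epsilon> y has_derivative (\<lambda>v. inner (x - y) v / rounded_dist \<epsilon> y x)) (at x)" for y
  proof -
    have p: "\<epsilon>\<^sup>2 + inner (x - y) (x - y) > 0" using assms by (simp add: add_pos_nonneg)
    have "((\<lambda>x. sqrt (\<epsilon>\<^sup>2 + inner (x - y) (x - y))) has_derivative
      (\<lambda>v. inner (x - y) v / sqrt (\<epsilon>\<^sup>2 + inner (x - y) (x - y)))) (at x)"
      using p by (auto intro!: derivative_eq_intros simp: inner_commute field_simps)
    then show ?thesis
      unfolding rounded_dist_def[abs_def] power2_norm_eq_inner .
  qed
  show ?thesis
    unfolding soft_sum_def[abs_def] soft_sum_deriv_def[abs_def]
    by (auto intro!: derivative_eq_intros q simp: mult_ac)
qed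

text \<open>
  Each \<open>rounded_dist\<close> has slope at most one, and all terms of the sum carry the same factor \<open>k\<close>.
\<close>

lemma soft_sum_deriv_le:
  assumes "\<epsilon> > 0" "k \<ge> 0"
  shows "\<bar>soft_sum_deriv Y k \<epsilon> x v\<bar> \<le> k * soft_sum Y k \<epsilon> x * norm v"
proof -
  have "\<bar>soft_sum_deriv Y k \<epsilon> x v\<bar> \<le> (\<Sum>y\<in>Y. \<bar>- k * exp (- k * rounded_dist \<epsilon> y x) * (inner (x - y) v / rounded_dist \<epsilon> y x)\<bar>)"
    unfolding soft_sum_deriv_def by (rule sum_abs)
  also have "\<dots> \<le> (\<Sum>y\<in>Y. k * exp (- k * rounded_dist \<epsilon> y x) * norm v)"
  proof (rule sum_mono)
    fix y
    have "\<bar>inner (x - y) v\<bar> \<le> norm (x - y) * norm v" by (rule Cauchy_Schwarz_ineq2)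
    also have "\<dots> \<le> rounded_dist \<epsilon> y x * norm v" by (intro mult_right_mono rounded_dist_ge) auto
    finally have "\<bar>inner (x - y) v / rounded_dist \<epsilon> y x\<bar> \<le> norm v"
      using rounded_dist_pos[OF assms(1), of y x] by (simp add: abs_divide pos_divide_le_eq mult.commute)
    then have "k * exp (- k * rounded_dist \<epsilon> y x) * \<bar>inner (x - y) v / rounded_dist \<epsilon> y x\<bar>
        \<le> k * exp (- k * rounded_dist \<epsilon> y x) * norm v"
      using assms(2) by (intro mult_left_mono) auto
    then show "\<bar>- k * exp (- k * rounded_dist \<epsilon> y x) * (inner (x - y) v / rounded_dist \<epsilon> y x)\<bar>
        \<le> k * exp (- k * rounded_dist \<epsilon> y x) * norm v"
      using assms(2) by (simp add: abs_mult)
  qed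
  also have "\<dots> = k * soft_sum Y k \<epsilon> x * norm v"
    by (simp add: soft_sum_def sum_distrib_left sum_distrib_right)
  finally show ?thesis .
qed

lemma soft_sum_le_card:
  assumes "k \<ge> 0" "\<And>y. y \<in> Y \<Longrightarrow> D \<le> norm (x - y)"
  shows "soft_sum Y k \<epsilon> x \<le> card Y * exp (- k * D)"
proof -
  have "soft_sum Y k \<epsilon> x \<le> (\<Sum>y\<in>Y. exp (- k * D))"
    unfolding soft_sum_def
  proof (rule sum_mono)
    fix y assume "y \<in> Y"
    then have "D \<le> rounded_dist \<epsilon> y x" using assms(2) rounded_dist_ge order_trans by blast
    then show "exp (- k * rounded_dist \<epsilon> y x) \<le> exp (- k * D)" using assms(1) by (simp add: mult_left_mono)
  qed
  then show ?thesis by simp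
qed

lemma soft_weight_smooth_weight:
  assumes Y: "finite Y" "Y \<noteq> {}" and \<epsilon>: "\<epsilon> > 0" and k: "k > 0" and a: "a \<ge> 0"
  shows "smooth_weight (soft_weight Y k \<epsilon> a) (real (card Y) powr (2 * a / k))
    (\<lambda>x v. soft_sum_deriv Y k \<epsilon> x v * (2 * a / k * soft_sum Y k \<epsilon> x powr (2 * a / k - 1))) a"
proof
  note Spos = soft_sum_pos[OF Y, of k \<epsilon>]
  note sm = smooth_soft_weight[OF Y \<epsilon>, of k a]
  show "smooth_on UNIV (\<lambda>x. complex_of_real (soft_weight Y k \<epsilon> a x))" by (rule sm)
  have "continuous_on UNIV (\<lambda>x. Re (complex_of_real (soft_weight Y k \<epsilon> a x)))"
    by (rule continuous_on_Re[OF smooth_continuous[OF sm]])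
  then have "soft_weight Y k \<epsilon> a \<in> borel_measurable borel" by (intro borel_measurable_continuous_onI) simp
  then show "soft_weight Y k \<epsilon> a \<in> borel_measurable lebesgue" by (simp add: measurable_completion)
  show "0 \<le> soft_weight Y k \<epsilon> a x" for x by (simp add: soft_weight_def)
  show "0 < soft_weight Y k \<epsilon> a x" for x using Spos[of x] by (simp add: soft_weight_def)
  show "soft_weight Y k \<epsilon> a x \<le> real (card Y) powr (2 * a / k)" for x
    unfolding soft_weight_def
    using soft_sum_le_card[of k Y 0 x \<epsilon>] Spos[of x] k a by (intro powr_mono2) auto
  show "0 \<le> a" by (rule a)
  fix x
  have "((\<lambda>z. z powr (2 * a / k)) has_real_derivative 2 * a / k * soft_sum Y k \<epsilon> x powr (2 * a / k - 1)) (at (soft_sum Y k \<epsilon> x))"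
    by (rule has_real_derivative_powr[OF Spos])
  from DERIV_compose_FDERIV[OF this soft_sum_has_derivative[OF \<epsilon>]]
  show "(soft_weight Y k \<epsilon> a has_derivative
      (\<lambda>v. soft_sum_deriv Y k \<epsilon> x v * (2 * a / k * soft_sum Y k \<epsilon> x powr (2 * a / k - 1)))) (at x)"
    unfolding soft_weight_def[abs_def] .
  fix v
  have c: "0 \<le> 2 * a / k * soft_sum Y k \<epsilon> x powr (2 * a / k - 1)" using a k by simp
  have "\<bar>soft_sum_deriv Y k \<epsilon> x v * (2 * a / k * soft_sum Y k \<epsilon> x powr (2 * a / k - 1))\<bar>
    \<le> (k * soft_sum Y k \<epsilon> x * norm v) * (2 * a / k * soft_sum Y k \<epsilon> x powr (2 * a / k - 1))"
    unfolding abs_mult[of "soft_sum_deriv Y k \<epsilon> x v"] abs_of_nonneg[OF c]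
    using k by (intro mult_right_mono soft_sum_deriv_le \<epsilon> c) auto
  also have "\<dots> = 2 * a * (soft_sum Y k \<epsilon> x * soft_sum Y k \<epsilon> x powr (2 * a / k - 1)) * norm v"
    using k by simp
  also have "soft_sum Y k \<epsilon> x * soft_sum Y k \<epsilon> x powr (2 * a / k - 1) = soft_weight Y k \<epsilon> a x"
    unfolding soft_weight_def using Spos[of x] by (simp add: powr_diff)
  finally show "\<bar>soft_sum_deriv Y k \<epsilon> x v * (2 * a / k * soft_sum Y k \<epsilon> x powr (2 * a / k - 1))\<bar>
      \<le> 2 * a * soft_weight Y k \<epsilon> a x * norm v" .
qed

section \<open>The off-diagonal estimate\<close>

lemma finite_net:
  fixes S :: "(real^2) set"
  assumes "bounded S" "\<epsilon> > 0"
  obtains Y where "finite Y" "Y \<subseteq> S" "\<And>x. x \<in> S \<Longrightarrow> \<exists>y\<in>Y. norm (x - y) < \<epsilon>"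
proof -
  have "compact (closure S)" using assms(1) by simp
  moreover have "closure S \<subseteq> (\<Union>y\<in>S. ball y \<epsilon>)"
    using assms(2) by (auto simp: closure_approachable)
  ultimately obtain Y where Y: "Y \<subseteq> S" "finite Y" "closure S \<subseteq> (\<Union>y\<in>Y. ball y \<epsilon>)"
    by (rule compactE_image[OF _ open_ball])
  have "\<exists>y\<in>Y. norm (x - y) < \<epsilon>" if "x \<in> S" for x
    using Y(3) that closure_subset[of S] by (force simp: dist_norm norm_minus_commute)
  with Y show thesis by (intro that) auto
qed

text \<open>
  For a net \<open>Y\<close> of \<open>S\<close> with fineness \<open>\<epsilon>\<close>, the weight \<open>\<omega>\<close> is at most
  \<open>card Y powr (2 a / k) * exp (- 2 a d)\<close> on \<open>A\<close> and at least \<open>exp (- 4 a \<epsilon>)\<close> on \<open>S\<close>.  Both losses disappear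
  in the limit, provided that \<open>k\<close> tends to infinity before \<open>\<epsilon>\<close> tends to zero, because \<open>card Y\<close>
  depends on \<open>\<epsilon>\<close>.
\<close>

lemma heat_bound_bounded_target:
  fixes A S :: "(real^2) set"
  assumes heat: "(f, u) \<in> heat_semigroup \<alpha> B t" and t: "t > 0" and a: "a \<ge> 0"
    and fA: "\<And>x. x \<notin> A \<Longrightarrow> f x = 0" and g: "g \<in> l2_space lebesgue" and gS: "\<And>x. x \<notin> S \<Longrightarrow> g x = 0"
    and S: "bounded S" and d: "\<And>x y. x \<in> A \<Longrightarrow> y \<in> S \<Longrightarrow> d \<le> norm (x - y)"
  shows "cmod (l2_inner lebesgue u g) \<le> exp (a\<^sup>2 * t - a * d) * l2_norm lebesgue f * l2_norm lebesgue g"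
proof (cases "S = {}")
  case True
  then have "l2_inner lebesgue u g = 0" using gS by (simp add: l2_inner_def)
  then show ?thesis by simp
next
  case False
  have main: "cmod (l2_inner lebesgue u g)
      \<le> exp (2 * a * \<epsilon>) * (exp (a\<^sup>2 * t - a * d) * l2_norm lebesgue f * l2_norm lebesgue g)"
    if \<epsilon>: "\<epsilon> > 0" for \<epsilon> :: real
  proof -
    obtain Y where Y: "finite Y" "Y \<subseteq> S" "\<And>x. x \<in> S \<Longrightarrow> \<exists>y\<in>Y. norm (x - y) < \<epsilon>"
      using finite_net[OF S \<epsilon>] by blast
    then have Y0: "Y \<noteq> {}" using False by auto
    have card: "real (card Y) > 0" using Y(1) Y0 by (simp add: card_gt_0_iff)
    have step: "cmod (l2_inner lebesgue u g) \<le> real (card Y) powr (a / k) *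
       (exp (2 * a * \<epsilon>) * (exp (a\<^sup>2 * t - a * d) * l2_norm lebesgue f * l2_norm lebesgue g))"
      if k: "k > 0" for k :: real
    proof -
      interpret smooth_weight "soft_weight Y k \<epsilon> a" "real (card Y) powr (2 * a / k)"
        "\<lambda>x v. soft_sum_deriv Y k \<epsilon> x v * (2 * a / k * soft_sum Y k \<epsilon> x powr (2 * a / k - 1))" a
        by (rule soft_weight_smooth_weight[OF Y(1) Y0 \<epsilon> k a])
      note hb = heat_weighted_bound[OF heat less_imp_le[OF t]]
      define p where "p = 2 * a / k"
      have p: "p \<ge> 0" "k * p = 2 * a" using a k by (auto simp: p_def)
      have expp: "exp z powr p = exp (z * p)" for z by (simp add: powr_def mult.commute)
      have up: "soft_weight Y k \<epsilon> a x \<le> (real (card Y) powr (a / k) * exp (- a * d))\<^sup>2" if "x \<in> A" for x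
      proof -
        have "soft_sum Y k \<epsilon> x \<le> card Y * exp (- k * d)"
          using soft_sum_le_card[of k Y d x \<epsilon>] d[OF that] Y(2) k by auto
        then have "soft_weight Y k \<epsilon> a x \<le> (card Y * exp (- k * d)) powr p"
          unfolding soft_weight_def p_def[symmetric] using p soft_sum_pos[OF Y(1) Y0, of k \<epsilon> x]
          by (intro powr_mono2) auto
        also have "\<dots> = card Y powr p * exp (- k * d * p)" by (simp add: powr_mult expp)
        also have "- k * d * p = - (k * p) * d" by simp
        also have "card Y powr p = (real (card Y) powr (a / k))\<^sup>2"
          by (simp add: p_def power2_eq_square flip: powr_add)
        also have "exp (- (k * p) * d) = (exp (- a * d))\<^sup>2"
          unfolding p(2) by (simp add: power2_eq_square flip: exp_add)
        finally show ?thesis by (simp add: power_mult_distrib)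
      qed
      have low: "(exp (- 2 * a * \<epsilon>))\<^sup>2 \<le> soft_weight Y k \<epsilon> a x" if xS: "x \<in> S" for x
      proof -
        obtain y where y: "y \<in> Y" "norm (x - y) < \<epsilon>" using Y(3)[OF xS] by blast
        have "exp (- k * (2 * \<epsilon>)) \<le> exp (- k * rounded_dist \<epsilon> y x)"
          using rounded_dist_le[of x y \<epsilon>] y k by simp
        also have "\<dots> \<le> soft_sum Y k \<epsilon> x"
          unfolding soft_sum_def by (rule member_le_sum[OF y(1)]) (use Y in auto)
        finally have "exp (- k * (2 * \<epsilon>)) powr p \<le> soft_weight Y k \<epsilon> a x"
          unfolding soft_weight_def p_def[symmetric] using p by (intro powr_mono2) auto
        also have "exp (- k * (2 * \<epsilon>)) powr p = exp (- (k * p) * (2 * \<epsilon>))" by (simp add: expp)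
        also have "\<dots> = (exp (- 2 * a * \<epsilon>))\<^sup>2"
          unfolding p(2) by (simp add: power2_eq_square flip: exp_add)
        finally show ?thesis .
      qed
      have "weighted_norm f \<le> sqrt ((real (card Y) powr (a / k) * exp (- a * d))\<^sup>2) * l2_norm lebesgue f"
        by (rule weighted_norm_le_on[OF hb(1) fA up]) auto
      then have wf: "weighted_norm f \<le> real (card Y) powr (a / k) * exp (- a * d) * l2_norm lebesgue f" by simp
      have "cmod (l2_inner lebesgue u g) \<le> weighted_norm u * (l2_norm lebesgue g / sqrt ((exp (- 2 * a * \<epsilon>))\<^sup>2))"
        by (rule inner_le_weighted_norm[OF hb(2) g gS low]) auto
      also have "\<dots> = weighted_norm u * (exp (2 * a * \<epsilon>) * l2_norm lebesgue g)"
        unfolding real_sqrt_abs abs_exp_cancel by (simp add: exp_minus field_simps)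
      also have "\<dots> \<le> (exp (a\<^sup>2 * t) * (real (card Y) powr (a / k) * exp (- a * d) * l2_norm lebesgue f)) * (exp (2 * a * \<epsilon>) * l2_norm lebesgue g)"
        by (intro mult_right_mono order_trans[OF hb(3)] mult_left_mono wf) auto
      also have "\<dots> = real (card Y) powr (a / k) * (exp (2 * a * \<epsilon>) * ((exp (a\<^sup>2 * t) * exp (- a * d)) * l2_norm lebesgue f * l2_norm lebesgue g))"
        by (simp only: mult_ac)
      also have "exp (a\<^sup>2 * t) * exp (- a * d) = exp (a\<^sup>2 * t - a * d)" by (simp flip: exp_add)
      finally show ?thesis .
    qed
    have "(\<lambda>n. a * (1 / real (Suc n))) \<longlonglongrightarrow> a * 0"
      by (intro tendsto_intros) (use LIMSEQ_inverse_real_of_nat in \<open>simp add: inverse_eq_divide\<close>)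
    then have "(\<lambda>n. real (card Y) powr (a / real (Suc n))) \<longlonglongrightarrow> real (card Y) powr 0"
      using card by (intro tendsto_powr tendsto_const) auto
    then have "(\<lambda>n. real (card Y) powr (a / real (Suc n)) *
       (exp (2 * a * \<epsilon>) * (exp (a\<^sup>2 * t - a * d) * l2_norm lebesgue f * l2_norm lebesgue g)))
      \<longlonglongrightarrow> real (card Y) powr 0 * (exp (2 * a * \<epsilon>) * (exp (a\<^sup>2 * t - a * d) * l2_norm lebesgue f * l2_norm lebesgue g))"
      by (intro tendsto_mult tendsto_const)
    then have "cmod (l2_inner lebesgue u g) \<le> real (card Y) powr 0 * (exp (2 * a * \<epsilon>) * (exp (a\<^sup>2 * t - a * d) * l2_norm lebesgue f * l2_norm lebesgue g))"
      by (rule LIMSEQ_le_const) (use step[of "real (Suc n)" for n] in auto)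
    then show ?thesis using card by simp
  qed
  have "(\<lambda>n. exp (2 * a * (1 / real (Suc n))) * (exp (a\<^sup>2 * t - a * d) * l2_norm lebesgue f * l2_norm lebesgue g))
      \<longlonglongrightarrow> exp (2 * a * 0) * (exp (a\<^sup>2 * t - a * d) * l2_norm lebesgue f * l2_norm lebesgue g)"
    by (intro tendsto_intros) (use LIMSEQ_inverse_real_of_nat in \<open>simp add: inverse_eq_divide\<close>)
  then have "cmod (l2_inner lebesgue u g) \<le> exp (2 * a * 0) * (exp (a\<^sup>2 * t - a * d) * l2_norm lebesgue f * l2_norm lebesgue g)"
    by (rule LIMSEQ_le_const) (use main[of "1 / real (Suc n)" for n] in auto)
  then show ?thesis by simp
qed

lemma zero_ext_l2:
  assumes A: "A \<in> sets lebesgue" and f: "f \<in> l2_space (lebesgue_on A)"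
  shows "zero_ext A f \<in> l2_space lebesgue" "l2_norm lebesgue (zero_ext A f) = l2_norm (lebesgue_on A) f"
proof -
  have A': "A \<inter> space lebesgue \<in> sets lebesgue" using A by simp
  have z: "zero_ext A f = (\<lambda>x. indicator A x *\<^sub>R f x)" by (auto simp: zero_ext_def indicator_def)
  have sq: "(cmod (zero_ext A f x))\<^sup>2 = indicator A x *\<^sub>R (cmod (f x))\<^sup>2" for x
    by (simp add: zero_ext_def indicator_def)
  have "zero_ext A f \<in> borel_measurable lebesgue"
    unfolding z using l2_spaceD(1)[OF f] borel_measurable_restrict_space_iff[OF A', of f] by simp
  moreover have "integrable lebesgue (\<lambda>x. (cmod (zero_ext A f x))\<^sup>2)"
    unfolding sq using l2_spaceD(2)[OF f] integrable_restrict_space[OF A', of "\<lambda>x. (cmod (f x))\<^sup>2"] by simp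
  ultimately show "zero_ext A f \<in> l2_space lebesgue" by (simp add: l2_space_def)
  show "l2_norm lebesgue (zero_ext A f) = l2_norm (lebesgue_on A) f"
    unfolding l2_norm_def sq using integral_restrict_space[OF A', of "\<lambda>x. (cmod (f x))\<^sup>2"] by simp
qed

theorem proposition3p7:
  fixes \<alpha> B\<^sub>0 t :: real and A B :: "(real^2) set" and f g u :: "real^2 \<Rightarrow> complex"
  assumes "B\<^sub>0 > 0"
    and "A \<in> sets lebesgue" and "B \<in> sets lebesgue" and "A \<inter> B = {}"
    and "f \<in> l2_space (lebesgue_on A)" and "g \<in> l2_space (lebesgue_on B)"
    and "ess_support (zero_ext A f) \<subseteq> A" and "ess_support (zero_ext B g) \<subseteq> B"
    and "t > 0"
    and "(zero_ext A f, u) \<in> heat_semigroup \<alpha> B\<^sub>0 t"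
  shows "cmod (l2_inner lebesgue u (zero_ext B g))
    \<le> l2_norm (lebesgue_on A) f * l2_norm (lebesgue_on B) g * exp (- (setdist A B)\<^sup>2 / (4 * t))"
proof -
  note t = assms(9) and heat = assms(10)
  define F where "F = zero_ext A f"
  define G where "G = zero_ext B g"
  define d where "d = setdist A B"
  \<comment> \<open>This minimizes \<open>a\<^sup>2 t - a d\<close>.\<close>
  define a where "a = d / (2 * t)"
  have a: "a \<ge> 0" using t by (simp add: a_def d_def)
  have G: "G \<in> l2_space lebesgue" unfolding G_def by (rule zero_ext_l2[OF assms(3,6)])
  obtain E where "(F, u) \<in> spectral_integral lebesgue E (\<lambda>r. complex_of_real (exp (- t * r)))"
    using heat by (auto simp: F_def heat_semigroup_def functional_calculus_def)
  then have u: "u \<in> l2_space lebesgue" by (auto simp: spectral_integral_def)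
  \<comment> \<open>Finite nets exist for bounded sets only, so the target function is truncated.\<close>
  define Gn where "Gn n x = (if x \<in> cball 0 (real n) then G x else 0)" for n x
  have [measurable]: "G \<in> borel_measurable lebesgue" "u \<in> borel_measurable lebesgue"
    using l2_spaceD(1) G u by auto
  have cb[measurable]: "cball 0 r \<in> sets (lebesgue :: (real^2) measure)" for r by simp
  have [measurable]: "Gn n \<in> borel_measurable lebesgue" for n
    unfolding Gn_def by measurable
  have le: "cmod (Gn n x) \<le> cmod (G x)" for n x by (simp add: Gn_def)
  have sq_le: "(cmod (Gn n x))\<^sup>2 \<le> (cmod (G x))\<^sup>2" for n x by (intro power_mono le) simp
  have Gn: "Gn n \<in> l2_space lebesgue" for n
  proof -
    have "integrable lebesgue (\<lambda>x. (cmod (Gn n x))\<^sup>2)"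
      by (rule Bochner_Integration.integrable_bound[OF l2_spaceD(2)[OF G]]) (use sq_le in auto)
    then show ?thesis by (simp add: l2_space_def)
  qed
  have norm_le: "l2_norm lebesgue (Gn n) \<le> l2_norm lebesgue G" for n
    unfolding l2_norm_def real_sqrt_le_iff
    by (rule integral_mono[OF l2_spaceD(2)[OF Gn] l2_spaceD(2)[OF G] sq_le])
  have bound: "cmod (l2_inner lebesgue u (Gn n)) \<le> exp (a\<^sup>2 * t - a * d) * l2_norm lebesgue F * l2_norm lebesgue G" for n
  proof -
    have "cmod (l2_inner lebesgue u (Gn n)) \<le> exp (a\<^sup>2 * t - a * d) * l2_norm lebesgue F * l2_norm lebesgue (Gn n)"
    proof (rule heat_bound_bounded_target[of F u \<alpha> B\<^sub>0 t a A "Gn n" "B \<inter> cball 0 (real n)" d])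
      show "(F, u) \<in> heat_semigroup \<alpha> B\<^sub>0 t" using heat by (simp add: F_def)
      show "x \<notin> A \<Longrightarrow> F x = 0" for x by (simp add: F_def zero_ext_def)
      show "x \<notin> B \<inter> cball 0 (real n) \<Longrightarrow> Gn n x = 0" for x by (auto simp: Gn_def G_def zero_ext_def)
      show "bounded (B \<inter> cball 0 (real n))" by (rule bounded_subset[OF bounded_cball]) auto
      show "d \<le> norm (x - y)" if "x \<in> A" "y \<in> B \<inter> cball 0 (real n)" for x y
        using setdist_le_dist[of x A y B] that by (simp add: d_def dist_norm)
    qed (use t a Gn in auto)
    also have "\<dots> \<le> exp (a\<^sup>2 * t - a * d) * l2_norm lebesgue F * l2_norm lebesgue G"
      by (intro mult_left_mono norm_le) auto
    finally show ?thesis .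
  qed
  have "(\<lambda>n. l2_inner lebesgue u (Gn n)) \<longlonglongrightarrow> l2_inner lebesgue u G"
    unfolding l2_inner_def
  proof (rule integral_dominated_convergence)
    show "integrable lebesgue (\<lambda>x. norm (u x * cnj (G x)))"
      by (intro integrable_norm l2_product_integrable u G)
    show "AE x in lebesgue. (\<lambda>n. u x * cnj (Gn n x)) \<longlonglongrightarrow> u x * cnj (G x)"
    proof (rule AE_I2)
      fix x :: "real^2"
      obtain m :: nat where m: "norm x \<le> m" using real_arch_simple by blast
      have "\<forall>n\<ge>m. u x * cnj (Gn n x) = u x * cnj (G x)"
        using m by (auto simp: Gn_def)
      then show "(\<lambda>n. u x * cnj (Gn n x)) \<longlonglongrightarrow> u x * cnj (G x)"
        by (intro tendsto_eventually) (auto simp: eventually_sequentially)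
    qed
    show "AE x in lebesgue. norm (u x * cnj (Gn n x)) \<le> norm (u x * cnj (G x))" for n
      by (intro AE_I2) (simp add: norm_mult mult_left_mono le)
  qed measurable
  then have "(\<lambda>n. cmod (l2_inner lebesgue u (Gn n))) \<longlonglongrightarrow> cmod (l2_inner lebesgue u G)"
    by (rule tendsto_norm)
  then have "cmod (l2_inner lebesgue u G) \<le> exp (a\<^sup>2 * t - a * d) * l2_norm lebesgue F * l2_norm lebesgue G"
    by (rule LIMSEQ_le_const2) (use bound in auto)
  also have "a\<^sup>2 * t - a * d = - d\<^sup>2 / (4 * t)"
    using t by (simp add: a_def power2_eq_square field_simps)
  finally show ?thesis
    using zero_ext_l2(2)[OF assms(2,5)] zero_ext_l2(2)[OF assms(3,6)]
    by (simp add: F_def G_def d_def mult_ac)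
qed

end
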